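(* Let $\Sigma$ be a coherent subanalytic germ at $0$ of a closed subset of $\mathbb{R}^n$ with $0\in\Sigma$, and let $\varphi:(\mathbb{R}^n,0)\to(\mathbb{R}^n,0)$ be a real analytic map-germ. The following are equivalent: (1) for each $r\in\mathbb{N}$, $\varphi$ is $\Sigma$-$C^r$-rigid; (2) $\varphi$ is finitely $\Sigma$-$SV$-determined; (3) $\varphi$ is finitely $\Sigma$-$V$-determined; (4) $I_K(\varphi)$ is $\Sigma$-elliptic; (5) $\mathfrak{m}_\Sigma^\infty\subset I_K(\varphi)$; (6) $\mathfrak{m}_\Sigma^\infty\subset I_T(\varphi)$.
   Context: $\mathcal{E}(n)$ is the ring of germs at $0$ of $C^\infty$ functions on $\mathbb{R}^n$; $\mathcal{E}(n)^p$ the set of $C^\infty$ map-germs $(\mathbb{R}^n,0)\to(\mathbb{R}^p,0)$; $\mathcal{E}_{[r]}(n)$ the ring of $C^r$ function-germs and $\mathcal{E}_{[r]}(n)(\varphi)$ the ideal of it generated by the components of $\varphi$. $\mathfrak{m}_\Sigma$ is the ideal of germs in $\mathcal{E}(n)$ vanishing on $\Sigma$; $\Sigma$ is coherent if $\mathfrak{m}_\Sigma$ is finitely generated; $\mathfrak{m}_\Sigma^\infty$ is the ideal of germs flat on $\Sigma$. $j^kf(\Sigma;0)=j^kg(\Sigma;0)$ means the $k$-jets agree at all points of $\Sigma\cap U$ for some neighbourhood $U$ of $0$. $\mathcal{R}^{\mathrm{fix}}_\Sigma$ is the group of germs of homeomorphisms of $(\mathbb{R}^n,0)$ fixing $\Sigma$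 pointwise. $\varphi$ is $\Sigma$-$C^r$-rigid if there is $k$ such that for every $\psi$ with $j^k\psi(\Sigma;0)=j^k\varphi(\Sigma;0)$ some $\tau\in\mathcal{R}^{\mathrm{fix}}_\Sigma$ gives $\mathcal{E}_{[r]}(n)(\varphi\circ\tau)=\mathcal{E}_{[r]}(n)(\psi)$. $\Sigma$-$SV$-equivalence: $\varphi(f^{-1}(0))=g^{-1}(0)$ for some $\varphi\in\mathcal{R}^{\mathrm{fix}}_\Sigma$; $\Sigma$-$V$-equivalence: zero-set germs homeomorphic by a homeomorphism fixing $f^{-1}(0)\cap\Sigma$ pointwise. Finitely $\Sigma$-$SV$- (resp. $V$-) determined: there is $k$ such that every $C^\infty$ $g$ with $j^kg(\Sigma;0)=j^k\varphi(\Sigma;0)$ is $\Sigma$-$SV$- (resp. $V$-) equivalent to $\varphi$. $I_K(\varphi)$ is the ideal generated by $\varphi_1,\dots,\varphi_n$ and the Jacobian determinant $\det D\varphi$; since $n=p$, $I_T(\varphi)$ is the ideal generated by $\varphi_1,\dots,\varphi_n$. An ideal is $\Sigma$-elliptic if it contains $f$ with $|f(x)|\ge C\,d(x,\Sigma)^\alpha$ near $0$ for some $C,\alpha>0$. *)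

theory Defs
  imports "HOL-Analysis.Analysis"
begin

definition partial :: "'n::finite \<Rightarrow> (real^'n \<Rightarrow> real) \<Rightarrow> real^'n \<Rightarrow> real" where
  "partial i f x = deriv (\<lambda>t. f (x + t *\<^sub>R axis i 1)) 0"

fun pd :: "'n::finite list \<Rightarrow> (real^'n \<Rightarrow> real) \<Rightarrow> real^'n \<Rightarrow> real" where
  "pd [] f = f"
| "pd (i # ds) f = partial i (pd ds f)"

definition Ck_on :: "nat \<Rightarrow> (real^'n::finite) set \<Rightarrow> (real^'n \<Rightarrow> real) \<Rightarrow> bool" where
  "Ck_on k U f \<longleftrightarrow>
     (\<forall>ds. length ds \<le> k \<longrightarrow> continuous_on U (pd ds f)) \<and>
     (\<forall>ds i. length ds < k \<longrightarrow>
        (\<forall>x\<in>U. (\<lambda>t. pd ds f (x + t *\<^sub>R axis i 1)) differentiable (at 0)))"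

definition smooth_on :: "(real^'n::finite) set \<Rightarrow> (real^'n \<Rightarrow> real) \<Rightarrow> bool" where
  "smooth_on U f \<longleftrightarrow> (\<forall>k. Ck_on k U f)"

definition Cr_germ :: "nat \<Rightarrow> (real^'n::finite \<Rightarrow> real) \<Rightarrow> bool" where
  "Cr_germ r f \<longleftrightarrow> (\<exists>U. open U \<and> 0 \<in> U \<and> Ck_on r U f)"

definition smooth_germ :: "(real^'n::finite \<Rightarrow> real) \<Rightarrow> bool" where
  "smooth_germ f \<longleftrightarrow> (\<exists>U. open U \<and> 0 \<in> U \<and> smooth_on U f)"

definition smooth_map_germ :: "(real^'n::finite \<Rightarrow> real^'m::finite) \<Rightarrow> bool" where
  "smooth_map_germ g \<longleftrightarrow> (\<forall>i. smooth_germ (\<lambda>x. g x $ i))"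

definition comps :: "(real^'n::finite \<Rightarrow> real^'m::finite) \<Rightarrow> (real^'n \<Rightarrow> real) set" where
  "comps g = (\<lambda>i x. g x $ i) ` UNIV"

text \<open>Membership of (the germ of) f in the ideal generated by the finite set G of germs,
  in the ring of germs satisfying P (P = smooth_germ for E(n), P = Cr_germ r for E_[r](n)).\<close>
definition in_ideal :: "((real^'n::finite \<Rightarrow> real) \<Rightarrow> bool) \<Rightarrow> (real^'n \<Rightarrow> real)
     \<Rightarrow> (real^'n \<Rightarrow> real) set \<Rightarrow> bool" where
  "in_ideal P f G \<longleftrightarrow> (\<exists>h. (\<forall>g\<in>G. P (h g)) \<and>
       (\<forall>\<^sub>F x in nhds 0. f x = (\<Sum>g\<in>G. h g x * g x)))"

definition set_germ_eq :: "(real^'n::finite) set \<Rightarrow> (real^'n) set \<Rightarrow> bool" where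
  "set_germ_eq A B \<longleftrightarrow> (\<exists>W. open W \<and> 0 \<in> W \<and> A \<inter> W = B \<inter> W)"

definition vanishes_near :: "(real^'n::finite) set \<Rightarrow> (real^'n \<Rightarrow> real) \<Rightarrow> bool" where
  "vanishes_near \<Sigma> f \<longleftrightarrow> (\<exists>U. open U \<and> 0 \<in> U \<and> (\<forall>x\<in>\<Sigma> \<inter> U. f x = 0))"

definition coherent :: "(real^'n::finite) set \<Rightarrow> bool" where
  "coherent \<Sigma> \<longleftrightarrow> (\<exists>G. finite G \<and> (\<forall>g\<in>G. smooth_germ g \<and> vanishes_near \<Sigma> g) \<and>
      (\<forall>f. smooth_germ f \<and> vanishes_near \<Sigma> f \<longrightarrow> in_ideal smooth_germ f G))"

definition flat_on :: "(real^'n::finite) set \<Rightarrow> (real^'n \<Rightarrow> real) \<Rightarrow> bool" where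
  "flat_on \<Sigma> f \<longleftrightarrow> smooth_germ f \<and>
     (\<exists>U. open U \<and> 0 \<in> U \<and> (\<forall>x\<in>\<Sigma> \<inter> U. \<forall>ds. pd ds f x = 0))"

definition flat_subset :: "(real^'n::finite) set \<Rightarrow> (real^'n \<Rightarrow> real) set \<Rightarrow> bool" where
  "flat_subset \<Sigma> G \<longleftrightarrow> (\<forall>f. flat_on \<Sigma> f \<longrightarrow> in_ideal smooth_germ f G)"

definition jet_eq :: "nat \<Rightarrow> (real^'n::finite) set \<Rightarrow> (real^'n \<Rightarrow> real^'m::finite)
     \<Rightarrow> (real^'n \<Rightarrow> real^'m) \<Rightarrow> bool" where
  "jet_eq k \<Sigma> g \<phi> \<longleftrightarrow> (\<exists>U. open U \<and> 0 \<in> U \<and>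
     (\<forall>x\<in>\<Sigma> \<inter> U. \<forall>i ds. length ds \<le> k \<longrightarrow>
        pd ds (\<lambda>y. g y $ i) x = pd ds (\<lambda>y. \<phi> y $ i) x))"

definition R_fix_on :: "(real^'n::finite) set \<Rightarrow> (real^'n) set \<Rightarrow> (real^'n) set
     \<Rightarrow> (real^'n \<Rightarrow> real^'n) \<Rightarrow> (real^'n \<Rightarrow> real^'n) \<Rightarrow> bool" where
  "R_fix_on \<Sigma> U V \<tau> \<tau>' \<longleftrightarrow> open U \<and> open V \<and> 0 \<in> U \<and> homeomorphism U V \<tau> \<tau>' \<and>
     \<tau> 0 = 0 \<and> (\<forall>x\<in>\<Sigma> \<inter> U. \<tau> x = x)"

definition R_fix :: "(real^'n::finite) set \<Rightarrow> (real^'n \<Rightarrow> real^'n) \<Rightarrow> bool" where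
  "R_fix \<Sigma> \<tau> \<longleftrightarrow> (\<exists>U V \<tau>'. R_fix_on \<Sigma> U V \<tau> \<tau>')"

definition Cr_rigid :: "nat \<Rightarrow> (real^'n::finite) set \<Rightarrow> (real^'n \<Rightarrow> real^'m::finite) \<Rightarrow> bool" where
  "Cr_rigid r \<Sigma> \<phi> \<longleftrightarrow> (\<exists>k. \<forall>\<psi>. smooth_map_germ \<psi> \<and> jet_eq k \<Sigma> \<psi> \<phi> \<longrightarrow>
     (\<exists>\<tau>. R_fix \<Sigma> \<tau> \<and>
        (\<forall>f. in_ideal (Cr_germ r) f (comps (\<phi> \<circ> \<tau>)) \<longleftrightarrow> in_ideal (Cr_germ r) f (comps \<psi>))))"

definition SV_equiv :: "(real^'n::finite) set \<Rightarrow> (real^'n \<Rightarrow> real^'m::finite)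
     \<Rightarrow> (real^'n \<Rightarrow> real^'m) \<Rightarrow> bool" where
  "SV_equiv \<Sigma> f g \<longleftrightarrow> (\<exists>U V \<tau> \<tau>'. R_fix_on \<Sigma> U V \<tau> \<tau>' \<and>
     set_germ_eq (\<tau> ` ({x. f x = 0} \<inter> U)) {x. g x = 0})"

definition V_equiv :: "(real^'n::finite) set \<Rightarrow> (real^'n \<Rightarrow> real^'m::finite)
     \<Rightarrow> (real^'n \<Rightarrow> real^'m) \<Rightarrow> bool" where
  "V_equiv \<Sigma> f g \<longleftrightarrow> (\<exists>W1 W2 h h'. open W1 \<and> open W2 \<and> 0 \<in> W1 \<and> 0 \<in> W2 \<and>
     homeomorphism ({x. f x = 0} \<inter> W1) ({x. g x = 0} \<inter> W2) h h' \<and>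
     (\<forall>x\<in>{x. f x = 0} \<inter> \<Sigma> \<inter> W1. h x = x))"

definition fin_SV_det :: "(real^'n::finite) set \<Rightarrow> (real^'n \<Rightarrow> real^'m::finite) \<Rightarrow> bool" where
  "fin_SV_det \<Sigma> \<phi> \<longleftrightarrow> (\<exists>k. \<forall>g. smooth_map_germ g \<and> jet_eq k \<Sigma> g \<phi> \<longrightarrow> SV_equiv \<Sigma> \<phi> g)"

definition fin_V_det :: "(real^'n::finite) set \<Rightarrow> (real^'n \<Rightarrow> real^'m::finite) \<Rightarrow> bool" where
  "fin_V_det \<Sigma> \<phi> \<longleftrightarrow> (\<exists>k. \<forall>g. smooth_map_germ g \<and> jet_eq k \<Sigma> g \<phi> \<longrightarrow> V_equiv \<Sigma> \<phi> g)"

definition jac :: "(real^'n::finite \<Rightarrow> real^'n) \<Rightarrow> real^'n \<Rightarrow> real" where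
  "jac \<phi> x = det (\<chi> i j. partial j (\<lambda>y. \<phi> y $ i) x)"

definition I_K :: "(real^'n::finite \<Rightarrow> real^'n) \<Rightarrow> (real^'n \<Rightarrow> real) set" where
  "I_K \<phi> = comps \<phi> \<union> {jac \<phi>}"

definition I_T :: "(real^'n::finite \<Rightarrow> real^'n) \<Rightarrow> (real^'n \<Rightarrow> real) set" where
  "I_T \<phi> = comps \<phi>"

definition elliptic :: "(real^'n::finite) set \<Rightarrow> (real^'n \<Rightarrow> real) set \<Rightarrow> bool" where
  "elliptic \<Sigma> G \<longleftrightarrow> (\<exists>f. smooth_germ f \<and> in_ideal smooth_germ f G \<and>
     (\<exists>C \<alpha>. C > 0 \<and> \<alpha> > 0 \<and> (\<forall>\<^sub>F x in nhds 0. \<bar>f x\<bar> \<ge> C * infdist x \<Sigma> powr \<alpha>)))"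

definition real_analytic_germ :: "(real^'n::finite \<Rightarrow> real) \<Rightarrow> bool" where
  "real_analytic_germ f \<longleftrightarrow> (\<exists>r>0. \<exists>c :: ('n \<Rightarrow> nat) \<Rightarrow> real. \<forall>x\<in>ball 0 r.
     ((\<lambda>\<alpha>. c \<alpha> * (\<Prod>i\<in>UNIV. (x $ i) ^ (\<alpha> i))) has_sum f x) UNIV)"

definition analytic_map_germ :: "(real^'n::finite \<Rightarrow> real^'m::finite) \<Rightarrow> bool" where
  "analytic_map_germ \<phi> \<longleftrightarrow> (\<forall>i. real_analytic_germ (\<lambda>x. \<phi> x $ i))"

definition Rsp :: "nat \<Rightarrow> (nat \<Rightarrow> real) set" where
  "Rsp N = {x. \<forall>i\<ge>N. x i = 0}"

definition nball :: "nat \<Rightarrow> (nat \<Rightarrow> real) \<Rightarrow> real \<Rightarrow> (nat \<Rightarrow> real) set" where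
  "nball N a r = {x \<in> Rsp N. (\<Sum>i<N. (x i - a i)^2) < r^2}"

definition analytic_near :: "nat \<Rightarrow> ((nat \<Rightarrow> real) \<Rightarrow> real) \<Rightarrow> (nat \<Rightarrow> real) set \<Rightarrow> bool" where
  "analytic_near N f U \<longleftrightarrow> (\<forall>a\<in>U. \<exists>r>0. \<exists>c :: (nat \<Rightarrow> nat) \<Rightarrow> real.
     \<forall>x\<in>nball N a r. ((\<lambda>\<alpha>. c \<alpha> * (\<Prod>i<N. (x i - a i) ^ (\<alpha> i))) has_sum f x) {\<alpha>. \<forall>i\<ge>N. \<alpha> i = 0})"

definition semianalytic :: "nat \<Rightarrow> (nat \<Rightarrow> real) set \<Rightarrow> bool" where
  "semianalytic N S \<longleftrightarrow> S \<subseteq> Rsp N \<and> (\<forall>a\<in>Rsp N. \<exists>r>0.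
     \<exists>L :: (((nat \<Rightarrow> real) \<Rightarrow> real) list \<times> ((nat \<Rightarrow> real) \<Rightarrow> real) list) list.
       (\<forall>(E, P)\<in>set L. \<forall>f\<in>set E \<union> set P. analytic_near N f (nball N a r)) \<and>
       S \<inter> nball N a r = {x \<in> nball N a r. \<exists>(E, P)\<in>set L. (\<forall>f\<in>set E. f x = 0) \<and> (\<forall>g\<in>set P. 0 < g x)})"

definition subanalytic :: "nat \<Rightarrow> (nat \<Rightarrow> real) set \<Rightarrow> bool" where
  "subanalytic N X \<longleftrightarrow> X \<subseteq> Rsp N \<and> (\<forall>a\<in>Rsp N. \<exists>r>0. \<exists>m S.
     semianalytic (N + m) S \<and> (\<exists>R. S \<subseteq> nball (N + m) (\<lambda>_. 0) R) \<and>
     X \<inter> nball N a r = (\<lambda>x i. if i < N then x i else 0) ` S)"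

definition enum_idx :: "nat \<Rightarrow> 'n::finite" where
  "enum_idx = (SOME e. bij_betw e {..<CARD('n)} UNIV)"

definition emb :: "real^'n::finite \<Rightarrow> (nat \<Rightarrow> real)" where
  "emb x = (\<lambda>i. if i < CARD('n) then x $ enum_idx i else 0)"

definition subanalytic_germ :: "(real^'n::finite) set \<Rightarrow> bool" where
  "subanalytic_germ \<Sigma> \<longleftrightarrow> (\<exists>X. subanalytic CARD('n) (emb ` X) \<and> set_germ_eq X \<Sigma>)"

end

theory Submission
  imports Defs "HOL-Complex_Analysis.Complex_Analysis"
begin

text \<open>
  Write \<open>d\<close> for the distance to \<open>\<Sigma>\<close>. All six conditions are equivalent to the inequality
  \<open>\<bar>\<phi>\<bar> \<ge> C d\<^sup>N\<close> near the origin.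

  It implies rigidity already with \<open>\<tau> = id\<close>: if the jets of \<open>\<psi>\<close> and \<open>\<phi>\<close> agree to high order along
  \<open>\<Sigma>\<close>, then \<open>\<psi> - \<phi> = A \<phi>\<close> where the matrix \<open>A = (\<psi> - \<phi>) \<phi>\<^sup>T / \<bar>\<phi>\<bar>\<^sup>2\<close> extends by zero over \<open>\<Sigma>\<close> as
  a \<open>C\<^sup>r\<close> function. If a finitely generated ideal violates such an inequality, flat bumps along a
  sequence tending to the origin give a flat function outside the ideal.

  The analytic input is that isolated zeros of a real analytic map germ do not accumulate at the
  origin (Weierstrass division and induction on the dimension). If \<open>\<bar>\<phi>\<bar>\<close> is smaller than every power
  of \<open>d\<close> along a sequence, a flat perturbation of \<open>\<phi>\<close> acquires nondegenerate zeros along it, which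
  contradicts \<open>V\<close>-determinacy. If moreover the Jacobian determinant is bounded below by a power of
  \<open>d\<close> there, then Newton iteration finds nondegenerate zeros of \<open>\<phi>\<close> itself, so ellipticity of
  \<open>I_K \<phi>\<close> forces the inequality.
\<close>

section \<open>Functions holomorphic along complex lines\<close>

text \<open>\<open>V\<close>-equivalence preserves only the topology of the zero sets, so necessity
  has to rest on a topological property of a zero: being isolated. Zeros are therefore made
  nondegenerate, and the homeomorphism fixes the origin as a zero lying on \<Sigma>, so the
  transported zeros still tend to it. The Jacobian works by the same mechanism: where
  \<open>I_K\<close> satisfies the inequality, a zero of \<open>\<phi>\<close> off \<Sigma> has
  nonzero Jacobian and is isolated. The accumulation theorem eliminates one direction at a time and
  must keep all coefficients analytic. This is why real germs are extended to complex arguments: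
  uniform limits preserve holomorphy there, and real parts on real points lead back. For sufficiency
  the loss is counted in powers of the distance \<open>d\<close>: dividing by the sum of squares of
  the generators costs \<open>d^(2N)\<close>, and each derivative costs \<open>d^(2N)\<close> again.
  Bumps have size \<open>\<delta>^j\<close> at scale \<open>\<delta>\<close>, which beats the loss
  \<open>\<delta>^(-m)\<close> of any fixed number \<open>m\<close> of derivatives. Their centres
  are chosen inductively, each closer to the origin than a quarter of the distance of its
  predecessor to \<Sigma>, so that bumps do not interfere.\<close>

lemma norm_scalar_mult_complex: "norm (c *s (x::complex^'n::finite)) = norm c * norm x"
proof -
  have "norm (c *s x) = L2_set (\<lambda>i. norm c * norm (x $ i)) UNIV"
    by (simp add: norm_vec_def norm_mult)
  also have "\<dots> = norm c * norm x"
    by (simp add: norm_vec_def L2_set_right_distrib)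
  finally show ?thesis .
qed

lemma continuous_on_line [continuous_intros]:
  fixes z v :: "complex^'n::finite"
  shows "continuous_on A (\<lambda>t. z + t *s v)"
proof -
  have "continuous_on A (\<lambda>t. t *s v)"
    unfolding vector_scalar_mult_def by (intro continuous_intros)
  then show ?thesis by (intro continuous_intros)
qed

lemma open_line_vimage:
  fixes z v :: "complex^'n::finite"
  assumes "open U" shows "open {t. z + t *s v \<in> U}"
  using continuous_on_line[of UNIV z v] assms by (auto simp: continuous_on_open_vimage vimage_def)

text \<open>Continuity together with holomorphy on every complex line, which for open
  \<open>U\<close> is holomorphy in several variables. In this form closure under algebra and under
  uniform limits is inherited from one variable.\<close>

definition hol_on :: "(complex^'n::finite) set \<Rightarrow> (complex^'n \<Rightarrow> complex) \<Rightarrow> bool" where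
  "hol_on U F \<longleftrightarrow> continuous_on U F \<and>
     (\<forall>z v. (\<lambda>t. F (z + t *s v)) holomorphic_on {t. z + t *s v \<in> U})"

lemma hol_onD:
  assumes "hol_on U F"
  shows "continuous_on U F" "(\<lambda>t. F (z + t *s v)) holomorphic_on {t. z + t *s v \<in> U}"
  using assms by (auto simp: hol_on_def)

lemma hol_on_subset: "hol_on U F \<Longrightarrow> V \<subseteq> U \<Longrightarrow> hol_on V F"
  unfolding hol_on_def by (auto intro: continuous_on_subset holomorphic_on_subset)

lemma hol_on_const: "hol_on U (\<lambda>z. c)"
  by (auto simp: hol_on_def)

lemma hol_on_add: "hol_on U F \<Longrightarrow> hol_on U G \<Longrightarrow> hol_on U (\<lambda>z. F z + G z)"
  by (auto simp: hol_on_def intro!: continuous_intros holomorphic_intros)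

lemma hol_on_diff: "hol_on U F \<Longrightarrow> hol_on U G \<Longrightarrow> hol_on U (\<lambda>z. F z - G z)"
  by (auto simp: hol_on_def intro!: continuous_intros holomorphic_intros)

lemma hol_on_mult: "hol_on U F \<Longrightarrow> hol_on U G \<Longrightarrow> hol_on U (\<lambda>z. F z * G z)"
  by (auto simp: hol_on_def intro!: continuous_intros holomorphic_intros)

lemma hol_on_divide:
  "hol_on U F \<Longrightarrow> hol_on U G \<Longrightarrow> (\<And>z. z \<in> U \<Longrightarrow> G z \<noteq> 0) \<Longrightarrow> hol_on U (\<lambda>z. F z / G z)"
  by (auto simp: hol_on_def intro!: continuous_intros holomorphic_intros)

lemma hol_on_sum: "(\<And>i. i \<in> I \<Longrightarrow> hol_on U (F i)) \<Longrightarrow> hol_on U (\<lambda>z. \<Sum>i\<in>I. F i z)"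
  by (induction I rule: infinite_finite_induct) (auto intro: hol_on_const hol_on_add)

lemma hol_on_prod: "(\<And>i. i \<in> I \<Longrightarrow> hol_on U (F i)) \<Longrightarrow> hol_on U (\<lambda>z. \<Prod>i\<in>I. F i z)"
  by (induction I rule: infinite_finite_induct) (auto intro: hol_on_const hol_on_mult)

lemma hol_on_power: "hol_on U F \<Longrightarrow> hol_on U (\<lambda>z. F z ^ k)"
  by (auto simp: hol_on_def intro!: continuous_intros holomorphic_intros)

lemma hol_on_component: "hol_on U (\<lambda>z. z $ i)"
  by (auto simp: hol_on_def intro!: continuous_intros holomorphic_intros)

lemma hol_on_translate:
  assumes "hol_on U F" shows "hol_on {z. z + a \<in> U} (\<lambda>z. F (z + a))"
proof -
  have "continuous_on {z. z + a \<in> U} (\<lambda>z. F (z + a))"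
    by (rule continuous_on_compose2[OF hol_onD(1)[OF assms]]) (auto intro!: continuous_intros)
  moreover have "(\<lambda>t. F (z + t *s v + a)) holomorphic_on {t. z + t *s v \<in> {z. z + a \<in> U}}" for z v
    using hol_onD(2)[OF assms, of "z + a" v] by (simp add: algebra_simps)
  ultimately show ?thesis by (auto simp: hol_on_def)
qed

lemma hol_on_local:
  assumes "\<And>z. z \<in> U \<Longrightarrow> \<exists>N. open N \<and> z \<in> N \<and> hol_on N F"
  shows "hol_on U F"
  unfolding hol_on_def
proof (intro conjI allI)
  have "isCont F z" if "z \<in> U" for z
    using assms[OF that] hol_onD(1) continuous_on_eq_continuous_at by blast
  then show "continuous_on U F"
    by (simp add: continuous_at_imp_continuous_on)
  fix z v
  show "(\<lambda>t. F (z + t *s v)) holomorphic_on {t. z + t *s v \<in> U}"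
    unfolding holomorphic_on_def
  proof
    fix t assume "t \<in> {t. z + t *s v \<in> U}"
    then obtain N where N: "open N" "z + t *s v \<in> N" "hol_on N F"
      using assms by blast
    have "(\<lambda>t. F (z + t *s v)) field_differentiable at t"
      using holomorphic_on_imp_differentiable_at[OF hol_onD(2)[OF N(3)] open_line_vimage[OF N(1)]] N(2)
      by blast
    then show "(\<lambda>t. F (z + t *s v)) field_differentiable at t within {t. z + t *s v \<in> U}"
      by (rule field_differentiable_at_within)
  qed
qed

text \<open>The one-variable theorem on a closed disc inside each line. The filter is arbitrary
  because the lemma serves sequences of difference quotients and of iterates as well as the net of
  finite partial sums of a power series.\<close>

lemma hol_on_uniform_limit:
  assumes U: "open U" and ev: "eventually (\<lambda>n. hol_on U (Fn n)) L"
    and ul: "uniform_limit U Fn F L" and L: "L \<noteq> bot"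
  shows "hol_on U F"
  unfolding hol_on_def
proof (intro conjI allI)
  show "continuous_on U F"
    by (rule uniform_limit_theorem[OF _ ul L]) (use ev in \<open>auto elim!: eventually_mono dest: hol_onD(1)\<close>)
  fix z v
  let ?T = "{t. z + t *s v \<in> U}"
  have ul': "uniform_limit ?T (\<lambda>n t. Fn n (z + t *s v)) (\<lambda>t. F (z + t *s v)) L"
    unfolding uniform_limit_iff
  proof (intro allI impI)
    fix e :: real assume "e > 0"
    then have "\<forall>\<^sub>F n in L. \<forall>x\<in>U. dist (Fn n x) (F x) < e"
      using ul by (simp add: uniform_limit_iff)
    then show "\<forall>\<^sub>F n in L. \<forall>t\<in>?T. dist (Fn n (z + t *s v)) (F (z + t *s v)) < e"
      by eventually_elim auto
  qed
  show "(\<lambda>t. F (z + t *s v)) holomorphic_on ?T"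
    unfolding holomorphic_on_def
  proof
    fix t assume "t \<in> ?T"
    then obtain r where r: "r > 0" "cball t r \<subseteq> ?T"
      using open_line_vimage[OF U] open_contains_cball by metis
    have u: "uniform_limit (cball t r) (\<lambda>n t. Fn n (z + t *s v)) (\<lambda>t. F (z + t *s v)) L"
      by (rule uniform_limit_on_subset[OF ul' r(2)])
    have c: "\<forall>\<^sub>F n in L. continuous_on (cball t r) (\<lambda>t. Fn n (z + t *s v)) \<and>
        (\<lambda>t. Fn n (z + t *s v)) holomorphic_on ball t r"
      using ev
    proof eventually_elim
      case (elim n)
      have "(\<lambda>t. Fn n (z + t *s v)) holomorphic_on cball t r"
        using hol_onD(2)[OF elim] r(2) holomorphic_on_subset by blast
      then show ?case
        using holomorphic_on_imp_continuous_on holomorphic_on_subset ball_subset_cball by blast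
    qed
    have "(\<lambda>t. F (z + t *s v)) holomorphic_on ball t r"
      by (rule holomorphic_uniform_limit[OF c u L])
    then have "(\<lambda>t. F (z + t *s v)) field_differentiable at t"
      using r(1) by (simp add: holomorphic_on_imp_differentiable_at)
    then show "(\<lambda>t. F (z + t *s v)) field_differentiable at t within ?T"
      by (rule field_differentiable_at_within)
  qed
qed

text \<open>First-order Taylor expansion, the second derivative being estimated by Cauchy's
  inequality on discs of radius \<open>s/2\<close>: the constant is \<open>2! B / (s/2)^2\<close>.
  It depends on \<open>g\<close> through \<open>B\<close> only, which makes the estimate uniform in
  a base point.\<close>

lemma difference_quotient_bound:
  fixes g :: "complex \<Rightarrow> complex"
  assumes g: "g holomorphic_on ball 0 (2 * s)" and s: "s > 0"
    and B: "\<And>t. t \<in> ball 0 (2 * s) \<Longrightarrow> norm (g t) \<le> B" and h: "norm h < s" "h \<noteq> 0"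
  shows "norm ((g h - g 0) / h - deriv g 0) \<le> 8 * B / s\<^sup>2 * norm h"
proof -
  have cau: "norm ((deriv ^^ 2) g x) \<le> fact 2 * B / (s/2)^2" if "x \<in> ball 0 s" for x
  proof (rule Cauchy_inequality)
    have sub: "cball x (s/2) \<subseteq> ball 0 (2 * s)"
      using that s by (auto simp: dist_norm) (smt (verit) norm_triangle_sub norm_minus_commute)
    show "g holomorphic_on ball x (s/2)"
      using g sub holomorphic_on_subset ball_subset_cball by (meson subset_trans)
    show "continuous_on (cball x (s/2)) g"
      using g sub holomorphic_on_subset holomorphic_on_imp_continuous_on by blast
    show "\<And>y. norm (x - y) = s/2 \<Longrightarrow> norm (g y) \<le> B"
      using sub B by (auto simp: subset_iff dist_norm)
  qed (use s in auto)
  define f where "f i = (deriv ^^ i) g" for i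
  have der: "(f i has_field_derivative f (Suc i) x) (at x within ball 0 s)" if "x \<in> ball 0 s" for i x
  proof -
    have "f i holomorphic_on ball 0 (2 * s)"
      unfolding f_def using g by (intro holomorphic_higher_deriv) auto
    then have "(f i has_field_derivative deriv (f i) x) (at x)"
      using that s by (intro holomorphic_derivI) auto
    then show ?thesis
      by (auto simp: f_def intro: has_field_derivative_at_within)
  qed
  have "norm (f 0 h - (\<Sum>i\<le>1. f i 0 * (h - 0) ^ i / fact i)) \<le> (8 * B / s\<^sup>2) * norm (h - 0) ^ (Suc 1) / fact 1"
  proof (rule complex_Taylor[of "ball 0 s"])
    show "\<And>x. x \<in> ball 0 s \<Longrightarrow> cmod (f (Suc 1) x) \<le> 8 * B / s\<^sup>2"
      using cau by (simp add: f_def numeral_2_eq_2 power_divide field_simps)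
  qed (use der h s in auto)
  then have *: "norm (g h - g 0 - deriv g 0 * h) \<le> (8 * B / s\<^sup>2) * (norm h)\<^sup>2"
    by (simp add: f_def algebra_simps power2_eq_square)
  have "(g h - g 0) / h - deriv g 0 = (g h - g 0 - deriv g 0 * h) / h"
    using h by (simp add: field_simps)
  then have "norm ((g h - g 0) / h - deriv g 0) = norm (g h - g 0 - deriv g 0 * h) / norm h"
    by (simp add: norm_divide)
  also have "\<dots> \<le> (8 * B / s\<^sup>2) * (norm h)\<^sup>2 / norm h"
    using * by (intro divide_right_mono) auto
  finally show ?thesis
    using h by (simp add: power2_eq_square)
qed

definition dirderiv :: "complex^'n::finite \<Rightarrow> (complex^'n \<Rightarrow> complex) \<Rightarrow> complex^'n \<Rightarrow> complex" where
  "dirderiv v F z = deriv (\<lambda>t. F (z + t *s v)) 0"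

text \<open>Difference quotients with steps \<open>1/(m+1)\<close> are \<open>hol_on\<close> by
  translation and algebra. The previous bound involves the base point only through a local bound of
  \<open>F\<close>, so they converge locally uniformly.\<close>

lemma hol_on_dirderiv:
  fixes v :: "complex^'n::finite"
  assumes U: "open U" and F: "hol_on U F"
  shows "hol_on U (dirderiv v F)"
proof (rule hol_on_local)
  fix z0 assume z0: "z0 \<in> U"
  obtain e0 where e0: "e0 > 0" "ball z0 e0 \<subseteq> U"
    using U z0 open_contains_ball by blast
  have "isCont F z0"
    using F z0 U continuous_on_eq_continuous_at hol_onD(1) by blast
  then obtain e1 where e1: "e1 > 0" "\<And>z. dist z z0 < e1 \<Longrightarrow> dist (F z) (F z0) < 1"
    unfolding continuous_at by (metis Lim_at dist_self dist_pos_lt zero_less_one continuous_at_eps_delta \<open>isCont F z0\<close>)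
  define e where "e = min e0 e1 / 2"
  have e: "e > 0" "ball z0 (2*e) \<subseteq> U" and eB: "\<And>z. z \<in> ball z0 (2*e) \<Longrightarrow> norm (F z) \<le> norm (F z0) + 1"
  proof -
    show "e > 0" using e0 e1 by (simp add: e_def)
    show "ball z0 (2*e) \<subseteq> U" using e0(2) by (auto simp: e_def)
    fix z assume "z \<in> ball z0 (2*e)"
    then have "dist (F z) (F z0) < 1" using e1(2)[of z] by (auto simp: e_def dist_commute)
    then show "norm (F z) \<le> norm (F z0) + 1"
      by (smt (verit) dist_norm norm_triangle_sub)
  qed
  \<comment> \<open>Parameters of modulus below \<open>2 * s\<close> move the point by less than
    \<open>e\<close>; the summand 1 covers \<open>v = 0\<close>.\<close>
  define s where "s = e / (2 * (norm v + 1))"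
  have s: "s > 0" using e by (simp add: s_def add_nonneg_pos)
  have sv: "norm (t *s v) < e" if "norm t < 2 * s" for t
  proof -
    have "norm (t *s v) \<le> norm t * (norm v + 1)"
      by (simp add: norm_scalar_mult_complex mult_left_mono)
    also have "\<dots> < 2 * s * (norm v + 1)"
      using that by (intro mult_strict_right_mono) (auto simp: add_nonneg_pos)
    also have "\<dots> = e"
    proof -
      have "norm v + 1 \<noteq> 0" using norm_ge_zero[of v] by linarith
      then show ?thesis by (simp add: s_def nonzero_eq_divide_eq divide_eq_eq)
    qed
    finally show ?thesis .
  qed
  define B where "B = norm (F z0) + 1"
  define h :: "nat \<Rightarrow> complex" where "h m = of_real (1 / real (Suc m))" for m
  define D where "D m z = (F (z + h m *s v) - F z) / h m" for m z
  have h0: "h m \<noteq> 0" for m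
    unfolding h_def of_real_eq_0_iff by simp
  have hlim: "(\<lambda>m. norm (h m)) \<longlonglongrightarrow> 0"
    unfolding h_def by (simp only: norm_of_real) (use LIMSEQ_inverse_real_of_nat in \<open>simp add: inverse_eq_divide\<close>)
  have ball1: "z + t *s v \<in> ball z0 (2*e)" if "z \<in> ball z0 e" "norm t < 2 * s" for z t
  proof -
    have "dist z0 (z + t *s v) \<le> dist z0 z + norm (t *s v)"
      by (metis add.commute dist_norm dist_triangle norm_minus_commute add_diff_cancel_left')
    then show ?thesis using that sv[OF that(2)] by auto
  qed
  have evs: "\<forall>\<^sub>F m in sequentially. norm (h m) < s"
    using order_tendstoD(2)[OF hlim s] .
  have bound: "norm (D m z - dirderiv v F z) \<le> 8 * B / s\<^sup>2 * norm (h m)"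
    if "norm (h m) < s" "z \<in> ball z0 e" for m z
  proof -
    let ?g = "\<lambda>t. F (z + t *s v)"
    have sub: "ball 0 (2 * s) \<subseteq> {t. z + t *s v \<in> U}"
      using ball1[OF that(2)] e(2) by auto
    have "norm ((?g (h m) - ?g 0) / h m - deriv ?g 0) \<le> 8 * B / s\<^sup>2 * norm (h m)"
    proof (rule difference_quotient_bound)
      show "?g holomorphic_on ball 0 (2 * s)"
        using hol_onD(2)[OF F] sub holomorphic_on_subset by blast
      show "\<And>t. t \<in> ball 0 (2 * s) \<Longrightarrow> norm (F (z + t *s v)) \<le> B"
        unfolding B_def using ball1[OF that(2)] eB by auto
    qed (use that s h0 in auto)
    then show ?thesis by (simp add: D_def dirderiv_def)
  qed
  have ul: "uniform_limit (ball z0 e) D (dirderiv v F) sequentially"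
  proof (rule uniform_limitI)
    fix \<epsilon> :: real assume "\<epsilon> > 0"
    have "(\<lambda>m. 8 * B / s\<^sup>2 * norm (h m)) \<longlonglongrightarrow> 8 * B / s\<^sup>2 * 0"
      by (intro tendsto_mult_left hlim)
    then have "\<forall>\<^sub>F m in sequentially. 8 * B / s\<^sup>2 * norm (h m) < \<epsilon>"
      using \<open>\<epsilon> > 0\<close> order_tendstoD(2) by fastforce
    with evs show "\<forall>\<^sub>F m in sequentially. \<forall>z\<in>ball z0 e. dist (D m z) (dirderiv v F z) < \<epsilon>"
    proof eventually_elim
      case (elim m)
      then show ?case
        unfolding dist_norm using le_less_trans[OF bound[OF elim(1)] elim(2)] by blast
    qed
  qed
  have ev: "\<forall>\<^sub>F m in sequentially. hol_on (ball z0 e) (D m)"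
    using evs
  proof eventually_elim
    case (elim m)
    have "hol_on (ball z0 e) (\<lambda>z. F (z + h m *s v))"
      by (rule hol_on_subset[OF hol_on_translate[OF F]]) (use ball1 elim e(2) s in \<open>auto simp: subset_iff\<close>)
    moreover have "hol_on (ball z0 e) F"
      by (rule hol_on_subset[OF F]) (use e in \<open>auto simp: subset_iff\<close>)
    ultimately show ?case
      unfolding D_def by (intro hol_on_divide hol_on_diff hol_on_const h0) auto
  qed
  have "hol_on (ball z0 e) (dirderiv v F)"
    by (rule hol_on_uniform_limit[OF open_ball ev ul sequentially_bot])
  then show "\<exists>N. open N \<and> z0 \<in> N \<and> hol_on N (dirderiv v F)"
    using e(1) by (intro exI[of _ "ball z0 e"]) auto
qed

section \<open>Weierstrass division\<close>

text \<open>Differentiating in the parameter is the same as moving the base point along the line, so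
  one-variable Taylor coefficients become functions of the base point to which
  \<open>hol_on_dirderiv\<close> applies.\<close>

lemma higher_deriv_line:
  assumes U: "open U" and zt: "z + t *s v \<in> U"
  shows "(deriv ^^ k) (\<lambda>t. F (z + t *s v)) t = ((dirderiv v) ^^ k) F (z + t *s v)"
  using zt
proof (induction k arbitrary: t)
  case (Suc k)
  have "\<forall>\<^sub>F s in nhds t. (deriv ^^ k) (\<lambda>t. F (z + t *s v)) s = ((dirderiv v) ^^ k) F (z + s *s v)"
    using eventually_nhds_in_open[OF open_line_vimage[OF U], of t z v] Suc.prems
    by (auto elim!: eventually_mono simp: Suc.IH)
  then have "(deriv ^^ Suc k) (\<lambda>t. F (z + t *s v)) t = deriv (\<lambda>s. ((dirderiv v) ^^ k) F (z + s *s v)) t"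
    by (simp add: deriv_cong_ev)
  also have "\<dots> = deriv (\<lambda>s. ((dirderiv v) ^^ k) F (z + t *s v + s *s v)) 0"
    by (subst deriv_shift_0) (simp add: o_def algebra_simps vector_sadd_rdistrib)
  also have "\<dots> = ((dirderiv v) ^^ Suc k) F (z + t *s v)"
    by (simp add: dirderiv_def)
  finally show ?case .
qed simp

text \<open>The coefficients are iterated directional derivatives divided by \<open>k!\<close>.
  Cauchy's inequality on the circle of radius \<open>\<sigma>\<close> bounds them geometrically,
  \<open>M\<close> being a bound of \<open>F\<close> on the ball of radius \<open>R/2\<close>. The
  direction \<open>v\<close> is singled out without choosing coordinates.\<close>

lemma hol_on_taylor_line:
  fixes v :: "complex^'n::finite"
  assumes R: "R > 0" and F: "hol_on (ball 0 R) F"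
  obtains U \<sigma> M c where "open U" "0 \<in> U" "\<sigma> > 0" "\<And>k. hol_on U (c k)"
    "\<And>k z. z \<in> U \<Longrightarrow> norm (c k z) \<le> M / \<sigma> ^ k"
    "\<And>z w. z \<in> U \<Longrightarrow> norm w < \<sigma> \<Longrightarrow> (\<lambda>k. c k z * w ^ k) sums F (z + w *s v)"
proof -
  define c where "c k z = ((dirderiv v) ^^ k) F z / fact k" for k z
  have hol_iter: "hol_on (ball 0 R) (((dirderiv v) ^^ k) F)" for k
    by (induction k) (auto intro: F hol_on_dirderiv)
  have hc: "hol_on (ball 0 R) (c k)" for k
    unfolding c_def by (intro hol_on_divide hol_iter hol_on_const) auto
  define \<sigma> where "\<sigma> = R / (4 * (norm v + 1))"
  have \<sigma>: "\<sigma> > 0" using R by (simp add: \<sigma>_def add_nonneg_pos)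
  have small: "norm (t *s v) \<le> R / 4" if "norm t \<le> \<sigma>" for t
  proof -
    have "norm v + 1 \<noteq> 0" using norm_ge_zero[of v] by linarith
    then have "\<sigma> * (norm v + 1) = R / 4" by (simp add: \<sigma>_def nonzero_eq_divide_eq divide_eq_eq)
    moreover have "norm (t *s v) \<le> \<sigma> * (norm v + 1)"
      unfolding norm_scalar_mult_complex using that \<sigma> by (intro mult_mono) auto
    ultimately show ?thesis by simp
  qed
  have inb: "z + t *s v \<in> cball 0 (R/2)" if "z \<in> ball 0 (R/4)" "norm t \<le> \<sigma>" for z t
    using that small[OF that(2)] norm_triangle_ineq[of z "t *s v"] by auto
  have sub: "cball 0 (R/2) \<subseteq> ball (0::complex^'n) R" using R by auto
  have "compact (F ` cball 0 (R/2))"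
    using hol_onD(1)[OF F] sub by (intro compact_continuous_image) (auto intro: continuous_on_subset)
  then obtain M where M: "\<And>z. z \<in> cball 0 (R/2) \<Longrightarrow> norm (F z) \<le> M"
    unfolding bounded_iff by (metis compact_imp_bounded bounded_iff imageI)
  have hl: "(\<lambda>t. F (z + t *s v)) holomorphic_on cball 0 \<sigma>" if "z \<in> ball 0 (R/4)" for z
    by (rule holomorphic_on_subset[OF hol_onD(2)[OF F]]) (use inb[OF that] sub in \<open>auto simp only: mem_cball_0 subset_iff mem_Collect_eq\<close>)
  have ck: "(deriv ^^ k) (\<lambda>t. F (z + t *s v)) 0 / fact k = c k z" if "z \<in> ball 0 (R/4)" for k z
  proof -
    have "(deriv ^^ k) (\<lambda>t. F (z + t *s v)) 0 = ((dirderiv v) ^^ k) F (z + 0 *s v)"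
      by (rule higher_deriv_line[of "ball 0 R"]) (use that R in auto)
    then show ?thesis by (simp add: c_def)
  qed
  show thesis
  proof
    show "open (ball 0 (R/4) :: (complex^'n) set)" "0 \<in> (ball 0 (R/4) :: (complex^'n) set)" "\<sigma> > 0"
      using R \<sigma> by auto
    show "hol_on (ball 0 (R/4)) (c k)" for k
      by (rule hol_on_subset[OF hc]) (use R in auto)
    fix z :: "complex^'n" assume z: "z \<in> ball 0 (R/4)"
    have b: "(\<lambda>t. F (z + t *s v)) holomorphic_on ball 0 \<sigma>"
      using hl[OF z] holomorphic_on_subset ball_subset_cball by blast
    fix k
    have "norm ((deriv ^^ k) (\<lambda>t. F (z + t *s v)) 0) \<le> fact k * M / \<sigma> ^ k"
    proof (rule Cauchy_inequality)
      show "continuous_on (cball 0 \<sigma>) (\<lambda>t. F (z + t *s v))"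
        using hl[OF z] by (rule holomorphic_on_imp_continuous_on)
      show "norm (0 - x) = \<sigma> \<Longrightarrow> norm (F (z + x *s v)) \<le> M" for x
        using M inb[OF z, of x] by auto
    qed (use b \<sigma> in auto)
    then have "norm ((deriv ^^ k) (\<lambda>t. F (z + t *s v)) 0 / fact k) \<le> M / \<sigma> ^ k"
      by (simp add: norm_divide divide_le_eq mult.commute)
    then show "norm (c k z) \<le> M / \<sigma> ^ k"
      unfolding ck[OF z] .
    fix w :: complex assume "norm w < \<sigma>"
    then have "(\<lambda>n. (deriv ^^ n) (\<lambda>t. F (z + t *s v)) 0 / fact n * (w - 0) ^ n) sums F (z + w *s v)"
      by (intro holomorphic_power_series[OF b]) auto
    then show "(\<lambda>k. c k z * w ^ k) sums F (z + w *s v)"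
      by (simp add: ck[OF z])
  qed
qed

text \<open>The quotient is obtained coefficientwise, as the fixed point of a map that contracts the
  norms \<open>sup\<^sub>k \<bar>q\<^sub>k\<bar> \<rho>\<^sup>k\<close>; all sums involved in the iteration are finite.\<close>

lemma weierstrass_division:
  fixes f g :: "nat \<Rightarrow> complex^'n::finite \<Rightarrow> complex"
  assumes U: "open U" "0 \<in> U" and \<sigma>: "\<sigma> > 0"
    and hf: "\<And>k. hol_on U (f k)" and hg: "\<And>k. hol_on U (g k)"
    and bf: "\<And>k z. z \<in> U \<Longrightarrow> norm (f k z) \<le> M / \<sigma> ^ k"
    and bg: "\<And>k z. z \<in> U \<Longrightarrow> norm (g k z) \<le> M / \<sigma> ^ k"
    and fd: "f d 0 \<noteq> 0" and fl: "\<And>k. k < d \<Longrightarrow> f k 0 = 0"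
  obtains V \<rho> r where "open V" "0 \<in> V" "V \<subseteq> U" "\<rho> > 0" "\<rho> \<le> \<sigma>"
    "\<And>l. hol_on V (r l)" "\<And>l. l < d \<Longrightarrow> r l 0 = g l 0"
    "\<And>z w. z \<in> V \<Longrightarrow> norm w < \<rho> \<Longrightarrow>
       \<exists>q. (\<Sum>k. g k z * w ^ k) = q * (\<Sum>k. f k z * w ^ k) + (\<Sum>l<d. r l z * w ^ l)"
proof -
  define c where "c = norm (f d 0)"
  have c: "c > 0" using fd by (simp add: c_def)
  have "norm (f 0 0) \<le> M" using bf[OF U(2), of 0] by simp
  then have M: "M \<ge> 0" using norm_ge_zero order_trans by blast
  \<comment> \<open>The first bound makes the ratio \<open>\<rho> / \<sigma>\<close> at most 1/2;
    the second makes the coefficients of \<open>f\<close> above degree \<open>d\<close> weigh at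
    most \<open>\<rho>^d c / 8\<close>. Writing \<open>M + 1\<close> covers
    \<open>M = 0\<close>.\<close>
  define \<rho> where "\<rho> = min (\<sigma> / 2) (c * \<sigma> ^ (d + 1) / (16 * (M + 1)))"
  have \<rho>: "\<rho> > 0" "\<rho> \<le> \<sigma>" "\<rho> \<le> \<sigma> / 2" "\<rho> \<le> c * \<sigma> ^ (d + 1) / (16 * (M + 1))"
  proof -
    have "0 < c * \<sigma> ^ (d + 1) / (16 * (M + 1))"
      using c M \<sigma> by (intro divide_pos_pos mult_pos_pos) auto
    then show "\<rho> > 0" using \<sigma> by (simp add: \<rho>_def)
    show "\<rho> \<le> \<sigma> / 2" "\<rho> \<le> c * \<sigma> ^ (d + 1) / (16 * (M + 1))"
      unfolding \<rho>_def by (rule min.cobounded1, rule min.cobounded2)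
    then show "\<rho> \<le> \<sigma>" using \<sigma> by linarith
  qed
  have isc: "(f k \<longlongrightarrow> f k 0) (nhds 0)" for k
  proof -
    have "isCont (f k) 0"
      using continuous_on_eq_continuous_at[OF U(1)] hol_onD(1)[OF hf] U(2) by blast
    then show ?thesis by (simp add: isCont_def tendsto_at_iff_tendsto_nhds)
  qed
  have "\<forall>\<^sub>F z in nhds 0. norm (f d z) > c / 2"
    using order_tendstoD(1)[OF tendsto_norm[OF isc[of d]], of "c / 2"] c by (simp add: c_def)
  moreover have "\<forall>\<^sub>F z in nhds 0. \<forall>k\<in>{..<d}. norm (f k z) * \<rho> ^ k < \<rho> ^ d * c / (8 * real (d + 1))"
  proof (intro eventually_ball_finite ballI)
    fix k assume "k \<in> {..<d}"
    then have "((\<lambda>z. norm (f k z) * \<rho> ^ k) \<longlongrightarrow> 0) (nhds 0)"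
      using tendsto_mult_right[OF tendsto_norm[OF isc[of k]], of "\<rho> ^ k"] fl by simp
    then show "\<forall>\<^sub>F z in nhds 0. norm (f k z) * \<rho> ^ k < \<rho> ^ d * c / (8 * real (d + 1))"
      by (rule order_tendstoD) (use \<rho> c in auto)
  qed auto
  moreover have "\<forall>\<^sub>F z in nhds 0. z \<in> U"
    using U by (rule eventually_nhds_in_open)
  ultimately have "\<forall>\<^sub>F z in nhds 0. z \<in> U \<and> norm (f d z) > c / 2 \<and>
      (\<forall>k\<in>{..<d}. norm (f k z) * \<rho> ^ k < \<rho> ^ d * c / (8 * real (d + 1)))"
    by eventually_elim auto
  then obtain V where V: "open V" "0 \<in> V" and VP: "\<And>z. z \<in> V \<Longrightarrow> z \<in> U \<and> norm (f d z) > c / 2 \<and>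
      (\<forall>k\<in>{..<d}. norm (f k z) * \<rho> ^ k < \<rho> ^ d * c / (8 * real (d + 1)))"
    unfolding eventually_nhds by blast
  have fdz: "f d z \<noteq> 0" if "z \<in> V" for z
    using VP[OF that] c by auto
  have lower: "(\<Sum>i<d. norm (f i z) * \<rho> ^ i) \<le> \<rho> ^ d * c / 8" if "z \<in> V" for z
  proof -
    have "(\<Sum>i<d. norm (f i z) * \<rho> ^ i) \<le> (\<Sum>i<d. \<rho> ^ d * c / (8 * real (d + 1)))"
      using VP[OF that] by (intro sum_mono) (auto intro: less_imp_le)
    also have "\<dots> = real d * (\<rho> ^ d * c / (8 * real (d + 1)))" by simp
    also have "\<dots> \<le> real (d + 1) * (\<rho> ^ d * c / (8 * real (d + 1)))"
      using \<rho> c by (intro mult_right_mono) auto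
    also have "\<dots> = \<rho> ^ d * c / 8" by (simp add: field_simps)
    finally show ?thesis .
  qed
  have upper: "(\<Sum>i\<in>{d<..<d + 1 + N}. norm (f i z) * \<rho> ^ i) \<le> \<rho> ^ d * c / 8" if "z \<in> V" for z N
  proof -
    let ?x = "\<rho> / \<sigma>"
    have x: "0 \<le> ?x" "?x \<le> 1/2" using \<rho> \<sigma> by (auto simp: field_simps)
    have nn: "0 \<le> M * ?x ^ (d + 1)" using M x(1) by (intro mult_nonneg_nonneg zero_le_power)
    have "(\<Sum>i\<in>{d<..<d + 1 + N}. norm (f i z) * \<rho> ^ i) \<le> (\<Sum>i\<in>{d<..<d + 1 + N}. M * ?x ^ i)"
    proof (rule sum_mono)
      fix i
      have "norm (f i z) * \<rho> ^ i \<le> M / \<sigma> ^ i * \<rho> ^ i"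
        using bf VP[OF that] \<rho> by (intro mult_right_mono) auto
      then show "norm (f i z) * \<rho> ^ i \<le> M * ?x ^ i" by (simp add: power_divide)
    qed
    also have "\<dots> = (\<Sum>i<N. M * ?x ^ (d + 1) * ?x ^ i)"
      by (rule sum.reindex_bij_witness[of _ "\<lambda>i. i + (d + 1)" "\<lambda>i. i - (d + 1)"])
        (auto simp flip: power_add power_Suc)
    also have "\<dots> \<le> M * ?x ^ (d + 1) * (\<Sum>i<N. (1/2) ^ i)"
      unfolding sum_distrib_left using x by (intro sum_mono mult_left_mono power_mono nn) auto
    also have "\<dots> \<le> M * ?x ^ (d + 1) * 2"
      by (intro mult_left_mono nn) (auto simp: sum_gp_strict)
    also have "\<dots> \<le> \<rho> ^ d * c / 8"
    proof -
      have "\<rho> * (16 * (M + 1)) \<le> c * \<sigma> ^ (d + 1)"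
        using \<rho>(4) M by (simp add: pos_le_divide_eq)
      then have "16 * M * \<rho> \<le> c * \<sigma> ^ (d + 1)"
        using \<rho>(1) by (simp add: algebra_simps)
      then have "\<rho> ^ d * (16 * M * \<rho>) \<le> \<rho> ^ d * (c * \<sigma> ^ (d + 1))"
        using \<rho>(1) by (intro mult_left_mono) auto
      then show ?thesis using \<sigma> by (simp add: power_divide field_simps)
    qed
    finally show ?thesis .
  qed
  \<comment> \<open>With weights \<open>\<rho>^i\<close> the coefficients other than the
    \<open>d\<close>-th weigh together at most half of the \<open>d\<close>-th one. This half is the
    contraction factor.\<close>
  have all: "(\<Sum>i\<in>{..d + k} - {d}. norm (f i z) * \<rho> ^ i) \<le> norm (f d z) * \<rho> ^ d / 2" if "z \<in> V" for z k
  proof -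
    have split: "{..d + k} - {d} = {..<d} \<union> {d<..<d + 1 + k}" by auto
    have "(\<Sum>i\<in>{..d + k} - {d}. norm (f i z) * \<rho> ^ i) =
        (\<Sum>i<d. norm (f i z) * \<rho> ^ i) + (\<Sum>i\<in>{d<..<d + 1 + k}. norm (f i z) * \<rho> ^ i)"
      unfolding split by (rule sum.union_disjoint) auto
    also have "\<dots> \<le> \<rho> ^ d * (c / 2) / 2"
      using lower[OF that] upper[OF that, of k] by simp
    also have "\<dots> \<le> \<rho> ^ d * norm (f d z) / 2"
      using VP[OF that] \<rho>(1) by (intro divide_right_mono mult_left_mono) auto
    finally show ?thesis by (simp add: mult.commute)
  qed
  \<comment> \<open>Obtained by comparing coefficients of \<open>w^(k+d)\<close> in
    \<open>g = q f + r\<close>, to which a remainder of degree below \<open>d\<close> does not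
    contribute, and solving for the term \<open>q k * f d\<close>. Only \<open>f d\<close> is
    inverted.\<close>
  define step where "step q k z = (g (k + d) z - (\<Sum>j\<in>{..k + d} - {k}. q j z * f (k + d - j) z)) / f d z"
    for q :: "nat \<Rightarrow> complex^'n \<Rightarrow> complex" and k z
  define Q where "Q m = (step ^^ m) (\<lambda>_ _. 0)" for m
  have Q0: "Q 0 k z = 0" and QS: "Q (Suc m) = step (Q m)" for m k z
    by (auto simp: Q_def)
  have contr: "norm (step q k z - step q' k z) \<le> (E / 2) / \<rho> ^ k"
    if z: "z \<in> V" and E: "\<And>j. norm (q j z - q' j z) \<le> E / \<rho> ^ j" for q q' k z E
  proof -
    have "norm (q 0 z - q' 0 z) \<le> E" using E[of 0] by simp
    then have E0: "E \<ge> 0" using norm_ge_zero order_trans by blast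
    have "step q k z - step q' k z = - (\<Sum>j\<in>{..k + d} - {k}. (q j z - q' j z) * f (k + d - j) z) / f d z"
      by (simp add: step_def diff_divide_distrib[symmetric] sum_subtractf algebra_simps)
    then have "norm (step q k z - step q' k z) =
        norm (\<Sum>j\<in>{..k + d} - {k}. (q j z - q' j z) * f (k + d - j) z) / norm (f d z)"
      by (simp add: norm_divide)
    also have "\<dots> \<le> (\<Sum>j\<in>{..k + d} - {k}. E / \<rho> ^ (k + d) * (norm (f (k + d - j) z) * \<rho> ^ (k + d - j))) / norm (f d z)"
    proof (intro divide_right_mono sum_norm_le)
      fix j assume j: "j \<in> {..k + d} - {k}"
      have "norm ((q j z - q' j z) * f (k + d - j) z) \<le> E / \<rho> ^ j * norm (f (k + d - j) z)"
        unfolding norm_mult by (intro mult_right_mono E) auto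
      also have "E / \<rho> ^ j = E / \<rho> ^ (k + d) * \<rho> ^ (k + d - j)"
        using j \<rho>(1) by (simp add: field_simps flip: power_add)
      finally show "norm ((q j z - q' j z) * f (k + d - j) z) \<le> E / \<rho> ^ (k + d) * (norm (f (k + d - j) z) * \<rho> ^ (k + d - j))"
        by (simp add: algebra_simps)
    qed auto
    also have "\<dots> = E / \<rho> ^ (k + d) * (\<Sum>j\<in>{..k + d} - {k}. norm (f (k + d - j) z) * \<rho> ^ (k + d - j)) / norm (f d z)"
      by (simp add: sum_distrib_left)
    also have "(\<Sum>j\<in>{..k + d} - {k}. norm (f (k + d - j) z) * \<rho> ^ (k + d - j)) =
        (\<Sum>i\<in>{..d + k} - {d}. norm (f i z) * \<rho> ^ i)"
      by (rule sum.reindex_bij_witness[of _ "\<lambda>i. k + d - i" "\<lambda>i. k + d - i"]) auto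
    also have "E / \<rho> ^ (k + d) * \<dots> / norm (f d z) \<le> E / \<rho> ^ (k + d) * (norm (f d z) * \<rho> ^ d / 2) / norm (f d z)"
      using all[OF z, of k] E0 \<rho>(1) by (intro divide_right_mono mult_left_mono) auto
    also have "\<dots> = (E / 2) / \<rho> ^ k"
      using fdz[OF z] \<rho>(1) by (simp add: power_add field_simps)
    finally show ?thesis .
  qed
  \<comment> \<open>Bounds the weighted size of the first iterate \<open>g (k + d) / f d\<close>,
    using that \<open>f d\<close> exceeds \<open>c / 2\<close> in modulus.\<close>
  define B where "B = 2 * M / (c * \<sigma> ^ d)"
  have B: "B \<ge> 0" using M c \<sigma> by (simp add: B_def)
  have diff: "norm (Q (Suc m) k z - Q m k z) \<le> (B / 2 ^ m) / \<rho> ^ k" if z: "z \<in> V" for m k z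
  proof (induction m arbitrary: k)
    case 0
    have "norm (Q (Suc 0) k z - Q 0 k z) = norm (g (k + d) z) / norm (f d z)"
      by (simp add: QS Q0 step_def norm_divide)
    also have "\<dots> \<le> (M / \<sigma> ^ (k + d)) / (c / 2)"
      using bg VP[OF z] c M \<sigma> by (intro frac_le) auto
    also have "\<dots> = B / \<sigma> ^ k"
      using c \<sigma> by (simp add: B_def power_add field_simps)
    also have "\<dots> \<le> B / \<rho> ^ k"
      using \<rho> B by (intro divide_left_mono power_mono) (auto simp: \<sigma>)
    finally show ?case by simp
  next
    case (Suc m)
    have "norm (step (Q (Suc m)) k z - step (Q m) k z) \<le> (B / 2 ^ m / 2) / \<rho> ^ k"
      using contr[where q = "Q (Suc m)" and q' = "Q m" and E = "B / 2 ^ m", OF z] Suc.IH by blast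
    then show ?case by (simp add: QS mult.commute)
  qed
  define q where "q k z = (\<Sum>m. Q (Suc m) k z - Q m k z)" for k z
  have summ: "summable (\<lambda>m. (B / 2 ^ m) / \<rho> ^ k)" for k
    using summable_mult[OF summable_geometric[of "1/2::real"], of "B / \<rho> ^ k"]
    by (simp add: power_divide mult.commute)
  have tel: "(\<Sum>m<n. Q (Suc m) k z - Q m k z) = Q n k z" for n k z
    using sum_lessThan_telescope[of "\<lambda>m. Q m k z" n] by (simp add: Q0)
  have ul: "uniform_limit V (\<lambda>n. Q n k) (q k) sequentially" for k
  proof -
    have "uniform_limit V (\<lambda>n z. \<Sum>m<n. Q (Suc m) k z - Q m k z) (\<lambda>z. \<Sum>m. Q (Suc m) k z - Q m k z) sequentially"
      by (rule Weierstrass_m_test[OF _ summ[of k]]) (use diff in auto)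
    then show ?thesis
      by (simp add: q_def[abs_def] tel)
  qed
  have hQ: "hol_on V (Q m k)" for m k
  proof (induction m arbitrary: k)
    case 0
    then show ?case using hol_on_const[of V 0] by (simp add: Q_def)
  next
    case (Suc m)
    have "hol_on V (\<lambda>z. step (Q m) k z)"
      unfolding step_def
      by (intro hol_on_divide hol_on_diff hol_on_sum hol_on_mult Suc.IH
          hol_on_subset[OF hg] hol_on_subset[OF hf]) (use VP fdz in auto)
    then show ?case by (simp add: QS)
  qed
  have hq: "hol_on V (q k)" for k
    by (rule hol_on_uniform_limit[OF V(1) _ ul]) (use hQ in auto)
  have lim: "(\<lambda>n. Q n k z) \<longlonglongrightarrow> q k z" if "z \<in> V" for k z
    using tendsto_uniform_limitI[OF ul that] .
  have qb: "norm (q k z) \<le> 2 * B / \<rho> ^ k" if z: "z \<in> V" for k z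
  proof -
    have "norm (Q n k z) \<le> (B / \<rho> ^ k) * (\<Sum>m<n. (1/2) ^ m)" for n
    proof -
      have "Q n k z = (\<Sum>m<n. Q (Suc m) k z - Q m k z)"
        by (simp add: tel)
      also have "norm \<dots> \<le> (\<Sum>m<n. (B / \<rho> ^ k) * (1/2) ^ m)"
        by (rule sum_norm_le) (use diff[OF z] in \<open>simp add: power_divide mult.commute\<close>)
      finally show ?thesis by (simp add: sum_distrib_left)
    qed
    moreover have "(B / \<rho> ^ k) * (\<Sum>m<n. (1/2) ^ m) \<le> (B / \<rho> ^ k) * 2" for n
      using B \<rho>(1) by (intro mult_left_mono) (auto simp: sum_gp_strict)
    ultimately have "norm (Q n k z) \<le> 2 * B / \<rho> ^ k" for n
      by (simp add: mult.commute) (meson order_trans)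
    then show ?thesis
      by (intro LIMSEQ_le_const2[OF tendsto_norm[OF lim[OF z]]]) auto
  qed
  have fixp: "step q k z = q k z" if z: "z \<in> V" for k z
  proof (rule LIMSEQ_unique)
    show "(\<lambda>n. Q (Suc n) k z) \<longlonglongrightarrow> q k z"
      using lim[OF z] by (rule LIMSEQ_Suc)
    have "(\<lambda>n. step (Q n) k z) \<longlonglongrightarrow> step q k z"
      unfolding step_def by (intro tendsto_intros lim z fdz)
    then show "(\<lambda>n. Q (Suc n) k z) \<longlonglongrightarrow> step q k z"
      by (simp add: QS)
  qed
  \<comment> \<open>Coefficients of the Cauchy product of \<open>q\<close> and \<open>f\<close>.
    They agree with those of \<open>g\<close> from degree \<open>d\<close> on, so the difference of
    the two series is a polynomial of degree below \<open>d\<close>.\<close>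
  define e where "e k z = (\<Sum>j\<le>k. q j z * f (k - j) z)" for k z
  have ed: "e (k + d) z = g (k + d) z" if z: "z \<in> V" for k z
  proof -
    have "e (k + d) z = q k z * f d z + (\<Sum>j\<in>{..k + d} - {k}. q j z * f (k + d - j) z)"
      unfolding e_def by (subst sum.remove[of _ k]) auto
    moreover have "q k z * f d z = g (k + d) z - (\<Sum>j\<in>{..k + d} - {k}. q j z * f (k + d - j) z)"
      using fixp[OF z, of k] fdz[OF z] by (simp add: step_def divide_eq_eq)
    ultimately show ?thesis by simp
  qed
  define r where "r l z = g l z - e l z" for l z
  show thesis
  proof
    show "open V" "0 \<in> V" "\<rho> > 0" "\<rho> \<le> \<sigma>" using V \<rho> by auto
    show VU: "V \<subseteq> U" using VP by auto
    show "hol_on V (r l)" for l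
      unfolding r_def e_def
      by (intro hol_on_diff hol_on_sum hol_on_mult hq hol_on_subset[OF hg VU] hol_on_subset[OF hf VU])
    \<comment> \<open>At the origin the coefficients of \<open>f\<close> below degree
      \<open>d\<close> vanish, so the product contributes nothing in degree
      \<open>l\<close>.\<close>
    show "r l 0 = g l 0" if "l < d" for l
      unfolding r_def e_def using that by (simp add: fl)
    fix z w assume z: "z \<in> V" and w: "norm (w::complex) < \<rho>"
    have wr: "norm w / \<rho> < 1" "norm w / \<sigma> < 1" using w \<rho> \<sigma> by (auto simp: divide_less_eq)
    have sq: "summable (\<lambda>k. norm (q k z * w ^ k))"
    proof (rule summable_comparison_test')
      show "summable (\<lambda>k. 2 * B * (norm w / \<rho>) ^ k)"
        using wr \<rho>(1) by (intro summable_mult summable_geometric) auto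
      show "norm (norm (q k z * w ^ k)) \<le> 2 * B * (norm w / \<rho>) ^ k" for k
        using mult_right_mono[OF qb[OF z, of k], of "norm w ^ k"] by (simp add: norm_mult norm_power power_divide)
    qed
    have sf: "summable (\<lambda>k. norm (f k z * w ^ k))"
    proof (rule summable_comparison_test')
      show "summable (\<lambda>k. M * (norm w / \<sigma>) ^ k)"
        using wr \<sigma> by (intro summable_mult summable_geometric) auto
      show "norm (norm (f k z * w ^ k)) \<le> M * (norm w / \<sigma>) ^ k" for k
        using mult_right_mono[OF bf[of z k], of "norm w ^ k"] z VU by (auto simp: norm_mult norm_power power_divide)
    qed
    have "(\<lambda>k. \<Sum>i\<le>k. (q i z * w ^ i) * (f (k - i) z * w ^ (k - i))) sums
        ((\<Sum>k. q k z * w ^ k) * (\<Sum>k. f k z * w ^ k))"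
      by (rule Cauchy_product_sums[OF sq sf])
    moreover have "(\<Sum>i\<le>k. (q i z * w ^ i) * (f (k - i) z * w ^ (k - i))) = e k z * w ^ k" for k
      unfolding e_def sum_distrib_right by (intro sum.cong) (auto simp: algebra_simps simp flip: power_add)
    ultimately have "(\<lambda>k. e k z * w ^ k) sums ((\<Sum>k. q k z * w ^ k) * (\<Sum>k. f k z * w ^ k))"
      by simp
    moreover have "(\<lambda>k. if k \<in> {..<d} then r k z * w ^ k else 0) sums (\<Sum>l<d. r l z * w ^ l)"
      by (rule sums_If_finite_set) auto
    ultimately have "(\<lambda>k. e k z * w ^ k + (if k \<in> {..<d} then r k z * w ^ k else 0)) sums
       ((\<Sum>k. q k z * w ^ k) * (\<Sum>k. f k z * w ^ k) + (\<Sum>l<d. r l z * w ^ l))"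
      by (rule sums_add)
    moreover have "e k z * w ^ k + (if k \<in> {..<d} then r k z * w ^ k else 0) = g k z * w ^ k" for k
    proof (cases "k < d")
      case False
      then have "e k z = g k z" using ed[OF z, of "k - d"] by simp
      then show ?thesis using False by simp
    qed (simp add: r_def algebra_simps)
    ultimately have "(\<Sum>k. g k z * w ^ k) =
        (\<Sum>k. q k z * w ^ k) * (\<Sum>k. f k z * w ^ k) + (\<Sum>l<d. r l z * w ^ l)"
      by (simp add: sums_iff)
    then show "\<exists>q. (\<Sum>k. g k z * w ^ k) = q * (\<Sum>k. f k z * w ^ k) + (\<Sum>l<d. r l z * w ^ l)"
      by blast
  qed
qed

section \<open>Real analytic germs\<close>

definition cvec :: "real^'n::finite \<Rightarrow> complex^'n" where
  "cvec x = (\<chi> i. of_real (x $ i))"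

definition cnjv :: "complex^'n::finite \<Rightarrow> complex^'n" where
  "cnjv z = (\<chi> i. cnj (z $ i))"

lemma cvec_add: "cvec (x + y) = cvec x + cvec y"
  and cvec_scaleR: "cvec (t *\<^sub>R x) = of_real t *s cvec x"
  and cvec_0 [simp]: "cvec 0 = 0"
  and norm_cvec [simp]: "norm (cvec x) = norm x"
  and cnjv_cvec [simp]: "cnjv (cvec x) = cvec x"
  and norm_cnjv [simp]: "norm (cnjv z) = norm z"
  by (simp_all add: cvec_def cnjv_def vec_eq_iff norm_vec_def)

lemma cnjv_line: "cnjv (z + t *s v) = cnjv z + cnj t *s cnjv v"
  by (simp add: cnjv_def vec_eq_iff)

lemma continuous_on_cvec: "continuous_on A cvec"
  unfolding cvec_def by (intro continuous_intros)

lemma continuous_on_cnjv: "continuous_on A cnjv"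
  unfolding cnjv_def by (intro continuous_intros)

text \<open>The part of \<open>F\<close> symmetric under complex conjugation: the holomorphic
  extension of the real part of \<open>F\<close> on real points. It turns complex division
  coefficients into real analytic ones.\<close>

definition symm :: "(complex^'n::finite \<Rightarrow> complex) \<Rightarrow> complex^'n \<Rightarrow> complex" where
  "symm F z = (F z + cnj (F (cnjv z))) / 2"

lemma symm_cvec: "symm F (cvec x) = of_real (Re (F (cvec x)))"
  by (simp add: symm_def complex_add_cnj)

lemma hol_on_symm:
  fixes F :: "complex^'n::finite \<Rightarrow> complex"
  assumes F: "hol_on (ball 0 R) F" shows "hol_on (ball 0 R) (symm F)"
proof -
  have "hol_on (ball 0 R) (\<lambda>z. cnj (F (cnjv z)))"
    unfolding hol_on_def
  proof (intro conjI allI)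
    have "continuous_on (ball 0 R) (\<lambda>z. F (cnjv z))"
      by (rule continuous_on_compose2[OF hol_onD(1)[OF F] continuous_on_cnjv]) auto
    then show "continuous_on (ball 0 R) (\<lambda>z. cnj (F (cnjv z)))"
      by (intro continuous_intros)
    fix z v :: "complex^'n"
    let ?A = "{t. z + t *s v \<in> ball 0 R}"
    have "(\<lambda>t. F (cnjv z + t *s cnjv v)) holomorphic_on cnj ` ?A"
    proof (rule holomorphic_on_subset[OF hol_onD(2)[OF F]], clarify)
      fix t assume "z + t *s v \<in> ball 0 R"
      then have "norm (cnjv (z + t *s v)) < R" by simp
      then show "cnjv z + cnj t *s cnjv v \<in> ball 0 R"
        by (simp only: cnjv_line mem_ball_0)
    qed
    then have "(cnj \<circ> (\<lambda>t. F (cnjv z + t *s cnjv v)) \<circ> cnj) holomorphic_on ?A"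
      by (intro holomorphic_on_compose_cnj_cnj open_line_vimage) auto
    then show "(\<lambda>t. cnj (F (cnjv (z + t *s v)))) holomorphic_on ?A"
      by (simp add: o_def cnjv_line)
  qed
  then show ?thesis
    unfolding symm_def by (intro hol_on_divide hol_on_add F hol_on_const) auto
qed

text \<open>Analyticity at the origin expressed by a holomorphic extension instead of a power
  series, so that sums, products and division coefficients stay in the class by the closure
  properties of \<open>hol_on\<close>.\<close>

definition cx_analytic :: "(real^'n::finite \<Rightarrow> real) \<Rightarrow> bool" where
  "cx_analytic f \<longleftrightarrow> (\<exists>R>0. \<exists>F. hol_on (ball 0 R) F \<and> (\<forall>x\<in>ball 0 R. F (cvec x) = of_real (f x)))"

lemma cx_analytic_binop:
  fixes f g :: "real^'n::finite \<Rightarrow> real"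
  assumes f: "cx_analytic f" and g: "cx_analytic g"
    and hol: "\<And>(U::(complex^'n) set) F G. hol_on U F \<Longrightarrow> hol_on U G \<Longrightarrow> hol_on U (\<lambda>z. H (F z) (G z))"
    and op: "\<And>x y. H (of_real x) (of_real y) = of_real (h x y)"
  shows "cx_analytic (\<lambda>x. h (f x) (g x))"
proof -
  obtain R F where F: "R > 0" "hol_on (ball 0 R) F" "\<And>x. x \<in> ball 0 R \<Longrightarrow> F (cvec x) = of_real (f x)"
    using f unfolding cx_analytic_def by blast
  obtain S G where G: "S > 0" "hol_on (ball 0 S) G" "\<And>x. x \<in> ball 0 S \<Longrightarrow> G (cvec x) = of_real (g x)"
    using g unfolding cx_analytic_def by blast
  have "hol_on (ball 0 (min R S)) (\<lambda>z. H (F z) (G z))"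
    by (rule hol) (auto intro: hol_on_subset[OF F(2)] hol_on_subset[OF G(2)])
  then show ?thesis
    unfolding cx_analytic_def using F(1,3) G(1,3) op
    by (intro exI[of _ "min R S"] conjI exI[of _ "\<lambda>z. H (F z) (G z)"]) auto
qed

lemma cx_analytic_diff: "cx_analytic f \<Longrightarrow> cx_analytic g \<Longrightarrow> cx_analytic (\<lambda>x. f x - g x)"
  by (rule cx_analytic_binop[where H = "(-)"]) (auto intro: hol_on_diff)

lemma cx_analytic_mult: "cx_analytic f \<Longrightarrow> cx_analytic g \<Longrightarrow> cx_analytic (\<lambda>x. f x * g x)"
  by (rule cx_analytic_binop[where H = "(*)"]) (auto intro: hol_on_mult)

lemma cx_analytic_const: "cx_analytic (\<lambda>x. c)"
  unfolding cx_analytic_def by (intro exI[of _ 1] conjI exI[of _ "\<lambda>z. of_real c"]) (auto intro: hol_on_const)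

lemma cx_analytic_Re:
  assumes "open V" "0 \<in> V" "hol_on V F" shows "cx_analytic (\<lambda>x. Re (F (cvec x)))"
proof -
  obtain R where R: "R > 0" "ball 0 R \<subseteq> V" using assms open_contains_ball by blast
  have "hol_on (ball 0 R) (symm F)"
    using hol_on_symm hol_on_subset[OF assms(3) R(2)] by blast
  then show ?thesis unfolding cx_analytic_def using R(1) symm_cvec by blast
qed

lemma cx_analytic_isCont:
  assumes "cx_analytic f" shows "\<forall>\<^sub>F x in nhds 0. isCont f x"
proof -
  obtain R F where F: "R > 0" "hol_on (ball 0 R) F" "\<And>x. x \<in> ball 0 R \<Longrightarrow> F (cvec x) = of_real (f x)"
    using assms unfolding cx_analytic_def by blast
  have "continuous_on (ball 0 R) (\<lambda>x. F (cvec x))"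
    by (rule continuous_on_compose2[OF hol_onD(1)[OF F(2)] continuous_on_cvec]) auto
  then have "continuous_on (ball 0 R) (\<lambda>x. Re (F (cvec x)))"
    by (intro continuous_intros)
  then have "continuous_on (ball 0 R) f"
    by (rule continuous_on_eq) (simp add: F(3))
  then have "isCont f x" if "x \<in> ball 0 R" for x
    using that continuous_on_eq_continuous_at open_ball by blast
  then show ?thesis
    using F(1) unfolding eventually_nhds by (intro exI[of _ "ball 0 R"]) auto
qed

lemma cx_analytic_common_radius:
  fixes w :: "nat \<Rightarrow> real^'n::finite \<Rightarrow> real"
  assumes "\<And>l. l < d \<Longrightarrow> cx_analytic (w l)"
  shows "\<exists>R>0. \<exists>H. \<forall>l<d::nat. hol_on (ball 0 R) (H l) \<and> (\<forall>x\<in>ball 0 R. H l (cvec x) = of_real (w l x))"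
proof -
  have "\<forall>l\<in>{..<d}. \<exists>R F. R > 0 \<and> hol_on (ball 0 R) F \<and> (\<forall>x\<in>ball 0 R. F (cvec x) = of_real (w l x))"
    using assms unfolding cx_analytic_def by blast
  from bchoice[OF this] obtain R where
    "\<forall>l\<in>{..<d}. \<exists>F. R l > 0 \<and> hol_on (ball 0 (R l)) F \<and> (\<forall>x\<in>ball 0 (R l). F (cvec x) = of_real (w l x))"
    by blast
  from bchoice[OF this] obtain H where RH: "\<And>l. l < d \<Longrightarrow> R l > 0 \<and> hol_on (ball 0 (R l)) (H l) \<and>
      (\<forall>x\<in>ball 0 (R l). H l (cvec x) = of_real (w l x))"
    by blast
  define S where "S = Min (insert 1 (R ` {..<d}))"
  have "S > 0" unfolding S_def using RH by (subst Min_gr_iff) auto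
  moreover have "S \<le> R l" if "l < d" for l
    unfolding S_def using that by (intro Min_le) auto
  ultimately have "hol_on (ball 0 S) (H l) \<and> (\<forall>x\<in>ball 0 S. H l (cvec x) = of_real (w l x))" if "l < d" for l
    using RH[OF that] that hol_on_subset[of "ball 0 (R l)" "H l" "ball 0 S"] by (force simp: subset_iff)
  then show ?thesis using \<open>S > 0\<close> by blast
qed

text \<open>The interval of vanishing in the hypothesis may depend on \<open>v\<close>. On the
  complex line through \<open>y\<close> the domain of the extension is convex, and the real zeros
  accumulate at 0, so the identity theorem carries the vanishing up to parameter 1, that is to
  \<open>y\<close>. This gives one radius for all directions.\<close>

lemma cx_analytic_zero_on_lines:
  assumes f: "cx_analytic f" and V: "subspace V" and z: "\<And>v. v \<in> V \<Longrightarrow> \<forall>\<^sub>F t in nhds 0. f (t *\<^sub>R v) = 0"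
  shows "\<forall>\<^sub>F y in nhds 0. y \<in> V \<longrightarrow> f y = 0"
proof -
  obtain R F where F: "R > 0" "hol_on (ball 0 R) F" "\<And>x. x \<in> ball 0 R \<Longrightarrow> F (cvec x) = of_real (f x)"
    using f unfolding cx_analytic_def by blast
  have "f y = 0" if y: "y \<in> V" "y \<in> ball 0 R" for y
  proof -
    let ?S = "{t. 0 + t *s cvec y \<in> ball 0 R}"
    have Seq: "?S = {t. norm t * norm y < R}" by (simp add: norm_scalar_mult_complex)
    have "convex ?S"
    proof (rule convexI)
      fix a b :: complex and u v :: real
      assume ab: "a \<in> ?S" "b \<in> ?S" and uv: "0 \<le> u" "0 \<le> v" "u + v = 1"
      have "norm (u *\<^sub>R a + v *\<^sub>R b) \<le> u * norm a + v * norm b"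
        using norm_triangle_ineq[of "u *\<^sub>R a" "v *\<^sub>R b"] uv by simp
      also have "\<dots> \<le> max (norm a) (norm b)"
        using convex_bound_le[of "norm a" "max (norm a) (norm b)" "norm b" u v] uv by simp
      finally have "norm (u *\<^sub>R a + v *\<^sub>R b) * norm y \<le> max (norm a) (norm b) * norm y"
        by (rule mult_right_mono) auto
      also have "\<dots> < R" using ab unfolding Seq by (auto simp: max_def)
      finally show "u *\<^sub>R a + v *\<^sub>R b \<in> ?S" unfolding Seq by simp
    qed
    then have conn: "connected ?S" by (rule convex_connected)
    obtain e where e: "e > 0" "\<And>t. \<bar>t\<bar> < e \<Longrightarrow> f (t *\<^sub>R y) = 0"
      using z[OF y(1)] unfolding eventually_nhds_metric by (auto simp: dist_real_def)
    define e' where "e' = min e 1"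
    have e': "e' > 0" using e by (simp add: e'_def)
    let ?U = "of_real ` {t. \<bar>t\<bar> < e'} :: complex set"
    have yR: "norm y < R" using y by simp
    have small: "norm (t *\<^sub>R y) < R" if "\<bar>t\<bar> < e'" for t
    proof -
      have "\<bar>t\<bar> * norm y \<le> 1 * norm y" using that by (intro mult_right_mono) (auto simp: e'_def)
      then show ?thesis using yR by simp
    qed
    have lp: "(0::complex) islimpt ?U"
    proof (rule islimptI)
      fix T :: "complex set" assume "0 \<in> T" "open T"
      then obtain r where r: "r > 0" "ball 0 r \<subseteq> T" using open_contains_ball by blast
      let ?t = "min r e' / 2"
      have "complex_of_real ?t \<in> T" using r e' by (intro subsetD[OF r(2)]) auto
      moreover have "complex_of_real ?t \<in> ?U" using r e' by (intro imageI) auto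
      moreover have "complex_of_real ?t \<noteq> 0" using r e' by auto
      ultimately show "\<exists>y\<in>?U. y \<in> T \<and> y \<noteq> 0" by blast
    qed
    have "F (0 + 1 *s cvec y) = 0"
    proof (rule analytic_continuation[where f = "\<lambda>t. F (0 + t *s cvec y)" and w = 1 and S = ?S and U = ?U and \<xi> = 0])
      show "(\<lambda>t. F (0 + t *s cvec y)) holomorphic_on ?S" by (rule hol_onD(2)[OF F(2)])
      show "open ?S" by (intro open_line_vimage) auto
      show "?U \<subseteq> ?S" using small by (auto simp: norm_scalar_mult_complex)
      show "F (0 + u *s cvec y) = 0" if u: "u \<in> ?U" for u
      proof -
        obtain t where t: "u = of_real t" "\<bar>t\<bar> < e'" using u by blast
        then have "F (cvec (t *\<^sub>R y)) = 0"
          using F(3)[of "t *\<^sub>R y"] small[of t] e(2)[of t] by (simp add: e'_def)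
        then show ?thesis using t by (simp add: cvec_scaleR)
      qed
    qed (use conn lp yR F(1) in \<open>auto simp: norm_scalar_mult_complex\<close>)
    then show ?thesis using F(3)[OF y(2)] by simp
  qed
  then show ?thesis
    using F(1) unfolding eventually_nhds by (intro exI[of _ "ball 0 R"]) auto
qed

section \<open>Weierstrass polynomials and remainders along a real direction\<close>

lemma eventually_prod_ballI:
  assumes "\<delta> > 0" "open V" "0 \<in> V" "\<And>y t. cvec y \<in> V \<Longrightarrow> y \<in> ball 0 R \<Longrightarrow> \<bar>t\<bar> < \<delta> \<Longrightarrow> norm y + \<bar>t\<bar> < R \<Longrightarrow> P (y, t)" "R > 0"
  shows "\<forall>\<^sub>F p in nhds (0, 0::real). P p"
proof -
  obtain e where e: "e > 0" "ball 0 e \<subseteq> V" using assms open_contains_ball by blast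
  define m where "m = min (min e (R / 2)) \<delta>"
  have m: "m > 0" using e assms by (simp add: m_def)
  have "P (y, t)" if "dist (y, t) (0, 0) < m" for y t
  proof -
    have "norm y < m" "\<bar>t\<bar> < m"
      using that dist_fst_le[of "(y, t)" "(0, 0)"] dist_snd_le[of "(y, t)" "(0, 0)"]
      by (auto simp: dist_real_def)
    then show ?thesis
      using e by (intro assms(4)) (auto simp: m_def)
  qed
  then show ?thesis
    using m unfolding eventually_nhds_metric by auto
qed

text \<open>The monomial \<open>w^d\<close> is divided by \<open>f\<close>, where \<open>d\<close>
  is the order of \<open>f\<close> along \<open>v\<close> at the origin; on the zeros of
  \<open>f\<close> the quotient term drops out. This is the half of the preparation theorem that the
  elimination uses: zeros of \<open>f\<close> are roots of a monic polynomial whose lower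
  coefficients vanish at the origin.\<close>

lemma cx_analytic_monic_multiple:
  fixes v :: "real^'n::finite"
  assumes f: "cx_analytic f" and nz: "\<not> (\<forall>\<^sub>F t in nhds 0. f (t *\<^sub>R v) = 0)"
  obtains d w where "\<And>l. cx_analytic (w l)" "\<And>l. l < d \<Longrightarrow> w l 0 = 0"
    "\<forall>\<^sub>F p in nhds (0, 0). f (fst p + snd p *\<^sub>R v) = 0 \<longrightarrow> snd p ^ d = (\<Sum>l<d::nat. w l (fst p) * snd p ^ l)"
proof -
  obtain R F where F: "R > 0" "hol_on (ball 0 R) F" "\<And>x. x \<in> ball 0 R \<Longrightarrow> F (cvec x) = of_real (f x)"
    using f unfolding cx_analytic_def by blast
  obtain U \<sigma> M c where U: "open U" "0 \<in> U" "\<sigma> > 0" "\<And>k. hol_on U (c k)"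
    "\<And>k z. z \<in> U \<Longrightarrow> norm (c k z) \<le> M / \<sigma> ^ k"
    "\<And>z w. z \<in> U \<Longrightarrow> norm w < \<sigma> \<Longrightarrow> (\<lambda>k. c k z * w ^ k) sums F (z + w *s cvec v)"
    by (rule hol_on_taylor_line[OF F(1,2), of "cvec v"]) (rule that)
  have "\<exists>k. c k 0 \<noteq> 0"
  proof (rule ccontr)
    assume none: "\<not> ?thesis"
    have zero: "F (0 + w *s cvec v) = 0" if "norm w < \<sigma>" for w
    proof -
      have "(\<lambda>k. c k 0 * w ^ k) = (\<lambda>k. 0)" using none by auto
      then have "(\<lambda>k. 0) sums F (0 + w *s cvec v)" using U(6)[OF U(2) that] by simp
      then show ?thesis by (rule sums_unique2[OF _ sums_zero])
    qed
    have "((\<lambda>t. t *\<^sub>R v) \<longlongrightarrow> 0 *\<^sub>R v) (nhds 0)" by (intro tendsto_intros filterlim_ident)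
    then have "\<forall>\<^sub>F t in nhds 0. t *\<^sub>R v \<in> ball 0 R"
      by (rule topological_tendstoD) (use F in auto)
    moreover have "\<forall>\<^sub>F t in nhds 0. t \<in> ball 0 \<sigma>"
      using U(3) by (intro eventually_nhds_in_open) auto
    ultimately have "\<forall>\<^sub>F t in nhds 0. f (t *\<^sub>R v) = 0"
    proof eventually_elim
      case (elim t)
      then show ?case using F(3)[of "t *\<^sub>R v"] zero[of "of_real t"] by (simp add: cvec_scaleR)
    qed
    with nz show False by blast
  qed
  define d where "d = (LEAST k. c k 0 \<noteq> 0)"
  have d: "c d 0 \<noteq> 0"
    unfolding d_def using \<open>\<exists>k. c k 0 \<noteq> 0\<close> by (rule LeastI_ex)
  have dl: "c k 0 = 0" if "k < d" for k
    using not_less_Least[of k "\<lambda>k. c k 0 \<noteq> 0"] that by (simp add: d_def)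
  \<comment> \<open>The power series of the monomial \<open>w^d\<close>.\<close>
  define g where "g k z = (if k = d then 1 else 0 :: complex)" for k and z :: "complex^'n"
  define M' where "M' = max M (\<sigma> ^ d)"
  have bc: "norm (c k z) \<le> M' / \<sigma> ^ k" if "z \<in> U" for k z
    using U(3) by (intro order_trans[OF U(5)[OF that]] divide_right_mono) (auto simp: M'_def)
  have bg: "norm (g k z) \<le> M' / \<sigma> ^ k" if "z \<in> U" for k z
  proof (cases "k = d")
    case True
    then show ?thesis using U(3) by (simp add: g_def M'_def field_simps)
  next
    case False
    have "0 < \<sigma> ^ d" using U(3) by simp
    then have "0 \<le> M' / \<sigma> ^ k" using U(3) by (intro divide_nonneg_nonneg) (auto simp: M'_def le_max_iff_disj)
    then show ?thesis using False by (simp add: g_def)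
  qed
  have hg: "hol_on U (g k)" for k unfolding g_def by (rule hol_on_const)
  obtain V \<rho> r where V: "open V" "0 \<in> V" "V \<subseteq> U" "\<rho> > 0" "\<rho> \<le> \<sigma>"
    "\<And>l. hol_on V (r l)" "\<And>l. l < d \<Longrightarrow> r l 0 = g l 0"
    "\<And>z w. z \<in> V \<Longrightarrow> norm w < \<rho> \<Longrightarrow>
       \<exists>q. (\<Sum>k. g k z * w ^ k) = q * (\<Sum>k. c k z * w ^ k) + (\<Sum>l<d. r l z * w ^ l)"
    by (rule weierstrass_division[OF U(1,2,3,4) hg bc bg d dl]) (assumption | rule that)+
  define w where "w l x = Re (r l (cvec x))" for l x
  show thesis
  proof
    show "cx_analytic (w l)" for l unfolding w_def by (rule cx_analytic_Re[OF V(1,2,6)])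
    show "w l 0 = 0" if "l < d" for l using V(7)[OF that] that by (simp add: w_def g_def)
    show "\<forall>\<^sub>F p in nhds (0, 0). f (fst p + snd p *\<^sub>R v) = 0 \<longrightarrow> snd p ^ d = (\<Sum>l<d. w l (fst p) * snd p ^ l)"
    proof (rule eventually_prod_ballI[OF _ V(1,2)])
      let ?\<delta> = "min \<rho> (R / (2 * (norm v + 1)))"
      show "?\<delta> > 0" using V(4) F(1) by (auto intro!: divide_pos_pos simp: add_nonneg_pos)
      show "R / 2 > 0" using F(1) by simp
      fix y t assume y: "cvec y \<in> V" and t: "\<bar>t\<bar> < ?\<delta>" and yt: "norm y + \<bar>t\<bar> < R / 2"
      have "\<bar>t\<bar> * norm v \<le> R / 2"
      proof -
        have "\<bar>t\<bar> * norm v \<le> R / (2 * (norm v + 1)) * (norm v + 1)"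
          using t F(1) by (intro mult_mono) auto
        also have "\<dots> = R / 2"
        proof -
          have "norm v + 1 \<noteq> 0" using norm_ge_zero[of v] by linarith
          then show ?thesis by (simp add: nonzero_eq_divide_eq divide_eq_eq)
        qed
        finally show ?thesis .
      qed
      then have yv: "y + t *\<^sub>R v \<in> ball 0 R"
        using yt norm_triangle_ineq[of y "t *\<^sub>R v"] by simp
      obtain q where q: "(\<Sum>k. g k (cvec y) * of_real t ^ k) =
          q * (\<Sum>k. c k (cvec y) * of_real t ^ k) + (\<Sum>l<d. r l (cvec y) * of_real t ^ l)"
        using V(8)[OF y, of "of_real t"] t by auto
      have "(\<lambda>k. g k (cvec y) * of_real t ^ k) sums (of_real t ^ d)"
        using sums_single[of d "\<lambda>k. (of_real t :: complex) ^ k"]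
        by (simp add: g_def if_distrib[of "\<lambda>x. x * _"] cong: if_cong)
      then have "(\<Sum>k. g k (cvec y) * of_real t ^ k) = of_real t ^ d" by (simp add: sums_iff)
      moreover have "(\<Sum>k. c k (cvec y) * of_real t ^ k) = F (cvec y + of_real t *s cvec v)"
        using U(6)[of "cvec y" "of_real t"] y V(3,5) t by (auto simp: sums_iff)
      ultimately have eq: "of_real t ^ d = q * F (cvec (y + t *\<^sub>R v)) + (\<Sum>l<d. r l (cvec y) * of_real t ^ l)"
        using q by (simp add: cvec_add cvec_scaleR)
      show "f (fst (y, t) + snd (y, t) *\<^sub>R v) = 0 \<longrightarrow>
          snd (y, t) ^ d = (\<Sum>l<d. w l (fst (y, t)) * snd (y, t) ^ l)"
      proof
        assume "f (fst (y, t) + snd (y, t) *\<^sub>R v) = 0"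
        then have "of_real (t ^ d) = (\<Sum>l<d. r l (cvec y) * of_real (t ^ l))"
          using eq F(3)[OF yv] by simp
        then have "t ^ d = Re (\<Sum>l<d. r l (cvec y) * of_real (t ^ l))"
          by (metis Re_complex_of_real)
        then show "snd (y, t) ^ d = (\<Sum>l<d. w l (fst (y, t)) * snd (y, t) ^ l)"
          by (simp add: w_def)
      qed
    qed
  qed
qed

text \<open>Division by the Weierstrass polynomial itself: its lower coefficients vanish at the
  origin, as the division theorem demands of the divisor. On its roots \<open>f\<close> equals the
  remainder, so an analytic equation becomes a polynomial one.\<close>

lemma cx_analytic_remainder:
  fixes v :: "real^'n::finite"
  assumes f: "cx_analytic f" and w: "\<And>l. cx_analytic (w l)" and w0: "\<And>l. l < d \<Longrightarrow> w l 0 = 0"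
  obtains r where "\<And>l. cx_analytic (r l)"
    "\<forall>\<^sub>F p in nhds (0, 0). snd p ^ d = (\<Sum>l<d. w l (fst p) * snd p ^ l) \<longrightarrow>
        f (fst p + snd p *\<^sub>R v) = (\<Sum>l<d::nat. r l (fst p) * snd p ^ l)"
proof -
  obtain R F where F: "R > 0" "hol_on (ball 0 R) F" "\<And>x. x \<in> ball 0 R \<Longrightarrow> F (cvec x) = of_real (f x)"
    using f unfolding cx_analytic_def by blast
  obtain U \<sigma> M c where U: "open U" "0 \<in> U" "\<sigma> > 0" "\<And>k. hol_on U (c k)"
    "\<And>k z. z \<in> U \<Longrightarrow> norm (c k z) \<le> M / \<sigma> ^ k"
    "\<And>z w. z \<in> U \<Longrightarrow> norm w < \<sigma> \<Longrightarrow> (\<lambda>k. c k z * w ^ k) sums F (z + w *s cvec v)"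
    by (rule hol_on_taylor_line[OF F(1,2), of "cvec v"]) (rule that)
  obtain S H where S: "S > 0" and H: "\<And>l. l < d \<Longrightarrow> hol_on (ball 0 S) (H l)"
    "\<And>l x. l < d \<Longrightarrow> x \<in> ball 0 S \<Longrightarrow> H l (cvec x) = of_real (w l x)"
    using cx_analytic_common_radius[of d w] w by blast
  obtain T where T: "T > 0" "ball 0 T \<subseteq> U" using U open_contains_ball by blast
  define N where "N = (ball 0 (min (S / 2) T) :: (complex^'n) set)"
  have N: "open N" "0 \<in> N" "N \<subseteq> U" "N \<subseteq> ball 0 S" "N \<subseteq> cball 0 (S / 2)"
    using S T by (auto simp: N_def)
  \<comment> \<open>The monic polynomial \<open>t^d - (\<Sum>l<d. w l t^l)\<close>, read as a power
    series in \<open>t\<close> with holomorphic coefficients.\<close>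
  define h where "h k z = (if k < d then - H k z else if k = d then 1 else 0)" for k z
  have hh: "hol_on (ball 0 S) (h k)" for k
  proof -
    have "hol_on (ball 0 S) (\<lambda>z. 0 - H k z)" if "k < d"
      by (intro hol_on_diff hol_on_const H that)
    then show ?thesis
      by (cases "k < d") (auto simp: h_def[abs_def] intro: hol_on_const)
  qed
  have "\<exists>B. \<forall>z\<in>cball 0 (S / 2). norm (h k z) \<le> B" for k
  proof -
    have "compact (h k ` cball 0 (S / 2))"
      by (intro compact_continuous_image continuous_on_subset[OF hol_onD(1)[OF hh]]) (use S in auto)
    then show ?thesis by (drule_tac compact_imp_bounded) (auto simp: bounded_iff)
  qed
  then obtain B where B: "\<And>k z. z \<in> cball 0 (S / 2) \<Longrightarrow> norm (h k z) \<le> B k"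
    using choice[of "\<lambda>k B. \<forall>z\<in>cball 0 (S / 2). norm (h k z) \<le> B"] by blast
  define M' where "M' = max M (\<Sum>k\<le>d. \<bar>B k\<bar> * \<sigma> ^ k)"
  have bh: "norm (h k z) \<le> M' / \<sigma> ^ k" if "z \<in> N" for k z
  proof (cases "k \<le> d")
    case True
    have "norm (h k z) \<le> \<bar>B k\<bar>" using B[of z k] that N(5) by fastforce
    then have "norm (h k z) * \<sigma> ^ k \<le> \<bar>B k\<bar> * \<sigma> ^ k" using U(3) by (intro mult_right_mono) auto
    also have "\<dots> \<le> (\<Sum>k\<le>d. \<bar>B k\<bar> * \<sigma> ^ k)"
      using True U(3) by (intro member_le_sum) auto
    also have "\<dots> \<le> M'" by (simp add: M'_def)
    finally show ?thesis using U(3) by (simp add: pos_le_divide_eq)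
  next
    case False
    have "0 \<le> (\<Sum>k\<le>d. \<bar>B k\<bar> * \<sigma> ^ k)" using U(3) by (intro sum_nonneg) auto
    then show ?thesis using False U(3) by (auto simp: h_def M'_def)
  qed
  have bc: "norm (c k z) \<le> M' / \<sigma> ^ k" if "z \<in> N" for k z
    using U(3) N(3) that by (intro order_trans[OF U(5)] divide_right_mono) (auto simp: M'_def)
  have h0: "h d 0 \<noteq> 0" "\<And>k. k < d \<Longrightarrow> h k 0 = 0"
    using H(2)[of _ 0] S w0 by (auto simp: h_def)
  obtain V \<rho> r where V: "open V" "0 \<in> V" "V \<subseteq> N" "\<rho> > 0" "\<rho> \<le> \<sigma>"
    "\<And>l. hol_on V (r l)" "\<And>l. l < d \<Longrightarrow> r l 0 = c l 0"
    "\<And>z w. z \<in> V \<Longrightarrow> norm w < \<rho> \<Longrightarrow>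
       \<exists>q. (\<Sum>k. c k z * w ^ k) = q * (\<Sum>k. h k z * w ^ k) + (\<Sum>l<d. r l z * w ^ l)"
    by (rule weierstrass_division[OF N(1,2) U(3) hol_on_subset[OF hh N(4)] hol_on_subset[OF U(4) N(3)] bh bc h0]) (assumption | rule that)+
  define r' where "r' l x = Re (r l (cvec x))" for l x
  show thesis
  proof
    show "cx_analytic (r' l)" for l unfolding r'_def by (rule cx_analytic_Re[OF V(1,2,6)])
    show "\<forall>\<^sub>F p in nhds (0, 0). snd p ^ d = (\<Sum>l<d. w l (fst p) * snd p ^ l) \<longrightarrow>
        f (fst p + snd p *\<^sub>R v) = (\<Sum>l<d. r' l (fst p) * snd p ^ l)"
    proof (rule eventually_prod_ballI[OF _ V(1,2)])
      let ?\<delta> = "min \<rho> (R / (2 * (norm v + 1)))"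
      show "?\<delta> > 0" using V(4) F(1) by (auto intro!: divide_pos_pos simp: add_nonneg_pos)
      show "min S (R / 2) > 0" using F(1) S by simp
      fix y t assume y: "cvec y \<in> V" and t: "\<bar>t\<bar> < ?\<delta>" and yt: "norm y + \<bar>t\<bar> < min S (R / 2)"
        and yS: "y \<in> ball 0 (min S (R / 2))"
      have "\<bar>t\<bar> * norm v \<le> R / 2"
      proof -
        have "\<bar>t\<bar> * norm v \<le> R / (2 * (norm v + 1)) * (norm v + 1)"
          using t F(1) by (intro mult_mono) auto
        also have "\<dots> = R / 2"
        proof -
          have "norm v + 1 \<noteq> 0" using norm_ge_zero[of v] by linarith
          then show ?thesis by (simp add: nonzero_eq_divide_eq divide_eq_eq)
        qed
        finally show ?thesis .
      qed
      then have yv: "y + t *\<^sub>R v \<in> ball 0 R"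
        using yS norm_triangle_ineq[of y "t *\<^sub>R v"] by simp
      obtain q where q: "(\<Sum>k. c k (cvec y) * of_real t ^ k) =
          q * (\<Sum>k. h k (cvec y) * of_real t ^ k) + (\<Sum>l<d. r l (cvec y) * of_real t ^ l)"
        using V(8)[OF y, of "of_real t"] t by auto
      have "(\<Sum>k. h k (cvec y) * of_real t ^ k) = (\<Sum>k\<in>{..d}. h k (cvec y) * of_real t ^ k)"
        by (rule suminf_finite) (auto simp: h_def)
      also have "\<dots> = of_real t ^ d - (\<Sum>k<d. of_real (w k y) * of_real t ^ k)"
        using H(2)[of _ y] yS by (simp add: h_def sum_negf flip: lessThan_Suc_atMost)
      also have "\<dots> = of_real (t ^ d - (\<Sum>k<d. w k y * t ^ k))" by simp
      finally have hs: "(\<Sum>k. h k (cvec y) * of_real t ^ k) = of_real (t ^ d - (\<Sum>k<d. w k y * t ^ k))" .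
      have "(\<Sum>k. c k (cvec y) * of_real t ^ k) = F (cvec y + of_real t *s cvec v)"
        using U(6)[of "cvec y" "of_real t"] y V(3,5) N(3) t by (auto simp: sums_iff)
      then have eq: "of_real (f (y + t *\<^sub>R v)) = q * of_real (t ^ d - (\<Sum>k<d. w k y * t ^ k))
           + (\<Sum>l<d. r l (cvec y) * of_real (t ^ l))"
        using q hs F(3)[OF yv] by (simp add: cvec_add cvec_scaleR)
      show "snd (y, t) ^ d = (\<Sum>l<d. w l (fst (y, t)) * snd (y, t) ^ l) \<longrightarrow>
          f (fst (y, t) + snd (y, t) *\<^sub>R v) = (\<Sum>l<d. r' l (fst (y, t)) * snd (y, t) ^ l)"
      proof
        assume "snd (y, t) ^ d = (\<Sum>l<d. w l (fst (y, t)) * snd (y, t) ^ l)"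
        then have "complex_of_real (f (y + t *\<^sub>R v)) = (\<Sum>l<d. r l (cvec y) * of_real (t ^ l))"
          using eq by simp
        then have "f (y + t *\<^sub>R v) = Re (\<Sum>l<d. r l (cvec y) * of_real (t ^ l))"
          by (metis Re_complex_of_real)
        then show "f (fst (y, t) + snd (y, t) *\<^sub>R v) = (\<Sum>l<d. r' l (fst (y, t)) * snd (y, t) ^ l)"
          by (simp add: r'_def)
      qed
    qed
  qed
qed

section \<open>Zeros of real analytic germs\<close>

text \<open>The leading coefficient \<open>p e\<close> may vanish at the origin, so it is multiplied
  in rather than divided out. The quotient \<open>s\<close> is left as a bare function because the
  identity is applied only at roots of the divisor; the remainder has to be analytic for the
  induction on the dimension.\<close>

lemma pseudo_division:
  assumes p: "\<And>l. cx_analytic (p l)" and g: "\<And>l. cx_analytic (g l)"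
  shows "\<exists>m s r. (\<forall>l. cx_analytic (r l)) \<and> (\<forall>y t. p e y ^ m * (\<Sum>l<N. g l y * t ^ l) =
           s y t * (\<Sum>l\<le>e. p l y * t ^ l) + (\<Sum>l<e::nat. r l y * t ^ l))"
  using g
proof (induction N arbitrary: g)
  case 0
  show ?case
    by (intro exI[of _ 0] exI[of _ "\<lambda>_ _. 0"] exI[of _ "\<lambda>_ _. 0"]) (auto intro: cx_analytic_const)
next
  case (Suc N)
  show ?case
  proof (cases "N < e")
    case True
    define r where "r l = (if l < Suc N then g l else (\<lambda>_. 0))" for l
    have "cx_analytic (r l)" for l using Suc.prems by (auto simp: r_def intro: cx_analytic_const)
    moreover have "(\<Sum>l<e. r l y * t ^ l) = (\<Sum>l<Suc N. g l y * t ^ l)" for y t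
      using True by (intro sum.mono_neutral_cong_right) (auto simp: r_def)
    ultimately show ?thesis
      by (intro exI[of _ 0] exI[of _ "\<lambda>_ _. 0"] exI[of _ r]) auto
  next
    case False
    define k where "k = N - e"
    have N: "N = k + e" using False by (simp add: k_def)
    \<comment> \<open>Multiplying by \<open>p e\<close> and subtracting \<open>g N * t^k\<close>
      times the divisor cancels the term of degree \<open>N = k + e\<close>.\<close>
    define g' where "g' l = (if l \<ge> k then (\<lambda>y. p e y * g l y - g N y * p (l - k) y) else (\<lambda>y. p e y * g l y))" for l
    have g': "cx_analytic (g' l)" for l
      by (auto simp: g'_def intro!: cx_analytic_diff cx_analytic_mult p Suc.prems)
    obtain m s r where r: "\<And>l. cx_analytic (r l)" and msr: "\<And>y t. p e y ^ m * (\<Sum>l<N. g' l y * t ^ l) =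
           s y t * (\<Sum>l\<le>e. p l y * t ^ l) + (\<Sum>l<e. r l y * t ^ l)"
      using Suc.IH[of g'] g' by blast
    have red: "(\<Sum>l<N. g' l y * t ^ l) = p e y * (\<Sum>l<Suc N. g l y * t ^ l) - g N y * t ^ k * (\<Sum>l\<le>e. p l y * t ^ l)" for y t
    proof -
      have "g N y * t ^ k * (\<Sum>l\<le>e. p l y * t ^ l) = (\<Sum>l\<in>{k..k + e}. g N y * p (l - k) y * t ^ l)"
        unfolding sum_distrib_left
        by (rule sum.reindex_bij_witness[of _ "\<lambda>l. l - k" "\<lambda>l. l + k"]) (auto simp: power_add)
      also have "\<dots> = (\<Sum>l<Suc N. (if l \<ge> k then g N y * p (l - k) y else 0) * t ^ l)"
        by (rule sum.mono_neutral_cong_left) (auto simp: N)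
      finally have "p e y * (\<Sum>l<Suc N. g l y * t ^ l) - g N y * t ^ k * (\<Sum>l\<le>e. p l y * t ^ l) =
          (\<Sum>l<Suc N. p e y * (g l y * t ^ l) - (if l \<ge> k then g N y * p (l - k) y else 0) * t ^ l)"
        by (simp only: sum_distrib_left sum_subtractf)
      also have "\<dots> = (\<Sum>l<Suc N. g' l y * t ^ l)"
        by (intro sum.cong) (auto simp: g'_def algebra_simps)
      also have "\<dots> = (\<Sum>l<N. g' l y * t ^ l)"
        by (simp add: g'_def N)
      finally show ?thesis by simp
    qed
    have "p e y ^ Suc m * (\<Sum>l<Suc N. g l y * t ^ l) =
        (s y t + p e y ^ m * g N y * t ^ k) * (\<Sum>l\<le>e. p l y * t ^ l) + (\<Sum>l<e. r l y * t ^ l)" for y t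
      using msr[of y t] unfolding red by (simp add: algebra_simps)
    then show ?thesis using r
      by (intro exI[of _ "Suc m"] exI[of _ "\<lambda>y t. s y t + p e y ^ m * g N y * t ^ k"] exI[of _ r]) auto
  qed
qed

text \<open>At a simple root the polynomial changes sign, and the signs at \<open>\<tau> - h\<close>
  and \<open>\<tau> + h\<close> survive small changes of continuous coefficients; the intermediate
  value theorem does the rest. Existence of a nearby root is enough for lifting solutions.\<close>

lemma simple_root_persists_pos:
  fixes p :: "nat \<Rightarrow> 'a::metric_space \<Rightarrow> real"
  assumes cont: "\<And>l. l \<le> e \<Longrightarrow> isCont (p l) a" and root: "(\<Sum>l\<le>e. p l a * \<tau> ^ l) = 0"
    and pos: "(\<Sum>l\<le>e. p l a * (real l * \<tau> ^ (l - 1))) > 0" and \<epsilon>: "\<epsilon> > 0"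
  shows "\<forall>\<^sub>F y in nhds a. \<exists>t. \<bar>t - \<tau>\<bar> < \<epsilon> \<and> (\<Sum>l\<le>e. p l y * t ^ l) = 0"
proof -
  define P where "P y t = (\<Sum>l\<le>e. p l y * t ^ l)" for y t
  have der: "(P a has_real_derivative (\<Sum>l\<le>e. p l a * (real l * \<tau> ^ (l - 1)))) (at \<tau>)"
    unfolding P_def by (auto intro!: derivative_eq_intros sum.cong simp: algebra_simps)
  obtain d1 where d1: "d1 > 0" "\<And>h. 0 < h \<Longrightarrow> h < d1 \<Longrightarrow> P a \<tau> < P a (\<tau> + h)"
    using DERIV_pos_inc_right[OF der pos] by blast
  obtain d2 where d2: "d2 > 0" "\<And>h. 0 < h \<Longrightarrow> h < d2 \<Longrightarrow> P a (\<tau> - h) < P a \<tau>"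
    using DERIV_pos_inc_left[OF der pos] by blast
  define h where "h = min (min d1 d2) \<epsilon> / 2"
  have h: "0 < h" "h < d1" "h < d2" "h < \<epsilon>" using d1 d2 \<epsilon> by (auto simp: h_def)
  have Pa: "P a \<tau> = 0" using root by (simp add: P_def)
  have lim: "((\<lambda>y. P y t) \<longlongrightarrow> P a t) (nhds a)" for t
    unfolding P_def
    by (intro tendsto_sum tendsto_mult tendsto_const)
      (use cont in \<open>auto simp: isCont_def tendsto_at_iff_tendsto_nhds\<close>)
  have "\<forall>\<^sub>F y in nhds a. P y (\<tau> - h) < 0"
    using order_tendstoD(2)[OF lim] d2(2)[OF h(1,3)] Pa by simp
  moreover have "\<forall>\<^sub>F y in nhds a. P y (\<tau> + h) > 0"
    using order_tendstoD(1)[OF lim] d1(2)[OF h(1,2)] Pa by simp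
  ultimately show ?thesis
  proof eventually_elim
    case (elim y)
    have "continuous_on {\<tau> - h..\<tau> + h} (P y)"
      unfolding P_def by (intro continuous_intros)
    then obtain t where "\<tau> - h \<le> t" "t \<le> \<tau> + h" "P y t = 0"
      using IVT'[of "P y" "\<tau> - h" 0 "\<tau> + h"] elim h by auto
    then show ?case using h by (intro exI[of _ t]) (auto simp: P_def)
  qed
qed

lemma simple_root_persists:
  fixes p :: "nat \<Rightarrow> 'a::metric_space \<Rightarrow> real"
  assumes cont: "\<And>l. l \<le> e \<Longrightarrow> isCont (p l) a" and root: "(\<Sum>l\<le>e. p l a * \<tau> ^ l) = 0"
    and simple: "(\<Sum>l\<le>e. p l a * (real l * \<tau> ^ (l - 1))) \<noteq> 0" and \<epsilon>: "\<epsilon> > 0"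
  shows "\<forall>\<^sub>F y in nhds a. \<exists>t. \<bar>t - \<tau>\<bar> < \<epsilon> \<and> (\<Sum>l\<le>e. p l y * t ^ l) = 0"
proof (cases "(\<Sum>l\<le>e. p l a * (real l * \<tau> ^ (l - 1))) > 0")
  case True
  then show ?thesis by (intro simple_root_persists_pos assms)
next
  case False
  have "\<forall>\<^sub>F y in nhds a. \<exists>t. \<bar>t - \<tau>\<bar> < \<epsilon> \<and> (\<Sum>l\<le>e. (\<lambda>y. - p l y) y * t ^ l) = 0"
    by (rule simple_root_persists_pos[where p = "\<lambda>l y. - p l y"])
      (use assms False in \<open>auto simp: sum_negf intro: continuous_minus\<close>)
  then show ?thesis by (simp add: sum_negf)
qed

text \<open>Induction on \<open>dim V\<close>. A polynomial \<open>P\<close> of least degree in the last coordinate that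
  vanishes along some subsequence has simple roots there, so \<open>{P = 0}\<close> is locally a graph, and
  pseudo-division by \<open>P\<close> reduces the equations to equations in the remaining coordinates.\<close>

theorem cx_analytic_zeros_not_isolated:
  fixes x :: "nat \<Rightarrow> real^'n::finite"
  assumes "subspace V" "finite Fs" "\<And>f. f \<in> Fs \<Longrightarrow> cx_analytic f" "x \<longlonglongrightarrow> 0"
    "\<And>j. x j \<in> V" "\<And>j. x j \<noteq> 0" "\<And>j f. f \<in> Fs \<Longrightarrow> f (x j) = 0"
  shows "\<exists>j. \<forall>\<epsilon>>0. \<exists>y\<in>V. y \<noteq> x j \<and> dist y (x j) < \<epsilon> \<and> (\<forall>f\<in>Fs. f y = 0)"
  using assms
proof (induction "dim V" arbitrary: V Fs x rule: less_induct)
  case less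
  note V = less.prems(1) and fin = less.prems(2) and cx_analytic = less.prems(3) and x0 = less.prems(4)
    and xV = less.prems(5) and xnz = less.prems(6) and fx = less.prems(7)
  show ?case
  proof (cases "\<forall>f\<in>Fs. \<forall>\<^sub>F y in nhds 0. y \<in> V \<longrightarrow> f y = 0")
    case True
    then have "\<forall>\<^sub>F y in nhds 0. \<forall>f\<in>Fs. y \<in> V \<longrightarrow> f y = 0"
      by (rule eventually_ball_finite[OF fin])
    then obtain \<delta> where \<delta>: "\<delta> > 0" "\<And>y f. norm y < \<delta> \<Longrightarrow> y \<in> V \<Longrightarrow> f \<in> Fs \<Longrightarrow> f y = 0"
      unfolding eventually_nhds_metric by (auto simp: dist_norm)
    have "\<forall>\<^sub>F j in sequentially. norm (x j) < \<delta>"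
      using order_tendstoD(2)[OF tendsto_norm[OF x0]] \<delta> by simp
    then obtain j where j: "norm (x j) < \<delta>" by (auto simp: eventually_sequentially)
    have "\<exists>y\<in>V. y \<noteq> x j \<and> dist y (x j) < \<epsilon> \<and> (\<forall>f\<in>Fs. f y = 0)" if "\<epsilon> > 0" for \<epsilon>
    proof -
      \<comment> \<open>A small outward move of \<open>x j\<close> along its own ray stays in
        \<open>V\<close> and inside the ball on which all of \<open>Fs\<close> vanishes on
        \<open>V\<close>.\<close>
      define s where "s = min \<epsilon> (\<delta> - norm (x j)) / (2 * norm (x j))"
      have nx: "norm (x j) > 0" using xnz by simp
      have s: "s > 0" "s * norm (x j) < \<epsilon>" "s * norm (x j) < \<delta> - norm (x j)"
        using that j nx by (auto simp: s_def)
      let ?y = "x j + s *\<^sub>R x j"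
      have "?y \<in> V" by (intro subspace_add subspace_scale V xV)
      moreover have "norm ?y < \<delta>" using norm_triangle_ineq[of "x j" "s *\<^sub>R x j"] s by simp
      moreover have "?y \<noteq> x j" "dist ?y (x j) < \<epsilon>" using s xnz[of j] by (auto simp: dist_norm)
      ultimately show ?thesis using \<delta>(2) by blast
    qed
    then show ?thesis by blast
  next
    case False
    then obtain f1 where f1: "f1 \<in> Fs" "\<not> (\<forall>\<^sub>F y in nhds 0. y \<in> V \<longrightarrow> f1 y = 0)" by blast
    obtain v where v: "v \<in> V" "\<not> (\<forall>\<^sub>F t in nhds 0. f1 (t *\<^sub>R v) = 0)"
      using cx_analytic_zero_on_lines[OF cx_analytic[OF f1(1)] V] f1(2) by blast
    have f10: "f1 0 = 0"
    proof (rule LIMSEQ_unique)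
      have "isCont f1 0" using eventually_nhds_x_imp_x[OF cx_analytic_isCont[OF cx_analytic[OF f1(1)]]] .
      then show "(\<lambda>j. f1 (x j)) \<longlonglongrightarrow> f1 0" using x0 by (rule isCont_tendsto_compose)
      show "(\<lambda>j. f1 (x j)) \<longlonglongrightarrow> 0" using fx[OF f1(1)] by simp
    qed
    have vnz: "v \<noteq> 0" using v(2) f10 by auto
    \<comment> \<open>The remaining coordinates, orthogonal to the direction along which
      \<open>f1\<close> is not identically zero; the points split accordingly as
      \<open>a j + \<tau> j v\<close>.\<close>
    define V' where "V' = {y \<in> V. y \<bullet> v = 0}"
    have V': "subspace V'"
      using V unfolding V'_def subspace_def by (auto simp: inner_add_left)
    have "v \<notin> V'" "V' \<subseteq> V" using vnz by (auto simp: V'_def)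
    then have "V' \<subset> V" using v(1) by blast
    then have dimV': "dim V' < dim V"
      using dim_psubset[of V' V] V V' by (simp add: span_eq_iff[THEN iffD2])
    define \<tau> where "\<tau> j = (x j \<bullet> v) / (v \<bullet> v)" for j
    define a where "a j = x j - \<tau> j *\<^sub>R v" for j
    have xa: "x j = a j + \<tau> j *\<^sub>R v" for j by (simp add: a_def)
    have aV': "a j \<in> V'" for j
      unfolding V'_def a_def using V xV v(1) vnz
      by (auto simp: \<tau>_def inner_diff_left intro: subspace_diff subspace_scale)
    have \<tau>0: "\<tau> \<longlonglongrightarrow> 0"
    proof -
      have "\<tau> \<longlonglongrightarrow> (0 \<bullet> v) / (v \<bullet> v)" unfolding \<tau>_def by (intro tendsto_intros x0) (use vnz in auto)
      then show ?thesis by simp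
    qed
    have a0: "a \<longlonglongrightarrow> 0"
    proof -
      have "a \<longlonglongrightarrow> 0 - 0 *\<^sub>R v" unfolding a_def by (intro tendsto_intros x0 \<tau>0)
      then show ?thesis by simp
    qed
    obtain d w where w: "\<And>l. cx_analytic (w l)" "\<And>l. l < d \<Longrightarrow> w l 0 = 0" and wf: 
      "\<forall>\<^sub>F p in nhds (0, 0). f1 (fst p + snd p *\<^sub>R v) = 0 \<longrightarrow> snd p ^ d = (\<Sum>l<d. w l (fst p) * snd p ^ l)"
      by (rule cx_analytic_monic_multiple[OF cx_analytic[OF f1(1)] v(2)]) (rule that)
    have "\<forall>f\<in>Fs. \<exists>r. (\<forall>l. cx_analytic (r l)) \<and> (\<forall>\<^sub>F p in nhds (0, 0). snd p ^ d = (\<Sum>l<d. w l (fst p) * snd p ^ l) \<longrightarrow>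
        f (fst p + snd p *\<^sub>R v) = (\<Sum>l<d. r l (fst p) * snd p ^ l))"
    proof
      fix f assume f: "f \<in> Fs"
      obtain r where "\<And>l. cx_analytic (r l)"
        "\<forall>\<^sub>F p in nhds (0, 0). snd p ^ d = (\<Sum>l<d. w l (fst p) * snd p ^ l) \<longrightarrow>
          f (fst p + snd p *\<^sub>R v) = (\<Sum>l<d. r l (fst p) * snd p ^ l)"
        by (rule cx_analytic_remainder[OF cx_analytic[OF f] w, where v = v and d = d]) (assumption | rule that)+
      then show "\<exists>r. (\<forall>l. cx_analytic (r l)) \<and> (\<forall>\<^sub>F p in nhds (0, 0). snd p ^ d = (\<Sum>l<d. w l (fst p) * snd p ^ l) \<longrightarrow>
        f (fst p + snd p *\<^sub>R v) = (\<Sum>l<d. r l (fst p) * snd p ^ l))"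
        by (intro exI[of _ r] conjI allI)
    qed
    from bchoice[OF this] obtain r where r: "\<And>f l. f \<in> Fs \<Longrightarrow> cx_analytic (r f l)" and rf:
      "\<And>f. f \<in> Fs \<Longrightarrow> (\<forall>\<^sub>F p in nhds (0, 0). snd p ^ d = (\<Sum>l<d. w l (fst p) * snd p ^ l) \<longrightarrow>
        f (fst p + snd p *\<^sub>R v) = (\<Sum>l<d. r f l (fst p) * snd p ^ l))"
      by blast
    have "\<forall>\<^sub>F p in nhds (0, 0). (f1 (fst p + snd p *\<^sub>R v) = 0 \<longrightarrow> snd p ^ d = (\<Sum>l<d. w l (fst p) * snd p ^ l)) \<and>
        (\<forall>f\<in>Fs. snd p ^ d = (\<Sum>l<d. w l (fst p) * snd p ^ l) \<longrightarrow>
        f (fst p + snd p *\<^sub>R v) = (\<Sum>l<d. r f l (fst p) * snd p ^ l))"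
      by (intro eventually_conj wf eventually_ball_finite fin ballI rf)
    then obtain N where N: "open N" "(0, 0) \<in> N" and NP:
      "\<forall>p\<in>N. (f1 (fst p + snd p *\<^sub>R v) = 0 \<longrightarrow> snd p ^ d = (\<Sum>l<d. w l (fst p) * snd p ^ l)) \<and>
        (\<forall>f\<in>Fs. snd p ^ d = (\<Sum>l<d. w l (fst p) * snd p ^ l) \<longrightarrow>
        f (fst p + snd p *\<^sub>R v) = (\<Sum>l<d. r f l (fst p) * snd p ^ l))"
      unfolding eventually_nhds by blast
    have NW: "t ^ d = (\<Sum>l<d. w l y * t ^ l)" if "(y, t) \<in> N" "f1 (y + t *\<^sub>R v) = 0" for y t
      using bspec[OF NP that(1)] that(2) by simp
    have Nf: "f (y + t *\<^sub>R v) = (\<Sum>l<d. r f l y * t ^ l)"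
      if "(y, t) \<in> N" "f \<in> Fs" "t ^ d = (\<Sum>l<d. w l y * t ^ l)" for y t f
      using bspec[OF NP that(1)] that(2,3) by simp
    have "(\<lambda>j. (a j, \<tau> j)) \<longlonglongrightarrow> (0, 0)" by (intro tendsto_Pair a0 \<tau>0)
    then have "\<forall>\<^sub>F j in sequentially. (a j, \<tau> j) \<in> N" by (rule topological_tendstoD[OF _ N])
    then obtain J where J: "\<And>j. j \<ge> J \<Longrightarrow> (a j, \<tau> j) \<in> N" by (auto simp: eventually_sequentially)
    have W: "\<tau> j ^ d = (\<Sum>l<d. w l (a j) * \<tau> j ^ l)" if "j \<ge> J" for j
      by (rule NW[OF J[OF that]]) (use fx[OF f1(1), of j] xa in simp)
    \<comment> \<open>Over the origin the Weierstrass polynomial is \<open>t^d\<close>, so a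
      vanishing projection would force the whole point to vanish. The induction hypothesis needs
      nonzero points.\<close>
    have anz: "a j \<noteq> 0" if "j \<ge> J" for j
    proof
      assume "a j = 0"
      then have "\<tau> j ^ d = 0" using W[OF that] w(2) by simp
      then have "\<tau> j = 0" by (metis power_not_zero)
      then show False using xa[of j] \<open>a j = 0\<close> xnz by simp
    qed
    \<comment> \<open>Some polynomial of formal degree \<open>e\<close> with analytic coefficients
      vanishes along the subsequence \<open>s\<close>, and its leading coefficient is nonzero at
      each projected point, so the degree is attained there.\<close>
    define good where "good e s p \<longleftrightarrow> strict_mono s \<and> (\<forall>l. cx_analytic (p l)) \<and>
      (\<forall>j. p e (a (s j)) \<noteq> 0 \<and> (\<Sum>l\<le>e. p l (a (s j)) * \<tau> (s j) ^ l) = 0)"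
      for e :: nat and s :: "nat \<Rightarrow> nat" and p :: "nat \<Rightarrow> real^'n \<Rightarrow> real"
    define w' where "w' l = (if l = d then (\<lambda>_. 1) else (\<lambda>y. 0 - w l y))" for l
    have w': "cx_analytic (w' l)" for l
      unfolding w'_def using cx_analytic_diff[OF cx_analytic_const w(1), of 0 l] by (auto intro: cx_analytic_const)
    have w'sum: "(\<Sum>l<Suc d. w' l y * t ^ l) = t ^ d - (\<Sum>l<d. w l y * t ^ l)" for y t
      by (simp add: w'_def sum_negf)
    \<comment> \<open>The monic Weierstrass polynomial is a candidate, so a least degree
      exists.\<close>
    have "good d (\<lambda>j. j + J) w'"
      unfolding good_def using w' w'sum W
      by (auto simp: strict_mono_def w'_def lessThan_Suc_atMost[symmetric] simp del: sum.lessThan_Suc)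
    then have ex: "\<exists>e. \<exists>s p. good e s p" by blast
    define e where "e = (LEAST e. \<exists>s p. good e s p)"
    obtain s0 p where good0: "good e s0 p"
      using LeastI_ex[OF ex] unfolding e_def by blast
    define s where "s j = s0 (j + J)" for j
    have "strict_mono s0" using good0 by (simp add: good_def)
    then have sm: "strict_mono s" by (auto simp: s_def strict_mono_def)
    have sJ: "s j \<ge> J" for j
      using strict_mono_imp_increasing[OF \<open>strict_mono s0\<close>, of "j + J"] by (simp add: s_def)
    have p: "cx_analytic (p l)" "p e (a (s j)) \<noteq> 0" "(\<Sum>l\<le>e. p l (a (s j)) * \<tau> (s j) ^ l) = 0" for l j
      using good0 by (auto simp: good_def s_def)
    \<comment> \<open>An infinite index set is enumerated into a further subsequence, which would
      make the smaller degree good. Passing to subsequences is built into \<open>good\<close> for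
      this purpose.\<close>
    have minimal: False if "n < e" "\<And>l. cx_analytic (q l)"
      "infinite {j. q n (a (s j)) \<noteq> 0 \<and> (\<Sum>l\<le>n. q l (a (s j)) * \<tau> (s j) ^ l) = 0}" for n q
    proof -
      let ?I = "{j. q n (a (s j)) \<noteq> 0 \<and> (\<Sum>l\<le>n. q l (a (s j)) * \<tau> (s j) ^ l) = 0}"
      have "strict_mono (s \<circ> enumerate ?I)"
        using sm strict_mono_enumerate[OF that(3)] by (auto intro: strict_mono_o)
      moreover have "enumerate ?I j \<in> ?I" for j using enumerate_in_set[OF that(3)] .
      ultimately have "good n (s \<circ> enumerate ?I) q"
        unfolding good_def using that(2) by auto
      then show False using not_less_Least[of n "\<lambda>e. \<exists>s p. good e s p"] that(1) unfolding e_def by blast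
    qed
    have e0: "e > 0" using p(2,3)[of 0] by (cases e) auto
    \<comment> \<open>A polynomial of degree below \<open>e\<close> vanishing at the points loses
      its top coefficient there, by minimality; repeating this removes all coefficients at almost
      all points.\<close>
    have vanish: "\<forall>\<^sub>F j in sequentially. \<forall>l<n. q l (a (s j)) = 0"
      if "n \<le> e" "\<And>l. cx_analytic (q l)" "\<forall>\<^sub>F j in sequentially. (\<Sum>l<n. q l (a (s j)) * \<tau> (s j) ^ l) = 0" for n q
      using that
    proof (induction n)
      case (Suc n)
      have ev: "\<forall>\<^sub>F j in sequentially. q n (a (s j)) = 0"
      proof (rule ccontr)
        assume "\<not> ?thesis"
        then have fr: "\<exists>\<^sub>F j in sequentially. q n (a (s j)) \<noteq> 0" by (simp add: frequently_def)
        have "\<exists>\<^sub>F j in sequentially. q n (a (s j)) \<noteq> 0 \<and> (\<Sum>l\<le>n. q l (a (s j)) * \<tau> (s j) ^ l) = 0"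
          by (rule frequently_rev_mp[OF fr]) (use Suc.prems(3) in \<open>auto simp only: lessThan_Suc_atMost elim!: eventually_mono\<close>)
        then have "infinite {j. q n (a (s j)) \<noteq> 0 \<and> (\<Sum>l\<le>n. q l (a (s j)) * \<tau> (s j) ^ l) = 0}"
          by (simp add: INFM_iff_infinite cofinite_eq_sequentially[symmetric])
        then show False using minimal[of n q] Suc.prems by simp
      qed
      have "\<forall>\<^sub>F j in sequentially. (\<Sum>l<n. q l (a (s j)) * \<tau> (s j) ^ l) = 0"
        using ev Suc.prems(3) by eventually_elim simp
      then have "\<forall>\<^sub>F j in sequentially. \<forall>l<n. q l (a (s j)) = 0"
        using Suc.IH Suc.prems by simp
      with ev show ?case by eventually_elim (auto simp: less_Suc_eq)
    qed simp
    \<comment> \<open>The derivative in \<open>t\<close> has degree \<open>e - 1\<close> and leading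
      coefficient \<open>e * p e\<close>, nonzero at the points, so minimality excludes its
      vanishing infinitely often.\<close>
    have simple: "\<forall>\<^sub>F j in sequentially. (\<Sum>l\<le>e. p l (a (s j)) * (real l * \<tau> (s j) ^ (l - 1))) \<noteq> 0"
    proof (rule ccontr)
      assume neg: "\<not> ?thesis"
      obtain n where n: "e = Suc n" using e0 gr0_conv_Suc by blast
      define q where "q l y = real (Suc l) * p (Suc l) y" for l y
      have q: "cx_analytic (q l)" for l unfolding q_def by (intro cx_analytic_mult cx_analytic_const p)
      have qs: "(\<Sum>l\<le>e. p l y * (real l * t ^ (l - 1))) = (\<Sum>l\<le>n. q l y * t ^ l)" for y t
        unfolding n by (subst sum.atMost_Suc_shift) (simp add: q_def algebra_simps)
      have "\<exists>\<^sub>F j in sequentially. (\<Sum>l\<le>n. q l (a (s j)) * \<tau> (s j) ^ l) = 0"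
        using neg unfolding frequently_def qs .
      then have "infinite {j. (\<Sum>l\<le>n. q l (a (s j)) * \<tau> (s j) ^ l) = 0}"
        by (simp add: INFM_iff_infinite cofinite_eq_sequentially[symmetric])
      moreover have "q n (a (s j)) \<noteq> 0" for j using p(2)[of j] by (simp add: q_def n)
      ultimately show False using minimal[of n q] q n by simp
    qed
    \<comment> \<open>The Weierstrass polynomial is reduced as well: the remainders
      \<open>r f\<close> represent \<open>f\<close> only on its roots, so a lifted point must be
      shown to be such a root first.\<close>
    obtain m0 S0 R0 where R0: "\<And>l. cx_analytic (R0 l)" and R0eq: "\<And>y t. p e y ^ m0 * (\<Sum>l<Suc d. w' l y * t ^ l) =
           S0 y t * (\<Sum>l\<le>e. p l y * t ^ l) + (\<Sum>l<e. R0 l y * t ^ l)"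
      using pseudo_division[of p w' e "Suc d", OF p(1) w'] by blast
    have "\<forall>f\<in>Fs. \<exists>R. (\<forall>l. cx_analytic (R l)) \<and> (\<exists>m S. \<forall>y t. p e y ^ m * (\<Sum>l<d. r f l y * t ^ l) =
           S y t * (\<Sum>l\<le>e. p l y * t ^ l) + (\<Sum>l<e. R l y * t ^ l))"
    proof
      fix f assume f: "f \<in> Fs"
      show "\<exists>R. (\<forall>l. cx_analytic (R l)) \<and> (\<exists>m S. \<forall>y t. p e y ^ m * (\<Sum>l<d. r f l y * t ^ l) =
           S y t * (\<Sum>l\<le>e. p l y * t ^ l) + (\<Sum>l<e. R l y * t ^ l))"
        using pseudo_division[of p "r f" e d, OF p(1) r[OF f]] by blast
    qed
    from bchoice[OF this] obtain R where R: "\<And>f l. f \<in> Fs \<Longrightarrow> cx_analytic (R f l)" and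
      Req: "\<And>f. f \<in> Fs \<Longrightarrow> \<exists>m S. \<forall>y t. p e y ^ m * (\<Sum>l<d. r f l y * t ^ l) =
           S y t * (\<Sum>l\<le>e. p l y * t ^ l) + (\<Sum>l<e. R f l y * t ^ l)"
      by blast
    have evR0: "\<forall>\<^sub>F j in sequentially. \<forall>l<e. R0 l (a (s j)) = 0"
    proof (rule vanish[OF order_refl R0])
      have "(\<Sum>l<e. R0 l (a (s j)) * \<tau> (s j) ^ l) = 0" for j
        using R0eq[of "a (s j)" "\<tau> (s j)"] w'sum W[OF sJ[of j]] p(3)[of j] by (simp del: sum.lessThan_Suc)
      then show "\<forall>\<^sub>F j in sequentially. (\<Sum>l<e. R0 l (a (s j)) * \<tau> (s j) ^ l) = 0" by simp
    qed
    have evR: "\<forall>\<^sub>F j in sequentially. \<forall>l<e. R f l (a (s j)) = 0" if f: "f \<in> Fs" for f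
    proof (rule vanish[OF order_refl R[OF f]])
      obtain m S where mS: "\<And>y t. p e y ^ m * (\<Sum>l<d. r f l y * t ^ l) =
           S y t * (\<Sum>l\<le>e. p l y * t ^ l) + (\<Sum>l<e. R f l y * t ^ l)"
        using Req[OF f] by blast
      have "(\<Sum>l<d. r f l (a (s j)) * \<tau> (s j) ^ l) = 0" for j
        using Nf[OF J[OF sJ] f W[OF sJ], of j] fx[OF f, of "s j"] xa[of "s j"] by simp
      then have "(\<Sum>l<e. R f l (a (s j)) * \<tau> (s j) ^ l) = 0" for j
        using mS[of "a (s j)" "\<tau> (s j)"] p(3)[of j] by simp
      then show "\<forall>\<^sub>F j in sequentially. (\<Sum>l<e. R f l (a (s j)) * \<tau> (s j) ^ l) = 0" by simp
    qed
    have evR': "\<forall>\<^sub>F j in sequentially. \<forall>f\<in>Fs. \<forall>l<e. R f l (a (s j)) = 0"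
      by (intro eventually_ball_finite fin ballI evR)
    have as0: "(\<lambda>j. a (s j)) \<longlonglongrightarrow> 0"
      using LIMSEQ_subseq_LIMSEQ[OF a0 sm] by (simp add: o_def)
    have "\<forall>\<^sub>F y in nhds 0. \<forall>l\<in>{..e}. isCont (p l) y"
      by (intro eventually_ball_finite ballI cx_analytic_isCont p) auto
    then have evc: "\<forall>\<^sub>F j in sequentially. \<forall>l\<in>{..e}. isCont (p l) (a (s j))"
      using as0 by (rule eventually_compose_filterlim)
    from evR0 evR' simple evc have "\<forall>\<^sub>F j in sequentially. (\<forall>l<e. R0 l (a (s j)) = 0) \<and>
        (\<forall>f\<in>Fs. \<forall>l<e. R f l (a (s j)) = 0) \<and>
        (\<Sum>l\<le>e. p l (a (s j)) * (real l * \<tau> (s j) ^ (l - 1))) \<noteq> 0 \<and> (\<forall>l\<in>{..e}. isCont (p l) (a (s j)))"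
      by eventually_elim blast
    then obtain K where K: "\<And>j. j \<ge> K \<Longrightarrow> (\<forall>l<e. R0 l (a (s j)) = 0) \<and>
        (\<forall>f\<in>Fs. \<forall>l<e. R f l (a (s j)) = 0) \<and>
        (\<Sum>l\<le>e. p l (a (s j)) * (real l * \<tau> (s j) ^ (l - 1))) \<noteq> 0 \<and> (\<forall>l\<in>{..e}. isCont (p l) (a (s j)))"
      unfolding eventually_sequentially by blast
    \<comment> \<open>All remainder coefficients, as equations in the projected point only. Together
      with a root \<open>t\<close> of the least-degree polynomial and a nonzero leading coefficient
      they imply the original system.\<close>
    define F' where "F' = R0 ` {..<e} \<union> (\<Union>f\<in>Fs. R f ` {..<e})"
    have "\<exists>j. \<forall>\<epsilon>>0. \<exists>y\<in>V'. y \<noteq> a (s (j + K)) \<and> dist y (a (s (j + K))) < \<epsilon> \<and> (\<forall>f\<in>F'. f y = 0)"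
    proof (rule less.hyps[OF dimV' V'])
      show "finite F'" using fin by (auto simp: F'_def)
      show "cx_analytic f" if "f \<in> F'" for f using that R0 R by (auto simp: F'_def)
      show "(\<lambda>j. a (s (j + K))) \<longlonglongrightarrow> 0" using as0 by (rule LIMSEQ_ignore_initial_segment)
      show "a (s (j + K)) \<in> V'" for j by (rule aV')
      show "a (s (j + K)) \<noteq> 0" for j by (rule anz[OF sJ])
      show "f (a (s (j + K))) = 0" if "f \<in> F'" for j f
        using that K[of "j + K"] by (auto simp: F'_def)
    qed
    then obtain j where j: "\<And>\<epsilon>. \<epsilon> > 0 \<Longrightarrow> \<exists>y\<in>V'. y \<noteq> a (s (j + K)) \<and> dist y (a (s (j + K))) < \<epsilon> \<and> (\<forall>f\<in>F'. f y = 0)"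
      by blast
    define i where "i = s (j + K)"
    note Kj = K[of "j + K", folded i_def]
    \<comment> \<open>A nearby solution \<open>y\<close> of the reduced system is lifted to
      \<open>y + t v\<close> by the persistent simple root \<open>t\<close>. Since
      \<open>p e y\<close> is nonzero, the pseudo-division identities yield first the Weierstrass
      equation and then every equation in \<open>Fs\<close>. The lift differs from
      \<open>x i\<close> because its projection to \<open>V'\<close> does.\<close>
    have "\<exists>y\<in>V. y \<noteq> x i \<and> dist y (x i) < \<epsilon> \<and> (\<forall>f\<in>Fs. f y = 0)" if \<epsilon>: "\<epsilon> > 0" for \<epsilon>
    proof -
      have "(a i, \<tau> i) \<in> N" unfolding i_def by (rule J[OF sJ])
      then obtain A B where AB: "open A" "open B" "a i \<in> A" "\<tau> i \<in> B" "A \<times> B \<subseteq> N"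
        using N(1) by (metis mem_Sigma_iff open_prod_elim)
      obtain \<kappa> where \<kappa>: "\<kappa> > 0" "\<And>t. \<bar>t - \<tau> i\<bar> < \<kappa> \<Longrightarrow> t \<in> B"
        using AB(2,4) unfolding open_dist by (auto simp: dist_real_def)
      define \<epsilon>1 where "\<epsilon>1 = min \<kappa> (\<epsilon> / (2 * (norm v + 1)))"
      have \<epsilon>1: "\<epsilon>1 > 0" using \<kappa> \<epsilon> by (auto simp: \<epsilon>1_def intro!: divide_pos_pos add_nonneg_pos)
      have "\<forall>\<^sub>F y in nhds (a i). \<exists>t. \<bar>t - \<tau> i\<bar> < \<epsilon>1 \<and> (\<Sum>l\<le>e. p l y * t ^ l) = 0"
        by (rule simple_root_persists) (use Kj p(3)[of "j + K"] \<epsilon>1 in \<open>auto simp: i_def\<close>)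
      moreover have "\<forall>\<^sub>F y in nhds (a i). p e y \<noteq> 0"
      proof -
        have "(p e \<longlongrightarrow> p e (a i)) (nhds (a i))"
          using Kj by (auto simp: isCont_def tendsto_at_iff_tendsto_nhds)
        then show ?thesis by (rule tendsto_imp_eventually_ne) (use p(2)[of "j + K"] in \<open>simp add: i_def\<close>)
      qed
      moreover have "\<forall>\<^sub>F y in nhds (a i). y \<in> A" using AB by (intro eventually_nhds_in_open) auto
      moreover have "\<forall>\<^sub>F y in nhds (a i). dist y (a i) < \<epsilon> / 2"
        unfolding eventually_nhds_metric using \<epsilon> by (intro exI[of _ "\<epsilon> / 2"]) auto
      ultimately have "\<forall>\<^sub>F y in nhds (a i). (\<exists>t. \<bar>t - \<tau> i\<bar> < \<epsilon>1 \<and> (\<Sum>l\<le>e. p l y * t ^ l) = 0) \<and>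
          p e y \<noteq> 0 \<and> y \<in> A \<and> dist y (a i) < \<epsilon> / 2"
        by eventually_elim blast
      then obtain \<eta> where \<eta>: "\<eta> > 0" "\<And>y. dist y (a i) < \<eta> \<Longrightarrow> (\<exists>t. \<bar>t - \<tau> i\<bar> < \<epsilon>1 \<and> (\<Sum>l\<le>e. p l y * t ^ l) = 0) \<and>
          p e y \<noteq> 0 \<and> y \<in> A \<and> dist y (a i) < \<epsilon> / 2"
        unfolding eventually_nhds_metric by blast
      obtain y where y: "y \<in> V'" "y \<noteq> a i" "dist y (a i) < \<eta>" "\<And>f. f \<in> F' \<Longrightarrow> f y = 0"
        using j[OF \<eta>(1)] unfolding i_def by blast
      obtain t where t: "\<bar>t - \<tau> i\<bar> < \<epsilon>1" "(\<Sum>l\<le>e. p l y * t ^ l) = 0"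
        using \<eta>(2)[OF y(3)] by blast
      have pe: "p e y \<noteq> 0" and yA: "y \<in> A" and yd: "dist y (a i) < \<epsilon> / 2" using \<eta>(2)[OF y(3)] by auto
      have ytN: "(y, t) \<in> N" using AB(5) yA \<kappa>(2)[of t] t(1) by (auto simp: \<epsilon>1_def)
      have "(\<Sum>l<e. R0 l y * t ^ l) = 0" using y(4) by (intro sum.neutral) (auto simp: F'_def)
      then have "(\<Sum>l<Suc d. w' l y * t ^ l) = 0" using R0eq[of y t] t(2) pe by simp
      then have Wy: "t ^ d = (\<Sum>l<d. w l y * t ^ l)" unfolding w'sum by simp
      have fy: "f (y + t *\<^sub>R v) = 0" if f: "f \<in> Fs" for f
      proof -
        obtain m S where mS: "\<And>y t. p e y ^ m * (\<Sum>l<d. r f l y * t ^ l) =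
             S y t * (\<Sum>l\<le>e. p l y * t ^ l) + (\<Sum>l<e. R f l y * t ^ l)"
          using Req[OF f] by blast
        have "(\<Sum>l<e. R f l y * t ^ l) = 0" using y(4) f by (intro sum.neutral) (auto simp: F'_def)
        then have "(\<Sum>l<d. r f l y * t ^ l) = 0" using mS[of y t] t(2) pe by simp
        then show ?thesis using Nf[OF ytN f Wy] by simp
      qed
      have "y + t *\<^sub>R v \<in> V" using y(1) v(1) V by (auto simp: V'_def intro: subspace_add subspace_scale)
      moreover have "y + t *\<^sub>R v \<noteq> x i"
      proof
        assume eq: "y + t *\<^sub>R v = x i"
        have "(y + t *\<^sub>R v) \<bullet> v = (a i + \<tau> i *\<^sub>R v) \<bullet> v" using eq xa[of i] by simp
        then have "t = \<tau> i" using y(1) aV'[of i] vnz by (simp add: V'_def inner_add_left)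
        then show False using eq xa[of i] y(2) by simp
      qed
      moreover have "dist (y + t *\<^sub>R v) (x i) < \<epsilon>"
      proof -
        have "y + t *\<^sub>R v - x i = (y - a i) + (t - \<tau> i) *\<^sub>R v" using xa[of i] by (simp add: algebra_simps)
        then have "dist (y + t *\<^sub>R v) (x i) \<le> dist y (a i) + \<bar>t - \<tau> i\<bar> * norm v"
          unfolding dist_norm by (metis norm_scaleR norm_triangle_ineq)
        moreover have "\<bar>t - \<tau> i\<bar> * norm v \<le> \<epsilon> / 2"
        proof -
          have "\<bar>t - \<tau> i\<bar> * norm v \<le> \<epsilon> / (2 * (norm v + 1)) * (norm v + 1)"
            using t(1) \<epsilon> by (intro mult_mono) (auto simp: \<epsilon>1_def)
          also have "\<dots> = \<epsilon> / 2"
          proof -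
            have "norm v + 1 \<noteq> 0" using norm_ge_zero[of v] by linarith
            then show ?thesis by (simp add: nonzero_eq_divide_eq divide_eq_eq)
          qed
          finally show ?thesis .
        qed
        ultimately show ?thesis using yd by linarith
      qed
      ultimately show ?thesis using fy by blast
    qed
    then show ?thesis by blast
  qed
qed

section \<open>Calculus of iterated partial derivatives\<close>

abbreviation line_diff :: "'n::finite \<Rightarrow> (real^'n \<Rightarrow> real) \<Rightarrow> real^'n \<Rightarrow> bool" where
  "line_diff i f x \<equiv> (\<lambda>t. f (x + t *\<^sub>R axis i 1)) differentiable (at 0)"

lemma line_diff_DERIV:
  "line_diff i f x \<Longrightarrow> ((\<lambda>t. f (x + t *\<^sub>R axis i 1)) has_real_derivative partial i f x) (at 0)"
  unfolding partial_def by (simp add: DERIV_deriv_iff_real_differentiable)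

lemma DERIV_line_diff:
  assumes "((\<lambda>t. f (x + t *\<^sub>R axis i 1)) has_real_derivative D) (at 0)"
  shows "line_diff i f x" "partial i f x = D"
  using assms unfolding partial_def by (auto simp: real_differentiable_def DERIV_imp_deriv)

lemma eventually_line_in_open:
  fixes x v :: "'a::real_normed_vector"
  assumes "open U" "x \<in> U" shows "\<forall>\<^sub>F t in nhds 0. x + t *\<^sub>R v \<in> U"
proof -
  have "((\<lambda>t. x + t *\<^sub>R v) \<longlongrightarrow> x + 0 *\<^sub>R v) (nhds 0)"
    by (intro tendsto_intros filterlim_ident)
  then show ?thesis using assms by (intro topological_tendstoD) auto
qed

lemma line_DERIV_cong:
  fixes x v :: "'a::real_normed_vector"
  assumes "open U" "x \<in> U" "\<And>y. y \<in> U \<Longrightarrow> f y = g y"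
  shows "((\<lambda>t. f (x + t *\<^sub>R v)) has_real_derivative D) (at 0) \<longleftrightarrow>
         ((\<lambda>t. g (x + t *\<^sub>R v)) has_real_derivative D) (at 0)"
  by (rule DERIV_cong_ev) (use eventually_line_in_open[OF assms(1,2), of v] assms(3) in \<open>auto elim!: eventually_mono\<close>)

lemma line_diff_cong:
  assumes "open U" "x \<in> U" "\<And>y. y \<in> U \<Longrightarrow> f y = g y"
  shows "line_diff i f x \<longleftrightarrow> line_diff i g x"
  unfolding real_differentiable_def using line_DERIV_cong[OF assms(1,2), of f g "axis i 1"] assms(3) by simp

lemma partial_cong:
  assumes "open U" "x \<in> U" "\<And>y. y \<in> U \<Longrightarrow> f y = g y"
  shows "partial i f x = partial i g x"
  unfolding partial_def
  by (rule deriv_cong_ev) (use eventually_line_in_open[OF assms(1,2), of "axis i 1"] assms(3) in \<open>auto elim!: eventually_mono\<close>)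

lemma pd_cong:
  assumes "open U" "x \<in> U" "\<And>y. y \<in> U \<Longrightarrow> f y = g y"
  shows "pd ds f x = pd ds g x"
  using assms(2)
proof (induction ds arbitrary: x)
  case (Cons i ds)
  show ?case by simp (rule partial_cong[OF assms(1) Cons.prems Cons.IH])
qed (use assms in auto)

text \<open>\<open>pd\<close> applies the last list entry first. Peeling lists from the end thus
  replaces \<open>f\<close> by a partial derivative of \<open>f\<close>, which gives
  \<open>Ck_on\<close> the recursion \<open>Ck_on_Suc\<close> on which the closure properties
  rest.\<close>

lemma pd_append1: "pd (ds @ [i]) f = pd ds (partial i f)"
  by (induction ds) auto

lemma Ck_on_0: "Ck_on 0 U f \<longleftrightarrow> continuous_on U f"
  by (simp add: Ck_on_def)

lemma Ck_on_Suc: "Ck_on (Suc k) U f \<longleftrightarrow>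
    continuous_on U f \<and> (\<forall>i. \<forall>x\<in>U. line_diff i f x) \<and> (\<forall>i. Ck_on k U (partial i f))"
proof
  assume a: "Ck_on (Suc k) U f"
  have "continuous_on U f" using a unfolding Ck_on_def by (metis le0 list.size(3) pd.simps(1))
  moreover have "\<forall>i. \<forall>x\<in>U. line_diff i f x"
    using a unfolding Ck_on_def by (metis list.size(3) pd.simps(1) zero_less_Suc)
  moreover have "Ck_on k U (partial i f)" for i
    unfolding Ck_on_def pd_append1[symmetric] using a unfolding Ck_on_def by auto
  ultimately show "continuous_on U f \<and> (\<forall>i. \<forall>x\<in>U. line_diff i f x) \<and> (\<forall>i. Ck_on k U (partial i f))"
    by blast
next
  assume a: "continuous_on U f \<and> (\<forall>i. \<forall>x\<in>U. line_diff i f x) \<and> (\<forall>i. Ck_on k U (partial i f))"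
  have "continuous_on U (pd ds f)" if "length ds \<le> Suc k" for ds
    using a that by (cases ds rule: rev_cases) (auto simp: pd_append1 Ck_on_def)
  moreover have "line_diff j (pd ds f) x" if "length ds < Suc k" "x \<in> U" for ds j x
    using a that by (cases ds rule: rev_cases) (auto simp: pd_append1 Ck_on_def)
  ultimately show "Ck_on (Suc k) U f" unfolding Ck_on_def by blast
qed

lemma Ck_on_cong:
  assumes "open U" "\<And>y. y \<in> U \<Longrightarrow> f y = g y"
  shows "Ck_on k U f \<longleftrightarrow> Ck_on k U g"
proof -
  have "pd ds f x = pd ds g x" if "x \<in> U" for ds x
    using pd_cong[OF assms(1) that assms(2)] .
  then show ?thesis
    unfolding Ck_on_def
    using line_diff_cong[OF assms(1), of _ "pd _ f" "pd _ g"] by (auto cong: continuous_on_cong)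
qed

lemma Ck_on_subset: "Ck_on k U f \<Longrightarrow> V \<subseteq> U \<Longrightarrow> Ck_on k V f"
  unfolding Ck_on_def by (meson continuous_on_subset subsetD)

lemma Ck_on_le: "Ck_on k U f \<Longrightarrow> l \<le> k \<Longrightarrow> Ck_on l U f"
  unfolding Ck_on_def by auto

lemma Ck_on_continuous: "Ck_on k U f \<Longrightarrow> continuous_on U f"
  using Ck_on_le[of k U f 0] by (simp add: Ck_on_0)

lemma Ck_on_pd_continuous: "Ck_on k U f \<Longrightarrow> length ds \<le> k \<Longrightarrow> continuous_on U (pd ds f)"
  by (simp add: Ck_on_def)

lemma Ck_on_SucI:
  assumes U: "open U" and f: "continuous_on U f"
    and der: "\<And>i x. x \<in> U \<Longrightarrow> ((\<lambda>t. f (x + t *\<^sub>R axis i 1)) has_real_derivative f' i x) (at 0)"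
    and f': "\<And>i. Ck_on k U (f' i)"
  shows "Ck_on (Suc k) U f"
proof -
  have "Ck_on k U (partial i f)" for i
    using Ck_on_cong[OF U, of "partial i f" "f' i"] DERIV_line_diff(2)[OF der] f' by blast
  then show ?thesis unfolding Ck_on_Suc using f DERIV_line_diff(1)[OF der] by blast
qed

lemma Ck_on_SucD:
  assumes "Ck_on (Suc k) U f"
  shows "Ck_on k U f" "Ck_on k U (partial i f)" "continuous_on U f"
    "x \<in> U \<Longrightarrow> ((\<lambda>t. f (x + t *\<^sub>R axis i 1)) has_real_derivative partial i f x) (at 0)"
proof -
  show "Ck_on k U f" using assms Ck_on_le[of "Suc k" U f k] by simp
  show "Ck_on k U (partial i f)" "continuous_on U f" using assms by (auto simp: Ck_on_Suc)
  assume "x \<in> U"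
  then have "line_diff i f x" using assms by (auto simp: Ck_on_Suc)
  then show "((\<lambda>t. f (x + t *\<^sub>R axis i 1)) has_real_derivative partial i f x) (at 0)"
    by (rule line_diff_DERIV)
qed

lemma Ck_on_const: "open U \<Longrightarrow> Ck_on k U (\<lambda>x. c)"
proof (induction k arbitrary: c)
  case (Suc k)
  show ?case by (rule Ck_on_SucI[where f' = "\<lambda>_ _. 0"]) (use Suc in auto)
qed (simp add: Ck_on_0)

lemma Ck_on_add:
  assumes U: "open U" and "Ck_on k U f" "Ck_on k U g"
  shows "Ck_on k U (\<lambda>x. f x + g x)"
  using assms(2,3)
proof (induction k arbitrary: f g)
  case (Suc k)
  show ?case
  proof (rule Ck_on_SucI[OF U, where f' = "\<lambda>i x. partial i f x + partial i g x"])
    show "((\<lambda>t. f (x + t *\<^sub>R axis i 1) + g (x + t *\<^sub>R axis i 1)) has_real_derivative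
        partial i f x + partial i g x) (at 0)" if "x \<in> U" for i x
      by (intro DERIV_add Ck_on_SucD(4)[OF Suc.prems(1) that] Ck_on_SucD(4)[OF Suc.prems(2) that])
    show "Ck_on k U (\<lambda>x. partial i f x + partial i g x)" for i
      by (intro Suc.IH Ck_on_SucD[OF Suc.prems(1)] Ck_on_SucD[OF Suc.prems(2)])
  qed (use Suc.prems Ck_on_SucD in \<open>auto intro!: continuous_intros\<close>)
qed (auto simp: Ck_on_0 intro!: continuous_intros)

lemma Ck_on_mult:
  assumes U: "open U" and "Ck_on k U f" "Ck_on k U g"
  shows "Ck_on k U (\<lambda>x. f x * g x)"
  using assms(2,3)
proof (induction k arbitrary: f g)
  case (Suc k)
  show ?case
  proof (rule Ck_on_SucI[OF U, where f' = "\<lambda>i x. f x * partial i g x + partial i f x * g x"])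
    show "((\<lambda>t. f (x + t *\<^sub>R axis i 1) * g (x + t *\<^sub>R axis i 1)) has_real_derivative
        f x * partial i g x + partial i f x * g x) (at 0)" if x: "x \<in> U" for i x
      using DERIV_mult'[OF Ck_on_SucD(4)[OF Suc.prems(1) x] Ck_on_SucD(4)[OF Suc.prems(2) x]] by simp
    show "Ck_on k U (\<lambda>x. f x * partial i g x + partial i f x * g x)" for i
      by (intro Ck_on_add U Suc.IH Ck_on_SucD[OF Suc.prems(1)] Ck_on_SucD[OF Suc.prems(2)])
  qed (use Suc.prems Ck_on_SucD in \<open>auto intro!: continuous_intros\<close>)
qed (auto simp: Ck_on_0 intro!: continuous_intros)

lemma Ck_on_cmult: "open U \<Longrightarrow> Ck_on k U f \<Longrightarrow> Ck_on k U (\<lambda>x. c * f x)"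
  by (intro Ck_on_mult Ck_on_const)

lemma Ck_on_diff:
  assumes "open U" "Ck_on k U f" "Ck_on k U g" shows "Ck_on k U (\<lambda>x. f x - g x)"
  using Ck_on_add[OF assms(1,2) Ck_on_cmult[OF assms(1,3), of "- 1"]] by simp

lemma Ck_on_sum:
  "open U \<Longrightarrow> (\<And>i. i \<in> I \<Longrightarrow> Ck_on k U (f i)) \<Longrightarrow> Ck_on k U (\<lambda>x. \<Sum>i\<in>I. f i x)"
  by (induction I rule: infinite_finite_induct) (auto intro: Ck_on_const Ck_on_add)

lemma Ck_on_prod:
  "open U \<Longrightarrow> (\<And>i. i \<in> I \<Longrightarrow> Ck_on k U (f i)) \<Longrightarrow> Ck_on k U (\<lambda>x. \<Prod>i\<in>I. f i x)"
  by (induction I rule: infinite_finite_induct) (auto intro: Ck_on_const Ck_on_mult)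

text \<open>The outer function comes with its whole tower of derivatives, so that the induction on
  \<open>k\<close> can pass from \<open>B m\<close> to \<open>B (Suc m)\<close>.\<close>

lemma Ck_on_compose_real:
  fixes B :: "nat \<Rightarrow> real \<Rightarrow> real"
  assumes U: "open U" and B: "\<And>m t. (B m has_real_derivative B (Suc m) t) (at t)" and l: "Ck_on k U l"
  shows "Ck_on k U (\<lambda>x. B m (l x))"
  using l
proof (induction k arbitrary: m)
  case 0
  have "continuous_on UNIV (B m)" using B DERIV_continuous_on by blast
  then show ?case using 0 by (auto simp: Ck_on_0 intro: continuous_on_compose2)
next
  case (Suc k)
  have "continuous_on UNIV (B m)" using B DERIV_continuous_on by blast
  then have c: "continuous_on U (\<lambda>x. B m (l x))"
    using Ck_on_SucD(3)[OF Suc.prems] by (auto intro: continuous_on_compose2)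
  show ?case
  proof (rule Ck_on_SucI[OF U c, where f' = "\<lambda>i x. B (Suc m) (l x) * partial i l x"])
    show "((\<lambda>t. B m (l (x + t *\<^sub>R axis i 1))) has_real_derivative B (Suc m) (l x) * partial i l x) (at 0)"
      if "x \<in> U" for i x
      using DERIV_chain2[OF _ Ck_on_SucD(4)[OF Suc.prems that, of i], of "B m" "B (Suc m) (l x)"] B[of m "l x"] by simp
    show "Ck_on k U (\<lambda>x. B (Suc m) (l x) * partial i l x)" for i
      by (intro Ck_on_mult U Suc.IH Ck_on_SucD[OF Suc.prems])
  qed
qed

lemma line_DERIV_inverse:
  fixes x v :: "'a::real_normed_vector"
  assumes "((\<lambda>t. f (x + t *\<^sub>R v)) has_real_derivative D) (at 0)" "f x \<noteq> 0"
  shows "((\<lambda>t. inverse (f (x + t *\<^sub>R v))) has_real_derivative (- 1) * D * (inverse (f x) * inverse (f x))) (at 0)"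
  using DERIV_inverse'[OF assms(1)] assms(2) by (simp add: algebra_simps)

lemma Ck_on_inverse:
  assumes U: "open U" and "Ck_on k U f" and nz: "\<And>x. x \<in> U \<Longrightarrow> f x \<noteq> 0"
  shows "Ck_on k U (\<lambda>x. inverse (f x))"
  using assms(2)
proof (induction k)
  case (Suc k)
  show ?case
  proof (rule Ck_on_SucI[OF U, where f' = "\<lambda>i x. (- 1) * partial i f x * (inverse (f x) * inverse (f x))"])
    show "Ck_on k U (\<lambda>x. (- 1) * partial i f x * (inverse (f x) * inverse (f x)))" for i
      by (intro Ck_on_mult Ck_on_const U Suc.IH Ck_on_SucD[OF Suc.prems])
    show "((\<lambda>t. inverse (f (x + t *\<^sub>R axis i 1))) has_real_derivative (- 1) * partial i f x * (inverse (f x) * inverse (f x))) (at 0)"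
      if "x \<in> U" for i x
      by (rule line_DERIV_inverse[OF Ck_on_SucD(4)[OF Suc.prems that] nz[OF that]])
  qed (use Suc.prems Ck_on_SucD nz in \<open>auto intro!: continuous_intros\<close>)
qed (use nz in \<open>auto simp: Ck_on_0 intro!: continuous_intros\<close>)

lemma line_DERIV_component:
  "((\<lambda>t. (x + t *\<^sub>R axis i (1::real)) $ j) has_real_derivative (if i = j then 1 else 0)) (at 0)"
  by (auto simp: axis_def intro!: derivative_eq_intros)

lemma Ck_on_component: "open U \<Longrightarrow> Ck_on k U (\<lambda>x. x $ j)"
proof (cases k)
  case (Suc l)
  assume U: "open U"
  show ?thesis unfolding Suc
    by (rule Ck_on_SucI[OF U, where f' = "\<lambda>i x. if i = j then 1 else 0"])
      (rule line_DERIV_component continuous_intros Ck_on_const[OF U])+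
qed (auto simp: Ck_on_0 intro!: continuous_intros)

lemma pd_add:
  assumes U: "open U" and x: "x \<in> U" and "Ck_on (length ds) U f" "Ck_on (length ds) U g"
  shows "pd ds (\<lambda>y. f y + g y) x = pd ds f x + pd ds g x"
  using assms(3,4)
proof (induction ds arbitrary: f g rule: rev_induct)
  case (snoc i ds)
  have f: "Ck_on (Suc (length ds)) U f" and g: "Ck_on (Suc (length ds)) U g" using snoc.prems by auto
  have "partial i (\<lambda>y. f y + g y) y = partial i f y + partial i g y" if "y \<in> U" for y
    by (rule DERIV_line_diff(2)) (intro DERIV_add Ck_on_SucD(4)[OF f that] Ck_on_SucD(4)[OF g that])
  then have "pd ds (partial i (\<lambda>y. f y + g y)) x = pd ds (\<lambda>y. partial i f y + partial i g y) x"
    by (rule pd_cong[OF U x])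
  also have "\<dots> = pd ds (partial i f) x + pd ds (partial i g) x"
    using snoc.IH[OF Ck_on_SucD(2)[OF f] Ck_on_SucD(2)[OF g]] .
  finally show ?case by (simp add: pd_append1)
qed simp

lemma pd_cmult:
  assumes U: "open U" and x: "x \<in> U" and "Ck_on (length ds) U f"
  shows "pd ds (\<lambda>y. c * f y) x = c * pd ds f x"
  using assms(3)
proof (induction ds arbitrary: f rule: rev_induct)
  case (snoc i ds)
  have f: "Ck_on (Suc (length ds)) U f" using snoc.prems by auto
  have "partial i (\<lambda>y. c * f y) y = c * partial i f y" if "y \<in> U" for y
    by (rule DERIV_line_diff(2)) (intro DERIV_cmult Ck_on_SucD(4)[OF f that])
  then have "pd ds (partial i (\<lambda>y. c * f y)) x = pd ds (\<lambda>y. c * partial i f y) x"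
    by (rule pd_cong[OF U x])
  also have "\<dots> = c * pd ds (partial i f) x"
    using snoc.IH[OF Ck_on_SucD(2)[OF f]] .
  finally show ?case by (simp add: pd_append1)
qed simp

lemma pd_diff:
  assumes U: "open U" and x: "x \<in> U" and "Ck_on (length ds) U f" "Ck_on (length ds) U g"
  shows "pd ds (\<lambda>y. f y - g y) x = pd ds f x - pd ds g x"
  using pd_add[OF U x assms(3) Ck_on_cmult[OF U assms(4), of "- 1"]] pd_cmult[OF U x assms(4), of "- 1"] by simp

lemma pd_const_0: "pd ds (\<lambda>y::real^'n::finite. 0) x = 0"
proof (induction ds arbitrary: x)
  case (Cons i ds)
  have "pd ds (\<lambda>y::real^'n. 0) = (\<lambda>_. 0)" using Cons by auto
  then show ?case by (simp add: partial_def)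
qed simp

lemma pd_eq_0:
  assumes "open U" "x \<in> U" "\<And>y. y \<in> U \<Longrightarrow> f y = 0" shows "pd ds f x = 0"
  using pd_cong[OF assms(1,2), of f "\<lambda>_. 0"] assms(3) by (simp add: pd_const_0)

lemma pd_sum:
  assumes U: "open U" and x: "x \<in> U" and "\<And>i. i \<in> I \<Longrightarrow> Ck_on (length ds) U (f i)"
  shows "pd ds (\<lambda>y. \<Sum>i\<in>I. f i y) x = (\<Sum>i\<in>I. pd ds (f i) x)"
  using assms(3)
  by (induction I rule: infinite_finite_induct) (auto simp: pd_const_0 pd_add[OF U x] Ck_on_sum[OF U])

section \<open>Rescaling, and extension by zero across a closed set\<close>

lemma line_DERIV_affine:
  fixes x v a :: "'a::real_normed_vector"
  assumes "((\<lambda>t. g ((1 / \<delta>) *\<^sub>R (x - a) + t *\<^sub>R v)) has_real_derivative D) (at 0)" 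
  shows "((\<lambda>t. g ((1 / \<delta>) *\<^sub>R (x + t *\<^sub>R v - a))) has_real_derivative (1 / \<delta>) * D) (at 0)"
proof -
  have d: "((\<lambda>t. (1 / \<delta>) * t) has_real_derivative (1 / \<delta>)) (at 0)"
    using DERIV_cmult_Id by blast
  have "((\<lambda>t. g ((1 / \<delta>) *\<^sub>R (x - a) + t *\<^sub>R v)) has_real_derivative D) (at ((1 / \<delta>) * 0))"
    using assms by simp
  from DERIV_chain2[OF this d]
  have "((\<lambda>t. g ((1 / \<delta>) *\<^sub>R (x - a) + ((1 / \<delta>) * t) *\<^sub>R v)) has_real_derivative D * (1 / \<delta>)) (at 0)" .
  then show ?thesis by (simp add: algebra_simps)
qed

lemma Ck_on_affine:
  assumes "Ck_on k UNIV g"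
  shows "Ck_on k UNIV (\<lambda>x. g ((1 / \<delta>) *\<^sub>R (x - a)))"
  using assms
proof (induction k arbitrary: g)
  case 0
  then show ?case by (auto simp: Ck_on_0 intro!: continuous_on_compose2[of UNIV g] continuous_intros)
next
  case (Suc k)
  have c: "continuous_on UNIV (\<lambda>x. g ((1 / \<delta>) *\<^sub>R (x - a)))"
    using Ck_on_SucD(3)[OF Suc.prems] by (auto intro!: continuous_on_compose2[of UNIV g] continuous_intros)
  show ?case
    by (rule Ck_on_SucI[OF open_UNIV c, where f' = "\<lambda>i x. (1 / \<delta>) * partial i g ((1 / \<delta>) *\<^sub>R (x - a))"])
      (intro line_DERIV_affine Ck_on_SucD(4)[OF Suc.prems] UNIV_I Ck_on_cmult open_UNIV Suc.IH Ck_on_SucD(2)[OF Suc.prems])+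
qed

lemma pd_affine:
  assumes "Ck_on (length ds) UNIV g"
  shows "pd ds (\<lambda>x. g ((1 / \<delta>) *\<^sub>R (x - a))) x = (1 / \<delta>) ^ length ds * pd ds g ((1 / \<delta>) *\<^sub>R (x - a))"
  using assms
proof (induction ds arbitrary: g rule: rev_induct)
  case (snoc i ds)
  have g: "Ck_on (Suc (length ds)) UNIV g" using snoc.prems by simp
  have "partial i (\<lambda>x. g ((1 / \<delta>) *\<^sub>R (x - a))) y = (1 / \<delta>) * partial i g ((1 / \<delta>) *\<^sub>R (y - a))" for y
    by (rule DERIV_line_diff(2)) (intro line_DERIV_affine Ck_on_SucD(4)[OF g] UNIV_I)
  then have "pd ds (partial i (\<lambda>x. g ((1 / \<delta>) *\<^sub>R (x - a)))) x = pd ds (\<lambda>y. (1 / \<delta>) * partial i g ((1 / \<delta>) *\<^sub>R (y - a))) x"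
    by (intro pd_cong[OF open_UNIV]) auto
  also have "\<dots> = (1 / \<delta>) * pd ds (\<lambda>y. partial i g ((1 / \<delta>) *\<^sub>R (y - a))) x"
    by (rule pd_cmult[OF open_UNIV UNIV_I Ck_on_affine[OF Ck_on_SucD(2)[OF g]]])
  also have "pd ds (\<lambda>y. partial i g ((1 / \<delta>) *\<^sub>R (y - a))) x = (1 / \<delta>) ^ length ds * pd ds (partial i g) ((1 / \<delta>) *\<^sub>R (x - a))"
    by (rule snoc.IH[OF Ck_on_SucD(2)[OF g]])
  finally show ?case by (simp add: pd_append1)
qed simp

text \<open>Decay like the square of the distance makes the difference quotients at points of
  \<open>Z\<close> tend to 0, so by induction on the order every derivative exists there and
  vanishes. It serves twice: with \<open>Z = {0}\<close> for infinite sums of bumps, and with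
  \<open>Z = \<Sigma>\<close> for quotients.\<close>

lemma glue_zero:
  assumes U: "open U" and Z: "closed Z" and h0: "\<And>x. x \<in> Z \<Longrightarrow> h x = 0" and hk: "Ck_on r (U - Z) h"
    and bound: "\<And>ds. length ds \<le> r \<Longrightarrow> \<exists>C. \<forall>x\<in>U - Z. \<bar>pd ds h x\<bar> \<le> C * (infdist x Z)\<^sup>2"
  shows "Ck_on r U h \<and> (\<forall>x\<in>Z \<inter> U. \<forall>ds. length ds \<le> r \<longrightarrow> pd ds h x = 0)"
proof -
  have op: "open (U - Z)" using U Z by (rule open_Diff)
  have near: "\<bar>pd ds h y\<bar> \<le> C * (dist y x)\<^sup>2"
    if C: "\<forall>x\<in>U - Z. \<bar>pd ds h x\<bar> \<le> C * (infdist x Z)\<^sup>2" "C \<ge> 0"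
      and zero: "\<forall>x\<in>Z \<inter> U. pd ds h x = 0" and "x \<in> Z" "y \<in> U" for ds C x y
  proof (cases "y \<in> Z")
    case False
    have "infdist y Z \<le> dist y x" using \<open>x \<in> Z\<close> by (rule infdist_le)
    then have "C * (infdist y Z)\<^sup>2 \<le> C * (dist y x)\<^sup>2"
      using C(2) by (intro mult_left_mono power_mono infdist_nonneg)
    then show ?thesis using C(1) False \<open>y \<in> U\<close> by force
  qed (use zero C \<open>y \<in> U\<close> in auto)
  have bound': "\<exists>C\<ge>0. \<forall>x\<in>U - Z. \<bar>pd ds h x\<bar> \<le> C * (infdist x Z)\<^sup>2" if len: "length ds \<le> r" for ds
  proof -
    obtain C where C: "\<forall>x\<in>U - Z. \<bar>pd ds h x\<bar> \<le> C * (infdist x Z)\<^sup>2" using bound[OF len] by blast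
    have "\<forall>x\<in>U - Z. \<bar>pd ds h x\<bar> \<le> \<bar>C\<bar> * (infdist x Z)\<^sup>2"
    proof
      fix x assume "x \<in> U - Z"
      then have "\<bar>pd ds h x\<bar> \<le> C * (infdist x Z)\<^sup>2" using C by blast
      also have "\<dots> \<le> \<bar>C\<bar> * (infdist x Z)\<^sup>2" by (intro mult_right_mono) auto
      finally show "\<bar>pd ds h x\<bar> \<le> \<bar>C\<bar> * (infdist x Z)\<^sup>2" .
    qed
    then show ?thesis by (intro exI[of _ "\<bar>C\<bar>"]) auto
  qed
  have der0: "((\<lambda>t. pd ds h (x + t *\<^sub>R axis i 1)) has_real_derivative 0) (at 0)"
    if len: "length ds \<le> r" and zero: "\<forall>x\<in>Z \<inter> U. pd ds h x = 0" and x: "x \<in> Z \<inter> U" for ds i x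
  proof -
    obtain C where C: "\<forall>x\<in>U - Z. \<bar>pd ds h x\<bar> \<le> C * (infdist x Z)\<^sup>2" "C \<ge> 0"
      using bound'[OF len] by blast
    have "\<forall>\<^sub>F t in nhds 0. x + t *\<^sub>R axis i 1 \<in> U"
      by (rule eventually_line_in_open[OF U]) (use x in auto)
    then have ev: "\<forall>\<^sub>F t in at 0. x + t *\<^sub>R axis i 1 \<in> U" by (auto simp: eventually_at_filter elim: eventually_mono)
    have "((\<lambda>t. (pd ds h (x + t *\<^sub>R axis i 1) - pd ds h (x + 0 *\<^sub>R axis i 1)) / (t - 0)) \<longlongrightarrow> 0) (at 0)"
    proof (rule Lim_null_comparison)
      show "\<forall>\<^sub>F t in at 0. norm ((pd ds h (x + t *\<^sub>R axis i 1) - pd ds h (x + 0 *\<^sub>R axis i 1)) / (t - 0)) \<le> C * \<bar>t\<bar>"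
        using ev eventually_neq_at_within[of 0 0 UNIV]
      proof eventually_elim
        case (elim t)
        have "\<bar>pd ds h (x + t *\<^sub>R axis i 1)\<bar> \<le> C * (dist (x + t *\<^sub>R axis i 1) x)\<^sup>2"
          by (rule near[OF C zero]) (use x elim in auto)
        also have "\<dots> = C * \<bar>t\<bar> * \<bar>t\<bar>" by (simp add: dist_norm power2_eq_square)
        finally show ?case using elim zero x by (simp add: abs_divide divide_le_eq)
      qed
      have "((\<lambda>t. C * \<bar>t\<bar>) \<longlongrightarrow> C * \<bar>0\<bar>) (at 0)" by (intro tendsto_intros)
      then show "((\<lambda>t. C * \<bar>t\<bar>) \<longlongrightarrow> 0) (at 0)" by simp
    qed
    then show ?thesis by (simp add: has_field_derivative_iff)
  qed
  have zero: "\<forall>x\<in>Z \<inter> U. pd ds h x = 0" if "length ds \<le> r" for ds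
    using that
  proof (induction ds)
    case (Cons i ds)
    then have "length ds \<le> r" "\<forall>x\<in>Z \<inter> U. pd ds h x = 0" by auto
    then show ?case using DERIV_line_diff(2)[OF der0] by simp
  qed (use h0 in auto)
  have "continuous_on U (pd ds h)" if len: "length ds \<le> r" for ds
  proof -
    obtain C where C: "\<forall>x\<in>U - Z. \<bar>pd ds h x\<bar> \<le> C * (infdist x Z)\<^sup>2" "C \<ge> 0"
      using bound'[OF len] by blast
    have "isCont (pd ds h) x" if xU: "x \<in> U" for x
    proof (cases "x \<in> Z")
      case False
      then show ?thesis
        using Ck_on_pd_continuous[OF hk len] op xU continuous_on_eq_continuous_at by blast
    next
      case True
      have ev: "\<forall>\<^sub>F y in at x. y \<in> U"
        using eventually_nhds_in_open[OF U xU] by (auto simp: eventually_at_filter elim: eventually_mono)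
      have "((pd ds h) \<longlongrightarrow> 0) (at x)"
      proof (rule Lim_null_comparison)
        show "\<forall>\<^sub>F y in at x. norm (pd ds h y) \<le> C * (dist y x)\<^sup>2"
          using ev by eventually_elim (use near[OF C zero[OF len] True] in auto)
        have "((\<lambda>y. C * (dist y x)\<^sup>2) \<longlongrightarrow> C * (dist x x)\<^sup>2) (at x)" by (intro tendsto_intros)
        then show "((\<lambda>y. C * (dist y x)\<^sup>2) \<longlongrightarrow> 0) (at x)" by simp
      qed
      then show ?thesis using zero[OF len] True xU by (simp add: isCont_def)
    qed
    then show ?thesis by (simp add: continuous_at_imp_continuous_on)
  qed
  moreover have "line_diff i (pd ds h) x" if len: "length ds < r" and x: "x \<in> U" for ds i x
  proof (cases "x \<in> Z")
    case True
    then show ?thesis using DERIV_line_diff(1)[OF der0 [OF _ zero]] len x by auto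
  next
    case False
    then show ?thesis using hk len x by (auto simp: Ck_on_def)
  qed
  ultimately show ?thesis using zero by (auto simp: Ck_on_def)
qed

section \<open>From convergent real power series to holomorphic and smooth germs\<close>

lemma real_analytic_germ_imp_cx_analytic:
  fixes f :: "real^'n::finite \<Rightarrow> real"
  assumes "real_analytic_germ f" shows "cx_analytic f"
proof -
  obtain r and c :: "('n \<Rightarrow> nat) \<Rightarrow> real" where r: "r > 0" and
    sums: "\<And>x. x \<in> ball 0 r \<Longrightarrow> ((\<lambda>\<alpha>. c \<alpha> * (\<Prod>i\<in>UNIV. (x $ i) ^ \<alpha> i)) has_sum f x) UNIV"
    using assms unfolding real_analytic_germ_def by blast
  define \<rho> where "\<rho> = r / (2 * real CARD('n))"
  have \<rho>: "\<rho> > 0" using r by (simp add: \<rho>_def)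
  \<comment> \<open>The point with all coordinates \<open>\<rho>\<close> has norm at most
    \<open>r / 2\<close>, so the series converges absolutely there; its terms dominate the complex
    series on the ball of radius \<open>\<rho>\<close>.\<close>
  define x0 :: "real^'n" where "x0 = (\<chi> i. \<rho>)"
  have "norm x0 \<le> (\<Sum>i\<in>UNIV. \<bar>x0 $ i\<bar>)" by (rule norm_le_l1_cart)
  also have "\<dots> = r / 2" using \<rho> by (simp add: x0_def) (simp add: \<rho>_def)
  finally have x0: "x0 \<in> ball 0 r" using r by simp
  have "x0 $ i = \<rho>" for i by (simp add: x0_def)
  then have "((\<lambda>\<alpha>. c \<alpha> * (\<Prod>i\<in>UNIV. \<rho> ^ \<alpha> i)) has_sum f x0) UNIV"
    using sums[OF x0] by simp
  then have "(\<lambda>\<alpha>. c \<alpha> * (\<Prod>i\<in>UNIV. \<rho> ^ \<alpha> i)) summable_on UNIV"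
    by (rule has_sum_imp_summable)
  then have M: "(\<lambda>\<alpha>. norm (c \<alpha> * (\<Prod>i\<in>UNIV. \<rho> ^ \<alpha> i))) summable_on UNIV"
    by (rule summable_on_iff_abs_summable_on_real[THEN iffD1])
  define T where "T \<alpha> z = of_real (c \<alpha>) * (\<Prod>i\<in>UNIV. (z $ i) ^ \<alpha> i)" for \<alpha> and z :: "complex^'n"
  define F where "F z = (\<Sum>\<^sub>\<infinity>\<alpha>. T \<alpha> z)" for z
  have ul: "uniform_limit (ball 0 \<rho>) (\<lambda>A z. \<Sum>\<alpha>\<in>A. T \<alpha> z) F (finite_subsets_at_top UNIV)"
    unfolding F_def
  proof (rule Weierstrass_m_test_general[OF _ M])
    fix \<alpha> and z :: "complex^'n" assume z: "z \<in> ball 0 \<rho>"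
    have "norm (z $ i) \<le> \<rho>" for i using z Finite_Cartesian_Product.norm_nth_le[of z i] by auto
    then have "(\<Prod>i\<in>UNIV. norm (z $ i) ^ \<alpha> i) \<le> (\<Prod>i\<in>UNIV. \<rho> ^ \<alpha> i)"
      by (intro prod_mono) (auto intro: power_mono)
    moreover have "0 \<le> (\<Prod>i\<in>UNIV. \<rho> ^ \<alpha> i)" using \<rho> by (intro prod_nonneg) auto
    ultimately show "norm (T \<alpha> z) \<le> norm (c \<alpha> * (\<Prod>i\<in>UNIV. \<rho> ^ \<alpha> i))"
      by (simp add: T_def norm_mult norm_power abs_mult prod_norm[symmetric] mult_left_mono)
  qed
  have ev: "\<forall>\<^sub>F A in finite_subsets_at_top UNIV. hol_on (ball 0 \<rho>) (\<lambda>z. \<Sum>\<alpha>\<in>A. T \<alpha> z)"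
    unfolding T_def
    by (intro always_eventually allI hol_on_sum hol_on_mult hol_on_const hol_on_prod hol_on_power hol_on_component)
  have "hol_on (ball 0 \<rho>) F"
    by (rule hol_on_uniform_limit[OF open_ball ev ul]) simp
  moreover have "F (cvec x) = of_real (f x)" if "x \<in> ball 0 (min r \<rho>)" for x
  proof -
    have "((\<lambda>\<alpha>. complex_of_real (c \<alpha> * (\<Prod>i\<in>UNIV. (x $ i) ^ \<alpha> i))) has_sum of_real (f x)) UNIV"
      using sums[of x] that by (intro has_sum_of_real) auto
    then have "((\<lambda>\<alpha>. T \<alpha> (cvec x)) has_sum of_real (f x)) UNIV"
      by (simp add: T_def cvec_def)
    then show ?thesis unfolding F_def by (rule infsumI)
  qed
  ultimately show ?thesis
    unfolding cx_analytic_def using r \<rho>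
    by (intro exI[of _ "min r \<rho>"] conjI exI[of _ F]) (auto intro: hol_on_subset)
qed

lemma hol_on_Re_line_DERIV:
  assumes F: "hol_on (ball 0 R) F" and x: "x \<in> ball 0 R"
  shows "((\<lambda>t. Re (F (cvec (x + t *\<^sub>R v)))) has_real_derivative Re (dirderiv (cvec v) F (cvec x))) (at 0)"
proof -
  let ?g = "\<lambda>t. F (cvec x + t *s cvec v)"
  have "?g field_differentiable at 0"
    by (rule holomorphic_on_imp_differentiable_at[OF hol_onD(2)[OF F] open_line_vimage]) (use x in auto)
  then have "(?g has_field_derivative dirderiv (cvec v) F (cvec x)) (at 0)"
    unfolding dirderiv_def by (simp add: field_differentiable_derivI)
  then have "(?g has_field_derivative dirderiv (cvec v) F (cvec x)) (at (of_real 0))" by simp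
  then have "((\<lambda>t. ?g (of_real t)) has_vector_derivative dirderiv (cvec v) F (cvec x)) (at 0)"
    by (rule has_vector_derivative_real_field)
  then have "((\<lambda>t. Re (?g (of_real t))) has_vector_derivative Re (dirderiv (cvec v) F (cvec x))) (at 0)"
    by (rule bounded_linear.has_vector_derivative[OF bounded_linear_Re])
  then show ?thesis
    by (simp add: has_real_derivative_iff_has_vector_derivative cvec_add cvec_scaleR)
qed

lemma hol_on_Re_Ck_on:
  assumes "hol_on (ball 0 R) F" shows "Ck_on k (ball 0 R) (\<lambda>x. Re (F (cvec x)))"
proof -
  have cont: "continuous_on (ball 0 R) (\<lambda>x. Re (F (cvec x)))" if "hol_on (ball 0 R) F" for F
  proof -
    have "continuous_on (ball 0 R) (\<lambda>x. F (cvec x))"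
      by (rule continuous_on_compose2[OF hol_onD(1)[OF that] continuous_on_cvec]) auto
    then show ?thesis by (intro continuous_intros)
  qed
  show ?thesis
    using assms
  proof (induction k arbitrary: F)
    case 0
    then show ?case by (simp add: Ck_on_0 cont)
  next
    case (Suc k)
    show ?case
      by (rule Ck_on_SucI[OF open_ball cont[OF Suc.prems] hol_on_Re_line_DERIV[OF Suc.prems]])
        (auto intro: Suc.IH hol_on_dirderiv Suc.prems)
  qed
qed

lemma cx_analytic_imp_smooth_germ:
  assumes "cx_analytic f" shows "smooth_germ f"
proof -
  obtain R F where F: "R > 0" "hol_on (ball 0 R) F" "\<And>x. x \<in> ball 0 R \<Longrightarrow> F (cvec x) = of_real (f x)"
    using assms unfolding cx_analytic_def by blast
  have "Ck_on k (ball 0 R) f" for k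
    using hol_on_Re_Ck_on[OF F(2), of k] Ck_on_cong[OF open_ball, of 0 R f "\<lambda>x. Re (F (cvec x))" k] F(3) by simp
  then show ?thesis
    unfolding smooth_germ_def smooth_on_def using F(1) by (intro exI[of _ "ball 0 R"]) auto
qed

text \<open>A mean value inequality from partial derivatives alone: \<open>x\<close> is reached from
  \<open>p\<close> by changing one coordinate at a time. On the way each coordinate of the
  difference to \<open>p\<close> is at most that of \<open>x - p\<close>, so the path stays in the
  ball; the factor \<open>CARD('n)\<close> counts its pieces.\<close>

lemma axis_path_bound:
  fixes f :: "real^'n::finite \<Rightarrow> real"
  assumes der: "\<And>y i. norm (y - p) \<le> norm (x - p) \<Longrightarrow>
      ((\<lambda>t. f (y + t *\<^sub>R axis i 1)) has_real_derivative f' i y) (at 0)"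
    and B: "\<And>y i. norm (y - p) \<le> norm (x - p) \<Longrightarrow> \<bar>f' i y\<bar> \<le> B"
  shows "\<bar>f x - f p\<bar> \<le> real CARD('n) * B * norm (x - p)"
proof -
  have "\<bar>f' undefined p\<bar> \<le> B" by (rule B) simp
  then have B0: "B \<ge> 0" by linarith
  define q where "q S = p + (\<Sum>i\<in>S. (x - p) $ i *\<^sub>R axis i 1)" for S
  have qc: "q S $ j = p $ j + (if j \<in> S then (x - p) $ j else 0)" if "finite S" for S j
  proof -
    have "(\<Sum>i\<in>S. (x - p) $ i *\<^sub>R axis i 1) $ j = (\<Sum>i\<in>S. if i = j then (x - p) $ i else 0)"
      unfolding sum_component by (intro sum.cong) (auto simp: axis_def)
    then show ?thesis using that by (simp add: q_def)
  qed
  have "\<bar>f (q S) - f p\<bar> \<le> real (card S) * B * norm (x - p)" for S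
  proof (induction S rule: finite_induct[OF finite])
    case 1
    show ?case by (simp add: q_def)
  next
    case (2 i S)
    let ?a = "(x - p) $ i"
    let ?g = "\<lambda>t. f (q S + t *\<^sub>R axis i 1)"
    have inb: "norm (q S + t *\<^sub>R axis i 1 - p) \<le> norm (x - p)" if "t \<in> closed_segment 0 ?a" for t
    proof (rule norm_le_componentwise_cart)
      fix j
      have "\<bar>t\<bar> \<le> \<bar>?a\<bar>" using that by (auto simp: closed_segment_eq_real_ivl split: if_splits)
      then show "norm ((q S + t *\<^sub>R axis i 1 - p) $ j) \<le> norm ((x - p) $ j)"
        using 2 by (auto simp: qc axis_def)
    qed
    have "norm (?g ?a - ?g 0) \<le> B * norm (?a - 0)"
    proof (rule field_differentiable_bound[OF convex_closed_segment])
      fix t assume t: "t \<in> closed_segment 0 ?a"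
      have "((\<lambda>s. f (q S + t *\<^sub>R axis i 1 + s *\<^sub>R axis i 1)) has_real_derivative f' i (q S + t *\<^sub>R axis i 1)) (at 0)"
        by (rule der[OF inb[OF t]])
      then have "((\<lambda>s. ?g (s + t)) has_real_derivative f' i (q S + t *\<^sub>R axis i 1)) (at 0)"
        by (simp add: algebra_simps)
      then have "(?g has_real_derivative f' i (q S + t *\<^sub>R axis i 1)) (at t)"
        using DERIV_shift[of ?g _ 0 t] by simp
      then show "(?g has_real_derivative f' i (q S + t *\<^sub>R axis i 1)) (at t within closed_segment 0 ?a)"
        by (rule has_field_derivative_at_within)
      show "norm (f' i (q S + t *\<^sub>R axis i 1)) \<le> B" using B[OF inb[OF t]] by simp
    qed auto
    moreover have "B * norm (?a - 0) \<le> B * norm (x - p)"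
      using B0 component_le_norm_cart[of "x - p" i] by (intro mult_left_mono) auto
    moreover have "q (insert i S) = q S + ?a *\<^sub>R axis i 1" using 2 by (simp add: q_def algebra_simps)
    ultimately have "\<bar>f (q (insert i S)) - f (q S)\<bar> \<le> B * norm (x - p)" by simp
    moreover have "real (card (insert i S)) * B * norm (x - p) = real (card S) * B * norm (x - p) + B * norm (x - p)"
      using 2 by (simp add: algebra_simps)
    ultimately show ?case using "2.IH" by linarith
  qed
  moreover have "q UNIV = x" by (simp add: vec_eq_iff qc)
  ultimately show ?thesis by (metis)
qed

text \<open>Taylor's estimate by induction on the order: the bound for the partial derivatives is
  integrated with \<open>axis_path_bound\<close>, at the price of a factor \<open>CARD('n)\<close>
  per order. The last hypothesis keeps the ball around \<open>p\<close> through \<open>x\<close>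
  inside \<open>ball 0 R\<close>.\<close>

lemma jet_bound:
  fixes f :: "real^'n::finite \<Rightarrow> real"
  assumes "Ck_on (Suc k) (ball 0 R) f"
    and "\<And>ds y. length ds = Suc k \<Longrightarrow> y \<in> ball 0 R \<Longrightarrow> \<bar>pd ds f y\<bar> \<le> C"
    and "\<And>ds. length ds \<le> k \<Longrightarrow> pd ds f p = 0" and "norm p + norm (x - p) < R"
  shows "\<bar>f x\<bar> \<le> C * real CARD('n) ^ Suc k * norm (x - p) ^ Suc k"
proof -
  have "norm p < R" using assms(4) norm_ge_zero[of "x - p"] by linarith
  \<comment> \<open>Any list of length \<open>k + 1\<close> serves; the point is that
    \<open>C\<close> bounds an absolute value and is therefore nonnegative.\<close>
  then have "\<bar>pd (replicate (Suc k) undefined) f p\<bar> \<le> C" by (intro assms(2)) auto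
  then have C: "C \<ge> 0" using order_trans[OF abs_ge_zero] by blast
  show ?thesis
    using assms
  proof (induction k arbitrary: f x)
    case 0
    have inb: "y \<in> ball 0 R" if "norm (y - p) \<le> norm (x - p)" for y
      using that 0(4) norm_triangle_ineq[of p "y - p"] by simp
    have "\<bar>f x - f p\<bar> \<le> real CARD('n) * C * norm (x - p)"
      by (rule axis_path_bound[where f' = "\<lambda>i. partial i f"])
        (use Ck_on_SucD(4)[OF 0(1) inb] 0(2)[of "[_]"] inb in auto)
    then show ?case using 0(3)[of "[]"] by (simp add: mult.commute)
  next
    case (Suc k)
    have inb: "norm p + norm (y - p) < R" if "norm (y - p) \<le> norm (x - p)" for y
      using that Suc.prems(4) by simp
    have inb': "y \<in> ball 0 R" if "norm (y - p) \<le> norm (x - p)" for y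
      using inb[OF that] norm_triangle_ineq[of p "y - p"] by simp
    let ?B = "C * real CARD('n) ^ Suc k * norm (x - p) ^ Suc k"
    have "\<bar>f x - f p\<bar> \<le> real CARD('n) * ?B * norm (x - p)"
    proof (rule axis_path_bound[where f' = "\<lambda>i. partial i f"])
      fix y i assume y: "norm (y - p) \<le> norm (x - p)"
      show "((\<lambda>t. f (y + t *\<^sub>R axis i 1)) has_real_derivative partial i f y) (at 0)"
        by (rule Ck_on_SucD(4)[OF Suc.prems(1) inb'[OF y]])
      have "\<bar>partial i f y\<bar> \<le> C * real CARD('n) ^ Suc k * norm (y - p) ^ Suc k"
      proof (rule Suc.IH[OF Ck_on_SucD(2)[OF Suc.prems(1)] _ _ inb[OF y]])
        show "\<bar>pd ds (partial i f) y\<bar> \<le> C" if "length ds = Suc k" "y \<in> ball 0 R" for ds y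
          using Suc.prems(2)[of "ds @ [i]" y] that by (simp add: pd_append1)
        show "pd ds (partial i f) p = 0" if "length ds \<le> k" for ds
          using Suc.prems(3)[of "ds @ [i]"] that by (simp add: pd_append1)
      qed
      also have "\<dots> \<le> ?B" using C y by (intro mult_left_mono power_mono) auto
      finally show "\<bar>partial i f y\<bar> \<le> ?B" .
    qed
    then show ?case using Suc.prems(3)[of "[]"] by (simp add: algebra_simps)
  qed
qed

text \<open>The path inequality is applied to \<open>f\<close> minus its candidate linear part,
  whose partial derivatives are small near \<open>a\<close> by continuity.\<close>

lemma C1_has_derivative:
  fixes f :: "real^'n::finite \<Rightarrow> real"
  assumes f: "Ck_on 1 U f" and U: "open U" "a \<in> U"
  shows "(f has_derivative (\<lambda>h. \<Sum>i\<in>UNIV. partial i f a * h $ i)) (at a)"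
proof -
  let ?L = "\<lambda>h. \<Sum>i\<in>UNIV. partial i f a * h $ i"
  have f1: "Ck_on (Suc 0) U f" using f by simp
  have bl: "bounded_linear ?L"
    by (intro bounded_linear_sum bounded_linear_const_mult bounded_linear_vec_nth)
  have "\<exists>d>0. \<forall>x. norm (x - a) < d \<longrightarrow> norm (f x - f a - ?L (x - a)) \<le> e * norm (x - a)" if e: "e > 0" for e
  proof -
    let ?e = "e / real CARD('n)"
    have e': "?e > 0" using e by simp
    have "\<forall>i. \<forall>\<^sub>F y in nhds a. \<bar>partial i f y - partial i f a\<bar> < ?e"
    proof
      fix i
      have "isCont (partial i f) a"
        using Ck_on_continuous[OF Ck_on_SucD(2)[OF f1]] U continuous_on_eq_continuous_at by blast
      then have "(partial i f \<longlongrightarrow> partial i f a) (nhds a)"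
        by (simp add: isCont_def tendsto_at_iff_tendsto_nhds)
      then show "\<forall>\<^sub>F y in nhds a. \<bar>partial i f y - partial i f a\<bar> < ?e"
        using tendstoD[OF _ e'] by (fastforce simp: dist_real_def)
    qed
    then have "\<forall>\<^sub>F y in nhds a. \<forall>i. \<bar>partial i f y - partial i f a\<bar> < ?e"
      by (intro eventually_all_finite) blast
    then have "\<forall>\<^sub>F y in nhds a. y \<in> U \<and> (\<forall>i. \<bar>partial i f y - partial i f a\<bar> < ?e)"
      by (intro eventually_conj eventually_nhds_in_open U)
    then obtain d where d: "d > 0" "\<And>y. dist y a < d \<Longrightarrow> y \<in> U \<and> (\<forall>i. \<bar>partial i f y - partial i f a\<bar> < ?e)"
      unfolding eventually_nhds_metric by blast
    have "norm (f x - f a - ?L (x - a)) \<le> e * norm (x - a)" if x: "norm (x - a) < d" for x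
    proof -
      let ?g = "\<lambda>y. f y - ?L (y - a)"
      have "\<bar>?g x - ?g a\<bar> \<le> real CARD('n) * ?e * norm (x - a)"
      proof (rule axis_path_bound[where f' = "\<lambda>i y. partial i f y - partial i f a"])
        fix y i assume "norm (y - a) \<le> norm (x - a)"
        then have y: "dist y a < d" using x by (simp add: dist_norm)
        show "\<bar>partial i f y - partial i f a\<bar> \<le> ?e" using d(2)[OF y] by (simp add: less_imp_le)
        have "?L (y + t *\<^sub>R axis i 1 - a) = ?L (y - a) + partial i f a * t" for t
        proof -
          have "?L (y + t *\<^sub>R axis i 1 - a) = ?L ((y - a) + t *\<^sub>R axis i 1)" by (simp add: algebra_simps)
          also have "\<dots> = ?L (y - a) + ?L (t *\<^sub>R axis i 1)"
            using linear_add[OF bounded_linear.linear[OF bl]] .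
          also have "?L (t *\<^sub>R axis i 1) = (\<Sum>j\<in>UNIV. if j = i then partial i f a * t else 0)"
            by (intro sum.cong) (auto simp: axis_def)
          finally show ?thesis by simp
        qed
        moreover have "((\<lambda>t. f (y + t *\<^sub>R axis i 1) - (?L (y - a) + partial i f a * t)) has_real_derivative
            partial i f y - partial i f a) (at 0)"
          by (rule derivative_eq_intros Ck_on_SucD(4)[OF f1] refl | use d(2)[OF y] in simp)+
        ultimately show "((\<lambda>t. f (y + t *\<^sub>R axis i 1) - ?L (y + t *\<^sub>R axis i 1 - a)) has_real_derivative
            partial i f y - partial i f a) (at 0)" by simp
      qed
      then show ?thesis by (simp add: algebra_simps)
    qed
    then show ?thesis using d(1) by blast
  qed
  then show ?thesis using bl by (simp add: has_derivative_at_alt)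
qed

section \<open>Weighted bounds on derivatives\<close>

text \<open>Here \<open>D\<close> is the distance to the singular set, \<open>m\<close> the order of
  vanishing, and \<open>L\<close> the order lost with each derivative. Exponents are real since
  \<open>m - L * length ds\<close> may be negative.\<close>

definition weighted_bound :: "(real^'n::finite) set \<Rightarrow> (real^'n \<Rightarrow> real) \<Rightarrow> real \<Rightarrow> nat \<Rightarrow> real \<Rightarrow> (real^'n \<Rightarrow> real) \<Rightarrow> bool" where
  "weighted_bound A D L s m f \<longleftrightarrow> (\<forall>ds. length ds \<le> s \<longrightarrow> (\<exists>C. \<forall>x\<in>A. \<bar>pd ds f x\<bar> \<le> C * D x powr (m - L * length ds)))"

lemma weighted_bound_nonneg_const:
  fixes g D :: "'a \<Rightarrow> real"
  assumes "\<exists>C. \<forall>x\<in>A. \<bar>g x\<bar> \<le> C * D x powr m" 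
  shows "\<exists>C\<ge>0. \<forall>x\<in>A. \<bar>g x\<bar> \<le> C * D x powr m"
proof -
  obtain C where C: "\<forall>x\<in>A. \<bar>g x\<bar> \<le> C * D x powr m" using assms by blast
  have "\<forall>x\<in>A. \<bar>g x\<bar> \<le> \<bar>C\<bar> * D x powr m"
  proof
    fix x assume "x \<in> A"
    then have "\<bar>g x\<bar> \<le> C * D x powr m" using C by blast
    also have "\<dots> \<le> \<bar>C\<bar> * D x powr m" by (intro mult_right_mono) auto
    finally show "\<bar>g x\<bar> \<le> \<bar>C\<bar> * D x powr m" .
  qed
  then show ?thesis by (intro exI[of _ "\<bar>C\<bar>"]) auto
qed

lemma weighted_bound_Suc: "weighted_bound A D L (Suc s) m f \<longleftrightarrow>
    (\<exists>C. \<forall>x\<in>A. \<bar>f x\<bar> \<le> C * D x powr m) \<and> (\<forall>i. weighted_bound A D L s (m - L) (partial i f))"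
proof
  assume a: "weighted_bound A D L (Suc s) m f"
  have "\<exists>C. \<forall>x\<in>A. \<bar>f x\<bar> \<le> C * D x powr m" using a[unfolded weighted_bound_def, rule_format, of "[]"] by simp
  moreover have "weighted_bound A D L s (m - L) (partial i f)" for i
    unfolding weighted_bound_def
  proof (intro allI impI)
    fix ds :: "'a list" assume "length ds \<le> s"
    then show "\<exists>C. \<forall>x\<in>A. \<bar>pd ds (partial i f) x\<bar> \<le> C * D x powr (m - L - L * length ds)"
      using a[unfolded weighted_bound_def, rule_format, of "ds @ [i]"] by (simp add: pd_append1 algebra_simps)
  qed
  ultimately show "(\<exists>C. \<forall>x\<in>A. \<bar>f x\<bar> \<le> C * D x powr m) \<and> (\<forall>i. weighted_bound A D L s (m - L) (partial i f))" by blast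
next
  assume a: "(\<exists>C. \<forall>x\<in>A. \<bar>f x\<bar> \<le> C * D x powr m) \<and> (\<forall>i. weighted_bound A D L s (m - L) (partial i f))"
  show "weighted_bound A D L (Suc s) m f"
    unfolding weighted_bound_def
  proof (intro allI impI)
    fix ds :: "'a list" assume len: "length ds \<le> Suc s"
    show "\<exists>C. \<forall>x\<in>A. \<bar>pd ds f x\<bar> \<le> C * D x powr (m - L * length ds)"
    proof (cases ds rule: rev_cases)
      case (snoc ds' i)
      then show ?thesis
        using a[THEN conjunct2, rule_format, of i, unfolded weighted_bound_def, rule_format, of ds'] len
        by (simp add: pd_append1 algebra_simps)
    qed (use a in simp)
  qed
qed

lemma weighted_bound_0: "weighted_bound A D L 0 m f \<longleftrightarrow> (\<exists>C. \<forall>x\<in>A. \<bar>f x\<bar> \<le> C * D x powr m)"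
  by (simp add: weighted_bound_def)

lemma weighted_bound_cong:
  assumes "open A" "\<And>x. x \<in> A \<Longrightarrow> f x = g x" shows "weighted_bound A D L s m f \<longleftrightarrow> weighted_bound A D L s m g"
  unfolding weighted_bound_def using pd_cong[OF assms(1) _ assms(2)] by simp

lemma weighted_bound_le: "weighted_bound A D L s m f \<Longrightarrow> t \<le> s \<Longrightarrow> weighted_bound A D L t m f"
  by (auto simp: weighted_bound_def)

lemma weighted_bound_add:
  assumes A: "open A" and f: "weighted_bound A D L s m f" "Ck_on s A f" and g: "weighted_bound A D L s m g" "Ck_on s A g"
  shows "weighted_bound A D L s m (\<lambda>x. f x + g x)"
  unfolding weighted_bound_def
proof (intro allI impI)
  fix ds :: "'a list" assume len: "length ds \<le> s"
  obtain C where C: "\<forall>x\<in>A. \<bar>pd ds f x\<bar> \<le> C * D x powr (m - L * length ds)" using f len unfolding weighted_bound_def by blast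
  obtain C' where C': "\<forall>x\<in>A. \<bar>pd ds g x\<bar> \<le> C' * D x powr (m - L * length ds)" using g len unfolding weighted_bound_def by blast
  have "\<bar>pd ds (\<lambda>x. f x + g x) x\<bar> \<le> (C + C') * D x powr (m - L * length ds)" if "x \<in> A" for x
    using C C' that pd_add[OF A that Ck_on_le[OF f(2) len] Ck_on_le[OF g(2) len]]
    by (smt (verit) distrib_right)
  then show "\<exists>C. \<forall>x\<in>A. \<bar>pd ds (\<lambda>x. f x + g x) x\<bar> \<le> C * D x powr (m - L * length ds)" by blast
qed

lemma weighted_bound_mult:
  assumes A: "open A" and "weighted_bound A D L s m f" "Ck_on s A f" "weighted_bound A D L s m' g" "Ck_on s A g"
    and D: "\<And>x. x \<in> A \<Longrightarrow> 0 < D x \<and> D x \<le> 1" and L: "L \<ge> 0"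
  shows "weighted_bound A D L s (m + m') (\<lambda>x. f x * g x)"
  using assms(2-5)
proof (induction s arbitrary: f g m m')
  case 0
  obtain C where C: "C \<ge> 0" "\<forall>x\<in>A. \<bar>f x\<bar> \<le> C * D x powr m" using 0 weighted_bound_nonneg_const unfolding weighted_bound_0 by blast
  obtain C' where C': "C' \<ge> 0" "\<forall>x\<in>A. \<bar>g x\<bar> \<le> C' * D x powr m'" using 0 weighted_bound_nonneg_const unfolding weighted_bound_0 by blast
  have "\<bar>f x * g x\<bar> \<le> (C * C') * D x powr (m + m')" if "x \<in> A" for x
  proof -
    have "\<bar>f x * g x\<bar> \<le> (C * D x powr m) * (C' * D x powr m')"
      unfolding abs_mult using C C' that by (intro mult_mono) auto
    then show ?thesis by (simp add: powr_add algebra_simps)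
  qed
  then show ?case unfolding weighted_bound_0 by blast
next
  case (Suc s)
  note f = Suc.prems(1,2) and g = Suc.prems(3,4)
  have f0: "weighted_bound A D L s m f" and g0: "weighted_bound A D L s m' g" using weighted_bound_le[OF f(1)] weighted_bound_le[OF g(1)] by auto
  have fp: "weighted_bound A D L s (m - L) (partial i f)" and gp: "weighted_bound A D L s (m' - L) (partial i g)" for i
    using f g by (auto simp: weighted_bound_Suc)
  obtain C where C: "C \<ge> 0" "\<forall>x\<in>A. \<bar>f x\<bar> \<le> C * D x powr m" using f weighted_bound_nonneg_const unfolding weighted_bound_Suc by blast
  obtain C' where C': "C' \<ge> 0" "\<forall>x\<in>A. \<bar>g x\<bar> \<le> C' * D x powr m'" using g weighted_bound_nonneg_const unfolding weighted_bound_Suc by blast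
  have "\<bar>f x * g x\<bar> \<le> (C * C') * D x powr (m + m')" if "x \<in> A" for x
  proof -
    have "\<bar>f x * g x\<bar> \<le> (C * D x powr m) * (C' * D x powr m')"
      unfolding abs_mult using C C' that by (intro mult_mono) auto
    then show ?thesis by (simp add: powr_add algebra_simps)
  qed
  moreover have "weighted_bound A D L s (m + m' - L) (partial i (\<lambda>x. f x * g x))" for i
  proof -
    have eq: "partial i (\<lambda>x. f x * g x) x = f x * partial i g x + partial i f x * g x" if "x \<in> A" for x
      by (rule DERIV_line_diff(2))
        (use DERIV_mult'[OF Ck_on_SucD(4)[OF f(2) that] Ck_on_SucD(4)[OF g(2) that]] in simp)
    have "weighted_bound A D L s (m + (m' - L)) (\<lambda>x. f x * partial i g x)"
      by (rule Suc.IH[OF f0 Ck_on_SucD(1)[OF f(2)] gp Ck_on_SucD(2)[OF g(2)]])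
    moreover have "weighted_bound A D L s ((m - L) + m') (\<lambda>x. partial i f x * g x)"
      by (rule Suc.IH[OF fp Ck_on_SucD(2)[OF f(2)] g0 Ck_on_SucD(1)[OF g(2)]])
    ultimately have "weighted_bound A D L s (m + m' - L) (\<lambda>x. f x * partial i g x + partial i f x * g x)"
      by (intro weighted_bound_add Ck_on_mult A Ck_on_SucD[OF f(2)] Ck_on_SucD[OF g(2)]) (simp_all add: algebra_simps)
    then show ?thesis
      using weighted_bound_cong[OF A, of "partial i (\<lambda>x. f x * g x)" "\<lambda>x. f x * partial i g x + partial i f x * g x"] eq by simp
  qed
  ultimately show ?case unfolding weighted_bound_Suc by blast
qed

lemma pd_const: "pd ds (\<lambda>y::real^'n::finite. c) = (if ds = [] then (\<lambda>y. c) else (\<lambda>y. 0))"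
proof (cases ds rule: rev_cases)
  case (snoc es i)
  have "partial i (\<lambda>y::real^'n. c) = (\<lambda>y. 0)" by (auto simp: partial_def)
  then show ?thesis using snoc by (auto simp: pd_append1 pd_const_0)
qed simp

text \<open>Because \<open>D\<close> is at most 1, allowing a negative exponent only weakens a
  bound. This brings smooth functions to the same loss \<open>L\<close> as the inverse they are
  multiplied with.\<close>

lemma weighted_bound_of_bounded:
  assumes D: "\<And>x. x \<in> A \<Longrightarrow> 0 < D x \<and> D x \<le> 1" and L: "L \<ge> 0" and bd: "weighted_bound A D 0 s 0 Q"
  shows "weighted_bound A D L s 0 Q"
  unfolding weighted_bound_def
proof (intro allI impI)
  fix ds :: "'a list" assume len: "length ds \<le> s"
  have "\<exists>C. \<forall>x\<in>A. \<bar>pd ds Q x\<bar> \<le> C * D x powr (0 - 0 * real (length ds))"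
    using bd len unfolding weighted_bound_def by blast
  from weighted_bound_nonneg_const[OF this]
  obtain C where C: "C \<ge> 0" "\<forall>x\<in>A. \<bar>pd ds Q x\<bar> \<le> C * D x powr (0 - 0 * real (length ds))"
    by (elim exE conjE) (rule that)
  have "\<bar>pd ds Q x\<bar> \<le> C * D x powr (0 - L * length ds)" if x: "x \<in> A" for x
  proof -
    have "0 - L * real (length ds) \<le> 0" using L by simp
    then have "D x powr 0 \<le> D x powr (0 - L * length ds)"
      using D[OF x] by (intro powr_mono') simp_all
    then have le: "1 \<le> D x powr (0 - L * length ds)" using D[OF x] by simp
    have "\<bar>pd ds Q x\<bar> \<le> C * D x powr (0 - 0 * real (length ds))" using C(2) x by blast
    also have "\<dots> = C * 1" using D[OF x] by simp
    also have "\<dots> \<le> C * D x powr (0 - L * length ds)" by (rule mult_left_mono[OF le C(1)])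
    finally show ?thesis .
  qed
  then show "\<exists>C. \<forall>x\<in>A. \<bar>pd ds Q x\<bar> \<le> C * D x powr (0 - L * length ds)" by blast
qed

text \<open>The derivative of \<open>1/Q\<close> is \<open>- Q' / Q^2\<close>, of weight
  \<open>- L - L\<close>: one derivative costs exactly another \<open>L\<close>. This fixes the loss
  per derivative as the exponent in the lower bound of \<open>Q\<close>.\<close>

lemma weighted_bound_inverse:
  assumes A: "open A" and D: "\<And>x. x \<in> A \<Longrightarrow> 0 < D x \<and> D x \<le> 1" and L: "L \<ge> 0"
    and Q: "Ck_on s A Q" "weighted_bound A D 0 s 0 Q" and c: "c > 0" "\<And>x. x \<in> A \<Longrightarrow> \<bar>Q x\<bar> \<ge> c * D x powr L"
  shows "weighted_bound A D L s (- L) (\<lambda>x. inverse (Q x))"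
proof -
  have nz: "Q x \<noteq> 0" if "x \<in> A" for x
  proof -
    have "0 < c * D x powr L" using D[OF that] c by simp
    then show ?thesis using c(2)[OF that] by auto
  qed
  have bd: "\<exists>C. \<forall>x\<in>A. \<bar>inverse (Q x)\<bar> \<le> C * D x powr (- L)"
  proof (intro exI ballI)
    fix x assume x: "x \<in> A"
    have "0 < c * D x powr L" using D[OF x] c by simp
    then have "inverse \<bar>Q x\<bar> \<le> inverse (c * D x powr L)"
      using c(2)[OF x] by (intro le_imp_inverse_le)
    then show "\<bar>inverse (Q x)\<bar> \<le> inverse c * D x powr (- L)" by (simp add: powr_minus abs_inverse)
  qed
  note bdd = weighted_bound_of_bounded[OF D L]
  show ?thesis
    using Q
  proof (induction s)
    case 0
    then show ?case using bd by (simp add: weighted_bound_0)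
  next
    case (Suc s)
    have wi: "weighted_bound A D L s (- L) (\<lambda>x. inverse (Q x))"
      using Suc.IH[OF Ck_on_SucD(1)[OF Suc.prems(1)] weighted_bound_le[OF Suc.prems(2)]] by simp
    have ci: "Ck_on s A (\<lambda>x. inverse (Q x))"
      by (rule Ck_on_inverse[OF A Ck_on_SucD(1)[OF Suc.prems(1)] nz])
    have "weighted_bound A D L s (- L - L) (partial i (\<lambda>x. inverse (Q x)))" for i
    proof -
      have eq: "partial i (\<lambda>x. inverse (Q x)) x = (- 1) * partial i Q x * (inverse (Q x) * inverse (Q x))" if "x \<in> A" for x
        by (rule DERIV_line_diff(2)[OF line_DERIV_inverse[OF Ck_on_SucD(4)[OF Suc.prems(1) that] nz[OF that]]])
      have wq: "weighted_bound A D L s 0 (partial i Q)"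
        using Suc.prems(2) by (intro bdd) (auto simp: weighted_bound_Suc)
      have cq: "Ck_on s A (partial i Q)" by (rule Ck_on_SucD(2)[OF Suc.prems(1)])
      have w1: "weighted_bound A D L s 0 (\<lambda>x. - 1)"
        by (rule bdd) (auto simp: weighted_bound_def pd_const intro!: exI[of _ 1] dest: D)
      have c1: "Ck_on s A (\<lambda>x. - 1)" by (rule Ck_on_const[OF A])
      have "weighted_bound A D L s ((0 + 0) + (- L + - L)) (\<lambda>x. (- 1) * partial i Q x * (inverse (Q x) * inverse (Q x)))"
        by (rule weighted_bound_mult[OF A weighted_bound_mult[OF A w1 c1 wq cq D L] Ck_on_mult[OF A c1 cq]
              weighted_bound_mult[OF A wi ci wi ci D L] Ck_on_mult[OF A ci ci] D L])
      then show ?thesis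
        using weighted_bound_cong[OF A, of "partial i (\<lambda>x. inverse (Q x))" "\<lambda>x. (- 1) * partial i Q x * (inverse (Q x) * inverse (Q x))" D L s "- L - L"] eq
        by simp
    qed
    then show ?case using bd unfolding weighted_bound_Suc by simp
  qed
qed

section \<open>Flat sums of bump functions\<close>

text \<open>The family \<open>p(1/t) exp(-1/t)\<close>, extended by zero, contains the standard flat
  function for \<open>p = 1\<close> and is closed under differentiation, which supplies the tower
  demanded by \<open>Ck_on_compose_real\<close>.\<close>

definition expm :: "real poly \<Rightarrow> real \<Rightarrow> real" where
  "expm p t = (if t > 0 then poly p (inverse t) * exp (- inverse t) else 0)"

lemma poly_exp_tendsto_0: "((\<lambda>s. poly p s * exp (- s)) \<longlongrightarrow> (0::real)) at_top"
proof -
  have "((\<lambda>s. \<Sum>i\<le>degree p. coeff p i * (s ^ i / exp s)) \<longlongrightarrow> (\<Sum>i\<le>degree p. coeff p i * 0)) at_top"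
    by (intro tendsto_sum tendsto_mult tendsto_const tendsto_power_div_exp_0)
  moreover have "(\<Sum>i\<le>degree p. coeff p i * (s ^ i / exp s)) = poly p s * exp (- s)" for s
    by (simp add: poly_altdef sum_distrib_right exp_minus divide_inverse mult.assoc)
  ultimately show ?thesis by simp
qed

text \<open>With \<open>s = 1/t\<close>, differentiation in \<open>t\<close> turns
  \<open>p(s) exp(-s)\<close> into \<open>s^2 (p - p')(s) exp(-s)\<close>.\<close>

definition expm_step :: "real poly \<Rightarrow> real poly" where
  "expm_step p = [:0, 0, 1:] * (p - pderiv p)"

text \<open>At 0 the right difference quotient is again of the form \<open>q(1/h) exp(-1/h)\<close>,
  with \<open>q\<close> equal to \<open>p\<close> times the variable, so it tends to 0.\<close>

lemma expm_DERIV: "(expm p has_real_derivative expm (expm_step p) t) (at t)"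
proof -
  consider "t > 0" | "t < 0" | "t = 0" by linarith
  then show ?thesis
  proof cases
    case 1
    have "((\<lambda>t. poly p (inverse t) * exp (- inverse t)) has_real_derivative expm (expm_step p) t) (at t)"
      using 1 by (auto intro!: derivative_eq_intros poly_DERIV[THEN DERIV_chain2]
          simp: expm_def expm_step_def algebra_simps power2_eq_square)
    moreover have "\<forall>\<^sub>F s in nhds t. expm p s = poly p (inverse s) * exp (- inverse s)"
      using eventually_nhds_in_open[of "{0<..}" t] 1 by (auto elim!: eventually_mono simp: expm_def)
    ultimately show ?thesis
      using DERIV_cong_ev[OF refl, of "expm p" "\<lambda>t. poly p (inverse t) * exp (- inverse t)" t] by blast
  next
    case 2
    have "\<forall>\<^sub>F s in nhds t. expm p s = 0"
      using eventually_nhds_in_open[of "{..<0}" t] 2 by (auto elim!: eventually_mono simp: expm_def)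
    then have "(expm p has_real_derivative 0) (at t)"
      using DERIV_cong_ev[OF refl, of "expm p" "\<lambda>_. 0" t 0 0] by simp
    then show ?thesis using 2 by (simp add: expm_def)
  next
    case 3
    have "((\<lambda>h. (expm p h - expm p 0) / (h - 0)) \<longlongrightarrow> 0) (at 0)"
    proof (rule filterlim_split_at)
      have "\<forall>\<^sub>F h in at_left 0. (expm p h - expm p 0) / (h - 0) = 0"
        by (auto simp: eventually_at_filter expm_def intro!: always_eventually)
      then show "((\<lambda>h. (expm p h - expm p 0) / (h - 0)) \<longlongrightarrow> 0) (at_left 0)"
        by (simp add: tendsto_eventually)
      have "((\<lambda>h. poly (pCons 0 p) (inverse h) * exp (- inverse h)) \<longlongrightarrow> 0) (at_right 0)"
        by (rule filterlim_compose[OF poly_exp_tendsto_0 filterlim_inverse_at_top_right])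
      moreover have "\<forall>\<^sub>F h in at_right 0. poly (pCons 0 p) (inverse h) * exp (- inverse h) = (expm p h - expm p 0) / (h - 0)"
        by (auto simp: eventually_at_filter expm_def field_simps intro!: always_eventually)
      ultimately show "((\<lambda>h. (expm p h - expm p 0) / (h - 0)) \<longlongrightarrow> 0) (at_right 0)"
        by (rule Lim_transform_eventually)
    qed
    then show ?thesis using 3 by (simp add: has_field_derivative_iff expm_def)
  qed
qed

lemma smooth_bump_exists:
  obtains \<omega> :: "real^'n::finite \<Rightarrow> real" where "\<And>k. Ck_on k UNIV \<omega>"
    "\<And>x. norm x \<le> 1/4 \<Longrightarrow> \<omega> x = 1" "\<And>x. norm x \<ge> 1/2 \<Longrightarrow> \<omega> x = 0"
proof -
  define B where "B m = expm ((expm_step ^^ m) 1)" for m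
  have B: "(B m has_real_derivative B (Suc m) t) (at t)" for m t
    unfolding B_def using expm_DERIV by simp
  have B0: "B 0 t \<ge> 0" "B 0 t > 0 \<longleftrightarrow> t > 0" "t \<le> 0 \<Longrightarrow> B 0 t = 0" for t
    by (auto simp: B_def expm_def)
  define N where "N x = (\<Sum>i\<in>UNIV. x $ i * x $ i)" for x :: "real^'n"
  have N: "N x = (norm x)\<^sup>2" for x
    by (simp add: N_def norm_vec_def L2_set_def power2_eq_square sum_nonneg)
  have CN: "Ck_on k UNIV N" for k
    unfolding N_def by (intro Ck_on_sum Ck_on_mult Ck_on_component open_UNIV)
  \<comment> \<open>\<open>u\<close> is positive exactly for norm below 1/2, \<open>w\<close>
    exactly for norm above 1/4, so \<open>u / (u + w)\<close> is a smooth cutoff. The squared norm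
    is used because it is smooth at the origin too.\<close>
  define u w where "u x = B 0 (1/4 - N x)" and "w x = B 0 (N x - 1/16)" for x
  have cu: "Ck_on k UNIV u" for k
    unfolding u_def
    by (rule Ck_on_compose_real[where B = B, OF open_UNIV B Ck_on_diff[OF open_UNIV Ck_on_const[OF open_UNIV] CN]])
  have cw: "Ck_on k UNIV w" for k
    unfolding w_def
    by (rule Ck_on_compose_real[where B = B, OF open_UNIV B Ck_on_diff[OF open_UNIV CN Ck_on_const[OF open_UNIV]]])
  have pos: "u x + w x > 0" for x
  proof (cases "N x < 1/4")
    case True
    then have "u x > 0" unfolding u_def using B0(2) by simp
    then show ?thesis using B0(1)[of "N x - 1/16"] by (simp add: w_def)
  next
    case False
    then have "w x > 0" unfolding w_def using B0(2) by simp
    then show ?thesis using B0(1)[of "1/4 - N x"] by (simp add: u_def)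
  qed
  show thesis
  proof
    show "Ck_on k UNIV (\<lambda>x. u x * inverse (u x + w x))" for k
      by (intro Ck_on_mult Ck_on_inverse Ck_on_add cu cw open_UNIV) (use pos in \<open>metis less_irrefl\<close>)
    show "u x * inverse (u x + w x) = 1" if "norm x \<le> 1/4" for x
    proof -
      have "(norm x)\<^sup>2 \<le> (1/4)\<^sup>2" using that by (intro power_mono) auto
      then have "w x = 0" unfolding w_def by (intro B0(3)) (simp add: N power2_eq_square)
      then show ?thesis using pos[of x] by simp
    qed
    show "u x * inverse (u x + w x) = 0" if "norm x \<ge> 1/2" for x
    proof -
      have "(1/2)\<^sup>2 \<le> (norm x)\<^sup>2" using that by (intro power_mono) auto
      then have "u x = 0" unfolding u_def by (intro B0(3)) (simp add: N power2_eq_square)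
      then show ?thesis by simp
    qed
  qed
qed

section \<open>Flat functions from bumps at shrinking scales\<close>

lemma pd_bounded_of_compact_support:
  fixes \<eta> :: "real^'n::finite \<Rightarrow> real"
  assumes ck: "\<And>k. Ck_on k UNIV \<eta>" and z: "\<And>x. norm x \<ge> 1/2 \<Longrightarrow> \<eta> x = 0"
  shows "pd ds \<eta> x = 0 \<or> norm x \<le> 1/2" "\<exists>C\<ge>0. \<forall>x. \<bar>pd ds \<eta> x\<bar> \<le> C"
proof -
  have out: "pd ds \<eta> x = 0" if "norm x > 1/2" for x
    by (rule pd_eq_0[of "- cball 0 (1/2)"]) (use that z in auto)
  then show "pd ds \<eta> x = 0 \<or> norm x \<le> 1/2" by force
  have "continuous_on (cball 0 1) (pd ds \<eta>)"
    using Ck_on_pd_continuous[OF ck order_refl] continuous_on_subset by blast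
  then have "bounded (pd ds \<eta> ` cball 0 1)"
    by (intro compact_imp_bounded compact_continuous_image) auto
  then obtain C where "\<forall>y\<in>pd ds \<eta> ` cball 0 1. \<bar>y\<bar> \<le> C" unfolding bounded_iff real_norm_def by blast
  then have C: "\<bar>pd ds \<eta> x\<bar> \<le> C" if "x \<in> cball 0 1" for x using that by blast
  have "\<bar>pd ds \<eta> x\<bar> \<le> max C 0" for x
    using C[of x] out[of x] by (cases "norm x \<le> 1") (auto simp: le_max_iff_disj)
  then show "\<exists>C\<ge>0. \<forall>x. \<bar>pd ds \<eta> x\<bar> \<le> C" by (intro exI[of _ "max C 0"]) auto
qed

text \<open>Bump \<open>j\<close> lives within \<open>\<delta> j / 2\<close> of \<open>X j\<close>,
  hence off \<Sigma>, and is the prescribed affine function within \<open>\<delta> j / 4\<close>. A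
  derivative of order \<open>m\<close> has size at most a constant times
  \<open>\<delta>^(j - m)\<close>, summable for each fixed \<open>m\<close>. The condition linking
  \<open>X (Suc j)\<close> to \<open>\<delta> j\<close> keeps every inner ball free of the other
  bumps.\<close>

lemma flat_bumps:
  fixes X :: "nat \<Rightarrow> real^'n::finite" and \<Sigma> :: "(real^'n) set"
  assumes \<Sigma>: "0 \<in> \<Sigma>" and \<delta>_def: "\<And>j. \<delta> j = infdist (X j) \<Sigma>" and \<delta>: "\<And>j. \<delta> j > 0"
    and X: "\<And>j. norm (X j) \<le> (1/2) ^ j" and XS: "\<And>j. norm (X (Suc j)) < \<delta> j / 4"
    and a: "\<And>j. \<bar>a j\<bar> \<le> \<delta> j ^ j" and b: "\<And>j. \<bar>b j\<bar> \<le> \<delta> j ^ j"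
  obtains u where "flat_on \<Sigma> u" "\<And>k. Ck_on k UNIV u"
    "\<And>j x. dist x (X j) \<le> \<delta> j / 4 \<Longrightarrow> u x = a j + b j * (x $ i - X j $ i)"
proof -
  obtain \<omega> :: "real^'n \<Rightarrow> real" where \<omega>: "\<And>k. Ck_on k UNIV \<omega>"
    "\<And>x. norm x \<le> 1/4 \<Longrightarrow> \<omega> x = 1" "\<And>x. norm x \<ge> 1/2 \<Longrightarrow> \<omega> x = 0"
    by (rule smooth_bump_exists) (rule that)
  \<comment> \<open>A cut-off coordinate function: rescaled to \<open>X j\<close> and multiplied by
    \<open>b j * \<delta> j\<close> it becomes the linear term on the inner ball.\<close>
  define \<omega>i where "\<omega>i x = \<omega> x * x $ i" for x
  have \<omega>i: "\<And>k. Ck_on k UNIV \<omega>i" "\<And>x. norm x \<ge> 1/2 \<Longrightarrow> \<omega>i x = 0"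
    unfolding \<omega>i_def using \<omega> by (auto intro!: Ck_on_mult Ck_on_component)
  have \<delta>X: "\<delta> j \<le> norm (X j)" for j using infdist_le[OF \<Sigma>, of "X j"] by (simp add: \<delta>_def)
  have \<delta>2: "\<delta> j \<le> (1/2) ^ j" for j using \<delta>X X order_trans by blast
  have \<delta>1: "\<delta> j \<le> 1" for j using order_trans[OF \<delta>2[of j], of 1] by (simp add: power_le_one)
  define sc where "sc j x = (1 / \<delta> j) *\<^sub>R (x - X j)" for j x
  have nsc: "norm (sc j x) = dist x (X j) / \<delta> j" for j x
    using \<delta>[of j] by (simp add: sc_def dist_norm)
  define T where "T j x = a j * \<omega> (sc j x) + (b j * \<delta> j) * \<omega>i (sc j x)" for j x
  have T0: "T j x = 0" if "dist x (X j) \<ge> \<delta> j / 2" for j x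
  proof -
    have "norm (sc j x) \<ge> 1/2" using that \<delta>[of j] by (simp add: nsc field_simps)
    then show ?thesis by (simp add: T_def \<omega>(3) \<omega>i(2))
  qed
  have csc: "Ck_on k UNIV (\<lambda>x. \<omega> (sc j x))" "Ck_on k UNIV (\<lambda>x. \<omega>i (sc j x))" for j k
    unfolding sc_def by (intro Ck_on_affine \<omega> \<omega>i)+
  have CT: "Ck_on k UNIV (T j)" for j k
    unfolding T_def by (intro Ck_on_add Ck_on_cmult csc open_UNIV)
  have pdT: "pd ds (T j) x = (1 / \<delta> j) ^ length ds * (a j * pd ds \<omega> (sc j x) + b j * \<delta> j * pd ds \<omega>i (sc j x))" for ds j x
  proof -
    have "pd ds (T j) x = a j * pd ds (\<lambda>x. \<omega> (sc j x)) x + (b j * \<delta> j) * pd ds (\<lambda>x. \<omega>i (sc j x)) x"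
      unfolding T_def
      by (subst pd_add[OF open_UNIV UNIV_I]) (auto intro!: Ck_on_cmult csc simp: pd_cmult[OF open_UNIV UNIV_I csc(1)] pd_cmult[OF open_UNIV UNIV_I csc(2)])
    then show ?thesis
      unfolding sc_def pd_affine[OF \<omega>(1)] pd_affine[OF \<omega>i(1)] by (simp only: distrib_left mult_ac)
  qed
  have pdT0: "pd ds (T j) x = 0" if "dist x (X j) > \<delta> j / 2" for ds j x
  proof -
    have "norm (sc j x) > 1/2" using that \<delta>[of j] by (simp add: nsc field_simps)
    then show ?thesis
      using pd_bounded_of_compact_support(1)[OF \<omega>(1,3), of ds "sc j x"]
        pd_bounded_of_compact_support(1)[OF \<omega>i, of ds "sc j x"] by (simp add: pdT)
  qed
  have bT: "\<exists>C\<ge>0. \<forall>j x. \<bar>pd ds (T j) x\<bar> \<le> C * (\<delta> j ^ j / \<delta> j ^ length ds)" for ds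
  proof -
    obtain C0 where C0: "C0 \<ge> 0" "\<And>x. \<bar>pd ds \<omega> x\<bar> \<le> C0"
      using pd_bounded_of_compact_support(2)[OF \<omega>(1,3)] by blast
    obtain C1 where C1: "C1 \<ge> 0" "\<And>x. \<bar>pd ds \<omega>i x\<bar> \<le> C1"
      using pd_bounded_of_compact_support(2)[OF \<omega>i] by blast
    have "\<bar>pd ds (T j) x\<bar> \<le> (C0 + C1) * (\<delta> j ^ j / \<delta> j ^ length ds)" for j x
    proof -
      have "\<bar>a j * pd ds \<omega> (sc j x)\<bar> \<le> \<delta> j ^ j * C0"
        unfolding abs_mult using a C0 \<delta>[of j] by (intro mult_mono) auto
      moreover have "\<bar>b j * \<delta> j * pd ds \<omega>i (sc j x)\<bar> \<le> \<delta> j ^ j * 1 * C1"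
        unfolding abs_mult using b C1 \<delta>[of j] \<delta>1[of j] by (intro mult_mono) auto
      ultimately have "\<bar>a j * pd ds \<omega> (sc j x) + b j * \<delta> j * pd ds \<omega>i (sc j x)\<bar> \<le> (C0 + C1) * \<delta> j ^ j"
        by (simp add: algebra_simps)
      then have "\<bar>(1 / \<delta> j) ^ length ds\<bar> * \<bar>a j * pd ds \<omega> (sc j x) + b j * \<delta> j * pd ds \<omega>i (sc j x)\<bar> \<le>
          \<bar>(1 / \<delta> j) ^ length ds\<bar> * ((C0 + C1) * \<delta> j ^ j)"
        by (intro mult_left_mono) auto
      then show ?thesis using \<delta>[of j] by (simp add: pdT abs_mult power_divide)
    qed
    then show ?thesis using C0 C1 by (intro exI[of _ "C0 + C1"]) auto
  qed
  define u where "u x = (\<Sum>j. T j x)" for x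
  \<comment> \<open>The centres tend to 0, so away from the origin only finitely many bumps are
    seen. The origin itself is the one point that needs gluing.\<close>
  have loc: "\<exists>G M. open G \<and> x \<in> G \<and> (\<forall>y\<in>G. u y = (\<Sum>j<M. T j y))" if "x \<noteq> 0" for x
  proof -
    have "norm x / 4 > 0" using that by simp
    then obtain M where M: "(1/2) ^ M < norm x / 4" using real_arch_pow_inv[of "norm x / 4" "1/2"] by auto
    have "u y = (\<Sum>j<M. T j y)" if y: "norm y > norm x / 2" for y
      unfolding u_def
    proof (rule suminf_finite)
      fix j assume "j \<notin> {..<M}"
      then have "(1/2) ^ j \<le> (1/2::real) ^ M" by (intro power_decreasing) auto
      then have nj: "norm (X j) < norm x / 4" using M X[of j] by linarith
      show "T j y = 0"
      proof (rule T0)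
        have "dist y (X j) \<ge> norm y - norm (X j)" by (simp add: dist_norm norm_triangle_ineq2)
        then show "dist y (X j) \<ge> \<delta> j / 2" using nj y \<delta>X[of j] norm_ge_zero[of x] by linarith
      qed
    qed auto
    then show ?thesis using that
      by (intro exI[of _ "- cball 0 (norm x / 2)"] exI[of _ M]) auto
  qed
  have pdu: "\<exists>M. pd ds u x = (\<Sum>j<M. pd ds (T j) x)" if x0: "x \<noteq> 0" for x ds
  proof -
    obtain G M where G: "open G" "x \<in> G" "\<And>y. y \<in> G \<Longrightarrow> u y = (\<Sum>j<M. T j y)" using loc[OF x0] by blast
    have "pd ds u x = pd ds (\<lambda>y. \<Sum>j<M. T j y) x" by (rule pd_cong[OF G])
    also have "\<dots> = (\<Sum>j<M. pd ds (T j) x)" by (rule pd_sum[OF open_UNIV UNIV_I CT])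
    finally show ?thesis by blast
  qed
  have C\<^sub>0: "Ck_on k (UNIV - {0}) u" for k
    unfolding Ck_on_def
  proof (intro conjI allI impI ballI)
    have CG: "Ck_on k G u" if "open G" "\<forall>y\<in>G. u y = (\<Sum>j<M. T j y)" for G M k
    proof -
      have "Ck_on k UNIV (\<lambda>y. \<Sum>j<M. T j y)" by (intro Ck_on_sum CT open_UNIV)
      then have "Ck_on k G (\<lambda>y. \<Sum>j<M. T j y)" by (rule Ck_on_subset) simp
      then show ?thesis using Ck_on_cong[OF that(1), of u "\<lambda>y. \<Sum>j<M. T j y" k] that(2) by simp
    qed
    fix ds :: "'n list"
    have "isCont (pd ds u) x" if x0: "x \<noteq> 0" for x
    proof -
      obtain G M where G: "open G" "x \<in> G" "\<forall>y\<in>G. u y = (\<Sum>j<M. T j y)" using loc[OF x0] by blast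
      then show ?thesis
        using Ck_on_pd_continuous[OF CG[OF G(1,3)] order_refl] continuous_on_eq_continuous_at by blast
    qed
    then show "continuous_on (UNIV - {0}) (pd ds u)" by (simp add: continuous_at_imp_continuous_on)
    fix l x assume "x \<in> UNIV - {0::real^'n}"
    then obtain G M where G: "open G" "x \<in> G" "\<forall>y\<in>G. u y = (\<Sum>j<M. T j y)" using loc by blast
    show "line_diff l (pd ds u) x"
      using CG[OF G(1,3), of "Suc (length ds)"] G(2) by (auto simp: Ck_on_def)
  qed
  have bu: "\<exists>C. \<forall>x\<in>UNIV - {0}. \<bar>pd ds u x\<bar> \<le> C * (infdist x {0})\<^sup>2" for ds
  proof -
    obtain C where C: "C \<ge> 0" "\<And>j x. \<bar>pd ds (T j) x\<bar> \<le> C * (\<delta> j ^ j / \<delta> j ^ length ds)" using bT by blast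
    \<comment> \<open>The two extra powers of \<open>\<delta> j\<close> pay for the squared distance
      to the origin: on the support of bump \<open>j\<close> one has
      \<open>\<delta> j \<le> 2 * norm x\<close>, so
      \<open>1 \<le> 4 * (norm x)^2 / \<delta>^2\<close>. From index \<open>length ds + 3\<close>
      on, \<open>c j\<close> is at most \<open>\<delta> j \<le> 2^(-j)\<close>.\<close>
    define c where "c j = \<delta> j ^ j / \<delta> j ^ (length ds + 2)" for j
    have c0: "c j \<ge> 0" for j using \<delta>[of j] by (simp add: c_def)
    define m where "m = length ds + 3"
    have cj: "c j \<le> (if j < m then c j else 0) + (1/2) ^ j" for j
    proof (cases "j < m")
      case False
      then have "c j = \<delta> j ^ (j - (length ds + 2))" unfolding c_def m_def using \<delta>[of j]
        by (subst power_diff) auto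
      also have "\<dots> \<le> \<delta> j ^ 1" using False \<delta>[of j] \<delta>1[of j] by (intro power_decreasing) (auto simp: m_def)
      finally show ?thesis using False \<delta>2[of j] by simp
    qed auto
    have Ksum: "(\<Sum>j<M. c j) \<le> (\<Sum>j<m. c j) + 2" for M
    proof -
      have "(\<Sum>j<M. c j) \<le> (\<Sum>j<M. (if j < m then c j else 0) + (1/2) ^ j)" by (rule sum_mono[OF cj])
      also have "\<dots> = (\<Sum>j<M. if j < m then c j else 0) + (\<Sum>j<M. (1/2) ^ j)" by (rule sum.distrib)
      also have "(\<Sum>j<M. if j < m then c j else 0) \<le> (\<Sum>j<m. c j)"
      proof -
        have "(\<Sum>j<M. if j < m then c j else 0) = (\<Sum>j\<in>{..<M} \<inter> {..<m}. c j)"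
          by (simp add: sum.inter_restrict)
        also have "\<dots> \<le> (\<Sum>j<m. c j)" by (intro sum_mono2) (auto simp: c0)
        finally show ?thesis .
      qed
      also have "(\<Sum>j<M. (1/2) ^ j) \<le> (2::real)" by (simp add: sum_gp_strict)
      finally show ?thesis by simp
    qed
    have "\<bar>pd ds u x\<bar> \<le> (C * 4 * ((\<Sum>j<m. c j) + 2)) * (infdist x {0})\<^sup>2" if "x \<noteq> 0" for x
    proof -
      obtain M where M: "pd ds u x = (\<Sum>j<M. pd ds (T j) x)" using pdu[OF \<open>x \<noteq> 0\<close>] by blast
      have summand: "\<bar>pd ds (T j) x\<bar> \<le> C * 4 * (norm x)\<^sup>2 * c j" for j
      proof (cases "dist x (X j) > \<delta> j / 2")
        case True
        then show ?thesis using C(1) c0[of j] by (simp add: pdT0)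
      next
        case False
        have "norm (X j) \<le> norm x + dist x (X j)" by (metis dist_norm norm_triangle_sub norm_minus_commute)
        then have "\<delta> j \<le> 2 * norm x" using False \<delta>X[of j] by linarith
        then have "(\<delta> j)\<^sup>2 \<le> (2 * norm x)\<^sup>2" using \<delta>[of j] by (intro power_mono) auto
        then have "1 \<le> 4 * (norm x)\<^sup>2 / (\<delta> j)\<^sup>2" using \<delta>[of j] by (simp add: field_simps power2_eq_square)
        then have "C * (\<delta> j ^ j / \<delta> j ^ length ds) * 1 \<le> C * (\<delta> j ^ j / \<delta> j ^ length ds) * (4 * (norm x)\<^sup>2 / (\<delta> j)\<^sup>2)"
          using C(1) \<delta>[of j] by (intro mult_left_mono) auto
        also have "\<dots> = C * 4 * (norm x)\<^sup>2 * c j" by (simp add: c_def power_add power2_eq_square field_simps)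
        finally show ?thesis using C(2)[of j x] by linarith
      qed
      have "\<bar>pd ds u x\<bar> \<le> (\<Sum>j<M. \<bar>pd ds (T j) x\<bar>)" unfolding M by (rule sum_abs)
      also have "\<dots> \<le> (\<Sum>j<M. C * 4 * (norm x)\<^sup>2 * c j)" by (rule sum_mono[OF summand])
      also have "\<dots> = C * 4 * (norm x)\<^sup>2 * (\<Sum>j<M. c j)" by (simp add: sum_distrib_left)
      also have "\<dots> \<le> C * 4 * (norm x)\<^sup>2 * ((\<Sum>j<m. c j) + 2)"
        using C(1) by (intro mult_left_mono Ksum) auto
      finally show ?thesis by (simp add: algebra_simps)
    qed
    then show ?thesis by blast
  qed
  have T\<Sigma>: "T j x = 0" "pd ds (T j) x = 0" if "x \<in> \<Sigma>" for j x ds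
  proof -
    have "\<delta> j \<le> dist x (X j)" using infdist_le[OF that, of "X j"] by (simp add: \<delta>_def dist_commute)
    then have "dist x (X j) > \<delta> j / 2" using \<delta>[of j] by linarith
    then show "T j x = 0" "pd ds (T j) x = 0" using T0[of j x] pdT0[of j x ds] by auto
  qed
  have u0: "u 0 = 0" unfolding u_def using T\<Sigma>(1)[OF \<Sigma>] by simp
  have gl: "Ck_on k UNIV u \<and> (\<forall>x\<in>{0} \<inter> UNIV. \<forall>ds. length ds \<le> k \<longrightarrow> pd ds u x = 0)" for k
    by (rule glue_zero[OF open_UNIV closed_singleton _ C\<^sub>0 bu]) (use u0 in auto)
  show thesis
  proof
    show ck: "Ck_on k UNIV u" for k using gl by blast
    have "pd ds u x = 0" if "x \<in> \<Sigma>" for x ds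
    proof (cases "x = 0")
      case True
      then show ?thesis using gl[of "length ds"] by simp
    next
      case False
      then show ?thesis using pdu[OF False, of ds] T\<Sigma>(2)[OF that] by auto
    qed
    then show "flat_on \<Sigma> u"
      unfolding flat_on_def smooth_germ_def smooth_on_def using ck
      by (intro conjI exI[of _ UNIV]) auto
    \<comment> \<open>The spacing condition iterated: all later centres, not only the next, lie
      closer to the origin than \<open>\<delta> j / 4\<close>.\<close>
    have Xl: "norm (X l) < \<delta> j / 4" if "j < l" for j l
      using that
    proof (induction l)
      case (Suc l)
      show ?case
      proof (cases "j = l")
        case True
        then show ?thesis using XS by simp
      next
        case False
        then have "norm (X l) < \<delta> j / 4" using Suc by simp
        then show ?thesis using XS[of l] \<delta>X[of l] \<delta>[of j] by linarith
      qed
    qed simp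
    fix j x assume xj: "dist x (X j) \<le> \<delta> j / 4"
    have nx: "norm x \<le> norm (X j) + \<delta> j / 4" "norm (X j) - \<delta> j / 4 \<le> norm x"
      using xj norm_triangle_sub[of x "X j"] norm_triangle_sub[of "X j" x] by (auto simp: dist_norm norm_minus_commute)
    have "T l x = 0" if "l \<noteq> j" for l
    proof (rule T0, rule ccontr)
      assume "\<not> \<delta> l / 2 \<le> dist x (X l)"
      then have nl: "norm x < norm (X l) + \<delta> l / 2" "norm (X l) - \<delta> l / 2 < norm x"
        using norm_triangle_sub[of x "X l"] norm_triangle_sub[of "X l" x] by (auto simp: dist_norm norm_minus_commute)
      show False
      proof (cases "j < l")
        case True
        then show False using Xl[OF True] nl nx \<delta>X[of l] \<delta>X[of j] \<delta>[of j] by linarith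
      next
        case False
        then have "l < j" using that by simp
        then show False using Xl[OF \<open>l < j\<close>] nl nx \<delta>X[of l] \<delta>X[of j] \<delta>[of j] by linarith
      qed
    qed
    then have "u x = (\<Sum>l\<in>{j}. T l x)" unfolding u_def by (intro suminf_finite) auto
    also have "\<dots> = a j + b j * (x $ i - X j $ i)"
    proof -
      have "norm (sc j x) \<le> 1/4" using xj \<delta>[of j] by (simp add: nsc field_simps)
      then show ?thesis using \<delta>[of j] by (simp add: T_def \<omega>i_def \<omega>(2)) (simp add: sc_def)
    qed
    finally show "u x = a j + b j * (x $ i - X j $ i)" .
  qed
qed

text \<open>Dependent choice: each point is picked after its predecessor, so that its norm can be
  compared with the distance of the predecessor to \<Sigma>. This provides the spacing required by
  \<open>flat_bumps\<close>.\<close>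

lemma fast_sequence:
  fixes \<Sigma> :: "(real^'n::finite) set"
  assumes "\<And>j e. e > 0 \<Longrightarrow> \<exists>x. norm x < e \<and> 0 < infdist x \<Sigma> \<and> P j x"
  obtains X where "\<And>j::nat. P j (X j)" "\<And>j. 0 < infdist (X j) \<Sigma>" "\<And>j. norm (X j) \<le> (1/2) ^ j"
    "\<And>j. norm (X (Suc j)) < infdist (X j) \<Sigma> / 4"
proof -
  have "\<exists>X. \<forall>j. (P j (X j) \<and> 0 < infdist (X j) \<Sigma> \<and> norm (X j) \<le> (1/2) ^ j) \<and>
      norm (X (Suc j)) < infdist (X j) \<Sigma> / 4"
  proof (rule dependent_nat_choice)
    show "\<exists>x. P 0 x \<and> 0 < infdist x \<Sigma> \<and> norm x \<le> (1/2) ^ 0"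
      using assms[of 1 0] by auto
    fix x n assume "P n x \<and> 0 < infdist x \<Sigma> \<and> norm x \<le> (1/2) ^ n"
    then have "min ((1/2) ^ Suc n) (infdist x \<Sigma> / 4) > 0" by auto
    from assms[OF this, of "Suc n"]
    show "\<exists>y. (P (Suc n) y \<and> 0 < infdist y \<Sigma> \<and> norm y \<le> (1/2) ^ Suc n) \<and> norm y < infdist x \<Sigma> / 4"
      by auto
  qed
  then show thesis using that by blast
qed

section \<open>Lojasiewicz inequalities and division\<close>

text \<open>The common form to which the conditions are reduced. For smooth germs a change of finite
  generating set alters the right-hand side only by constants, so this is a property of the
  ideal.\<close>

definition lojasiewicz :: "(real^'n::finite) set \<Rightarrow> (real^'n \<Rightarrow> real) set \<Rightarrow> bool" where
  "lojasiewicz \<Sigma> G \<longleftrightarrow> (\<exists>C>0. \<exists>N::nat. \<forall>\<^sub>F x in nhds 0. C * infdist x \<Sigma> ^ N \<le> (\<Sum>g\<in>G. \<bar>g x\<bar>))"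

lemma infdist_small:
  fixes \<Sigma> :: "(real^'n::finite) set"
  assumes "0 \<in> \<Sigma>" "e > 0" shows "\<forall>\<^sub>F x in nhds 0. infdist x \<Sigma> < e"
  unfolding eventually_nhds_metric
  using assms infdist_le[OF assms(1)] by (intro exI[of _ e]) (auto intro: le_less_trans)

lemma lojasiewiczE:
  assumes "0 \<in> \<Sigma>" "lojasiewicz \<Sigma> G"
  obtains C N where "C > 0" "N \<ge> 1" "\<forall>\<^sub>F x in nhds 0. C * infdist x \<Sigma> ^ N \<le> (\<Sum>g\<in>G. \<bar>g x\<bar>)"
proof -
  obtain C N where C: "C > 0" and ev: "\<forall>\<^sub>F x in nhds 0. C * infdist x \<Sigma> ^ N \<le> (\<Sum>g\<in>G. \<bar>g x\<bar>)"
    using assms(2) unfolding lojasiewicz_def by blast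
  have "\<forall>\<^sub>F x in nhds 0. C * infdist x \<Sigma> ^ Suc N \<le> (\<Sum>g\<in>G. \<bar>g x\<bar>)"
    using ev infdist_small[OF assms(1) zero_less_one]
  proof eventually_elim
    case (elim x)
    have "infdist x \<Sigma> ^ Suc N \<le> infdist x \<Sigma> ^ N"
      using elim by (intro power_decreasing) (auto simp: infdist_nonneg)
    then have "C * infdist x \<Sigma> ^ Suc N \<le> C * infdist x \<Sigma> ^ N" using C by (intro mult_left_mono) auto
    then show ?case using elim by linarith
  qed
  then show thesis using that[OF C, of "Suc N"] by simp
qed

text \<open>The failure is tested with constant 1 and arbitrarily high exponents. A witness is
  automatically off the closure of \<Sigma>, since at distance 0 the inequality holds trivially for
  a positive exponent.\<close>

lemma not_lojasiewiczD:
  assumes "\<not> lojasiewicz \<Sigma> G" "e > 0"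
  shows "\<exists>x. norm x < e \<and> 0 < infdist x \<Sigma> \<and> (\<Sum>g\<in>G. \<bar>g x\<bar>) < infdist x \<Sigma> ^ Suc N"
proof -
  have "\<not> (\<forall>\<^sub>F x in nhds 0. 1 * infdist x \<Sigma> ^ Suc N \<le> (\<Sum>g\<in>G. \<bar>g x\<bar>))"
    using assms(1) zero_less_one unfolding lojasiewicz_def by blast
  then obtain x where x: "dist x 0 < e" "\<not> 1 * infdist x \<Sigma> ^ Suc N \<le> (\<Sum>g\<in>G. \<bar>g x\<bar>)"
    unfolding eventually_nhds_metric using assms(2) by blast
  have "infdist x \<Sigma> \<noteq> 0"
  proof
    assume "infdist x \<Sigma> = 0"
    then have "(\<Sum>g\<in>G. \<bar>g x\<bar>) < 0" using x(2) by simp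
    moreover have "0 \<le> (\<Sum>g\<in>G. \<bar>g x\<bar>)" by (rule sum_nonneg) simp
    ultimately show False by linarith
  qed
  then have "0 < infdist x \<Sigma>" using infdist_nonneg[of x \<Sigma>] by linarith
  then show ?thesis using x by (intro exI[of _ x]) auto
qed

lemma smooth_germs_common:
  assumes "finite G" "\<And>g. g \<in> G \<Longrightarrow> smooth_germ g"
  obtains R where "R > 0" "\<And>g k. g \<in> G \<Longrightarrow> Ck_on k (ball 0 R) g"
proof -
  have "\<exists>R>0. \<forall>g\<in>G. \<forall>k. Ck_on k (ball 0 R) g"
    using assms
  proof (induction G rule: finite_induct)
    case empty
    show ?case by (intro exI[of _ 1]) auto
  next
    case (insert g G)
    then obtain R where R: "R > 0" "\<forall>g\<in>G. \<forall>k. Ck_on k (ball 0 R) g" by auto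
    obtain U where U: "open U" "0 \<in> U" "\<And>k. Ck_on k U g"
      using insert.prems[of g] unfolding smooth_germ_def smooth_on_def by auto
    obtain S where S: "S > 0" "ball 0 S \<subseteq> U" using U open_contains_ball by blast
    have "Ck_on k (ball 0 (min R S)) g" for k
      by (rule Ck_on_subset[OF U(3)]) (use S in auto)
    moreover have "Ck_on k (ball 0 (min R S)) f" if "f \<in> G" for f k
      by (rule Ck_on_subset[of k "ball 0 R"]) (use R that in auto)
    ultimately show ?case using R(1) S(1) by (intro exI[of _ "min R S"]) auto
  qed
  then show thesis using that by blast
qed

lemma smooth_germI:
  assumes "R > 0" "\<And>k. Ck_on k (ball 0 R) f" shows "smooth_germ f"
  unfolding smooth_germ_def smooth_on_def using assms by (intro exI[of _ "ball 0 R"]) auto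

lemma Cr_germ_isCont:
  assumes "Cr_germ r f" shows "isCont f 0"
  using assms Ck_on_continuous continuous_on_eq_continuous_at unfolding Cr_germ_def by blast

lemma smooth_germ_Cr_germ: "smooth_germ f \<Longrightarrow> Cr_germ r f"
  unfolding smooth_germ_def smooth_on_def Cr_germ_def by blast

lemma in_ideal_bound:
  assumes id: "in_ideal P f G" and fin: "finite G" and P: "\<And>h. P h \<Longrightarrow> isCont h 0"
  shows "\<exists>B>0. \<forall>\<^sub>F x in nhds 0. \<bar>f x\<bar> \<le> B * (\<Sum>g\<in>G. \<bar>g x\<bar>)"
proof -
  obtain h where h: "\<And>g. g \<in> G \<Longrightarrow> P (h g)" "\<forall>\<^sub>F x in nhds 0. f x = (\<Sum>g\<in>G. h g x * g x)"
    using id unfolding in_ideal_def by blast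
  define B where "B = (\<Sum>g\<in>G. \<bar>h g 0\<bar>) + 1"
  have B: "B > 0" unfolding B_def by (intro add_nonneg_pos sum_nonneg) auto
  have "\<forall>\<^sub>F x in nhds 0. \<forall>g\<in>G. \<bar>h g x\<bar> < B"
  proof (intro eventually_ball_finite fin ballI)
    fix g assume g: "g \<in> G"
    have "((\<lambda>x. \<bar>h g x\<bar>) \<longlongrightarrow> \<bar>h g 0\<bar>) (nhds 0)"
      using P[OF h(1)[OF g]] by (intro tendsto_rabs) (simp add: isCont_def tendsto_at_iff_tendsto_nhds)
    moreover have "\<bar>h g 0\<bar> \<le> (\<Sum>g\<in>G. \<bar>h g 0\<bar>)" using fin g by (intro member_le_sum) auto
    ultimately show "\<forall>\<^sub>F x in nhds 0. \<bar>h g x\<bar> < B" by (intro order_tendstoD) (auto simp: B_def)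
  qed
  with h(2) have "\<forall>\<^sub>F x in nhds 0. \<bar>f x\<bar> \<le> B * (\<Sum>g\<in>G. \<bar>g x\<bar>)"
  proof eventually_elim
    case (elim x)
    have "\<bar>f x\<bar> \<le> (\<Sum>g\<in>G. \<bar>h g x * g x\<bar>)" unfolding elim(1) by (rule sum_abs)
    also have "\<dots> \<le> (\<Sum>g\<in>G. B * \<bar>g x\<bar>)"
    proof (rule sum_mono)
      fix g assume "g \<in> G"
      then have "\<bar>h g x\<bar> \<le> B" using elim(2) by (simp add: less_imp_le)
      then show "\<bar>h g x * g x\<bar> \<le> B * \<bar>g x\<bar>" unfolding abs_mult by (rule mult_right_mono) simp
    qed
    finally show ?case by (simp add: sum_distrib_left)
  qed
  then show ?thesis using B by blast
qed

text \<open>An element of the ideal is bounded by the generators, which gives one direction after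
  rounding the exponent up. Conversely the sum of squares of the generators is elliptic with twice
  the exponent, by Cauchy-Schwarz; \<open>card G + 1\<close> avoids division by zero.\<close>

lemma elliptic_iff_lojasiewicz:
  assumes fin: "finite G" and sm: "\<And>g. g \<in> G \<Longrightarrow> smooth_germ g" and \<Sigma>: "0 \<in> \<Sigma>"
  shows "elliptic \<Sigma> G \<longleftrightarrow> lojasiewicz \<Sigma> G"
proof
  assume "elliptic \<Sigma> G"
  then obtain f C \<alpha> where f: "in_ideal smooth_germ f G" "C > 0" "\<alpha> > 0"
    "\<forall>\<^sub>F x in nhds 0. \<bar>f x\<bar> \<ge> C * infdist x \<Sigma> powr \<alpha>"
    unfolding elliptic_def by blast
  obtain B where B: "B > 0" "\<forall>\<^sub>F x in nhds 0. \<bar>f x\<bar> \<le> B * (\<Sum>g\<in>G. \<bar>g x\<bar>)"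
    using in_ideal_bound[OF f(1) fin] smooth_germ_Cr_germ Cr_germ_isCont by blast
  define N where "N = nat \<lceil>\<alpha>\<rceil>"
  have N: "\<alpha> \<le> real N" "N \<ge> 1" using f(3) by (auto simp: N_def le_nat_iff)
  have "\<forall>\<^sub>F x in nhds 0. C / B * infdist x \<Sigma> ^ N \<le> (\<Sum>g\<in>G. \<bar>g x\<bar>)"
    using f(4) B(2) infdist_small[OF \<Sigma> zero_less_one]
  proof eventually_elim
    case (elim x)
    have "infdist x \<Sigma> ^ N \<le> infdist x \<Sigma> powr \<alpha>"
    proof (cases "infdist x \<Sigma> = 0")
      case False
      then have "infdist x \<Sigma> > 0" using infdist_nonneg[of x \<Sigma>] by linarith
      then show ?thesis using N(1) elim(3) by (simp add: powr_realpow[symmetric] powr_mono')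
    qed (use N in \<open>simp add: power_0_left\<close>)
    then have "C * infdist x \<Sigma> ^ N \<le> C * infdist x \<Sigma> powr \<alpha>" using f(2) by (intro mult_left_mono) auto
    then have "C * infdist x \<Sigma> ^ N \<le> B * (\<Sum>g\<in>G. \<bar>g x\<bar>)" using elim by linarith
    then show ?case using B(1) by (simp add: field_simps)
  qed
  then show "lojasiewicz \<Sigma> G" unfolding lojasiewicz_def using f(2) B(1) by (meson divide_pos_pos)
next
  assume lj: "lojasiewicz \<Sigma> G"
  obtain C N where C: "C > 0" "N \<ge> 1" and ev: "\<forall>\<^sub>F x in nhds 0. C * infdist x \<Sigma> ^ N \<le> (\<Sum>g\<in>G. \<bar>g x\<bar>)"
    by (rule lojasiewiczE[OF \<Sigma> lj]) (rule that)
  obtain R where R: "R > 0" "\<And>g k. g \<in> G \<Longrightarrow> Ck_on k (ball 0 R) g"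
    by (rule smooth_germs_common[OF fin sm]) (assumption | rule that)+
  define f where "f x = (\<Sum>g\<in>G. g x * g x)" for x
  have "smooth_germ f"
    by (rule smooth_germI[OF R(1)]) (unfold f_def, intro Ck_on_sum Ck_on_mult R(2) open_ball)
  moreover have "in_ideal smooth_germ f G"
    unfolding in_ideal_def f_def using sm by (intro exI[of _ "\<lambda>g. g"]) auto
  moreover have "\<forall>\<^sub>F x in nhds 0. \<bar>f x\<bar> \<ge> (C\<^sup>2 / (real (card G) + 1)) * infdist x \<Sigma> powr (real (2 * N))"
    using ev
  proof eventually_elim
    case (elim x)
    \<comment> \<open>At distance 0 both sides vanish only because \<open>N\<close> is at least 1;
      this case is separate because \<open>powr_realpow\<close> asks for a positive base.\<close>
    have pw: "infdist x \<Sigma> powr (real (2 * N)) = (infdist x \<Sigma> ^ N)\<^sup>2"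
    proof (cases "infdist x \<Sigma> = 0")
      case False
      then have "infdist x \<Sigma> > 0" using infdist_nonneg[of x \<Sigma>] by linarith
      then show ?thesis by (simp only: powr_realpow power_mult[symmetric] mult.commute)
    qed (use C(2) in simp)
    have "(C * infdist x \<Sigma> ^ N)\<^sup>2 \<le> (\<Sum>g\<in>G. \<bar>g x\<bar>)\<^sup>2"
      using elim C by (intro power_mono) (auto simp: infdist_nonneg)
    also have "\<dots> \<le> (\<Sum>g\<in>G. \<bar>g x\<bar>\<^sup>2) * real (card G)" by (rule sum_squared_le_sum_of_squares)
    also have "(\<Sum>g\<in>G. \<bar>g x\<bar>\<^sup>2) = f x" by (simp add: f_def power2_eq_square)
    also have "f x * real (card G) \<le> f x * (real (card G) + 1)"
      by (intro mult_left_mono) (auto simp: f_def sum_nonneg)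
    finally have "C\<^sup>2 * (infdist x \<Sigma> ^ N)\<^sup>2 \<le> f x * (real (card G) + 1)" by (simp add: power_mult_distrib)
    then have "(C\<^sup>2 / (real (card G) + 1)) * (infdist x \<Sigma> ^ N)\<^sup>2 \<le> f x"
      by (simp add: pos_divide_le_eq)
    then show ?case unfolding pw by linarith
  qed
  moreover have "C\<^sup>2 / (real (card G) + 1) > 0" using C by (intro divide_pos_pos) auto
  moreover have "real (2 * N) > 0" using C by simp
  ultimately show "elliptic \<Sigma> G" unfolding elliptic_def
    by (intro exI[of _ f] conjI exI[of _ "C\<^sup>2 / (real (card G) + 1)"] exI[of _ "real (2 * N)"])
qed

section \<open>Order of vanishing along a closed set and division by a sum of squares\<close>

lemma pd_append: "pd (ds @ es) f = pd ds (pd es f)"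
  by (induction ds) auto

lemma Ck_on_pd: "Ck_on (k + length es) U f \<Longrightarrow> Ck_on k U (pd es f)"
  unfolding Ck_on_def by (auto simp: pd_append[symmetric])

lemma pd_bounded_on_cball:
  fixes f :: "real^'n::finite \<Rightarrow> real"
  assumes "Ck_on (length ds) (ball 0 R) f" "S < R"
  shows "\<exists>C\<ge>0. \<forall>x\<in>cball 0 S. \<bar>pd ds f x\<bar> \<le> C"
proof -
  have "continuous_on (cball 0 S) (pd ds f)"
    by (rule continuous_on_subset[OF Ck_on_pd_continuous[OF assms(1) order_refl]]) (use assms in auto)
  then have "bounded (pd ds f ` cball 0 S)"
    by (intro compact_imp_bounded compact_continuous_image) auto
  then obtain C where "\<forall>y\<in>pd ds f ` cball 0 S. \<bar>y\<bar> \<le> C" unfolding bounded_iff real_norm_def by blast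
  then show ?thesis by (intro exI[of _ "max C 0"]) (auto simp: le_max_iff_disj)
qed

lemma bounded_lists_of_length:
  fixes f :: "'n::finite list \<Rightarrow> 'b \<Rightarrow> real"
  assumes "\<And>ds. length ds = k \<Longrightarrow> \<exists>C\<ge>0. \<forall>x\<in>S. \<bar>f ds x\<bar> \<le> C"
  shows "\<exists>C\<ge>0. \<forall>ds. length ds = k \<longrightarrow> (\<forall>x\<in>S. \<bar>f ds x\<bar> \<le> C)"
proof -
  let ?L = "{ds :: 'n list. set ds \<subseteq> UNIV \<and> length ds = k}"
  have "\<forall>ds\<in>?L. \<exists>C. C \<ge> 0 \<and> (\<forall>x\<in>S. \<bar>f ds x\<bar> \<le> C)" using assms by blast
  from bchoice[OF this] obtain C where C: "\<And>ds. ds \<in> ?L \<Longrightarrow> C ds \<ge> 0 \<and> (\<forall>x\<in>S. \<bar>f ds x\<bar> \<le> C ds)" by blast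
  have fin: "finite ?L" by (rule finite_lists_length_eq) simp
  have "\<bar>f ds x\<bar> \<le> sum C ?L" if "length ds = k" "x \<in> S" for ds x
  proof -
    have "C ds \<le> sum C ?L" using that C by (intro member_le_sum fin) auto
    then show ?thesis using C[of ds] that by fastforce
  qed
  moreover have "sum C ?L \<ge> 0" using C by (intro sum_nonneg) auto
  ultimately show ?thesis by blast
qed

text \<open>Taylor expansion at a nearest point \<open>p\<close> of \<Sigma>. As 0 lies in \<Sigma>,
  \<open>p\<close> has distance at most \<open>norm x\<close> from \<open>x\<close> and norm at most
  \<open>2 * norm x\<close>; the radius \<open>R/8\<close> thus keeps everything inside the ball of
  radius \<open>R/2\<close>, where the derivatives are bounded.\<close>

lemma jet_zero_order:
  fixes f :: "real^'n::finite \<Rightarrow> real"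
  assumes \<Sigma>: "closed \<Sigma>" "0 \<in> \<Sigma>" and R: "R > 0" and ck: "\<And>k. Ck_on k (ball 0 R) f"
    and jet: "\<And>x ds. x \<in> \<Sigma> \<Longrightarrow> x \<in> ball 0 R \<Longrightarrow> length ds \<le> k \<Longrightarrow> pd ds f x = 0" and len: "length es \<le> k"
  shows "\<exists>C\<ge>0. \<forall>x\<in>ball 0 (R/8). \<bar>pd es f x\<bar> \<le> C * infdist x \<Sigma> ^ (k + 1 - length es)"
proof -
  define l where "l = k - length es"
  have l: "Suc l = k + 1 - length es" using len by (simp add: l_def)
  have "\<exists>C\<ge>0. \<forall>ds. length ds = Suc l \<longrightarrow> (\<forall>x\<in>cball 0 (R/2). \<bar>pd ds (pd es f) x\<bar> \<le> C)"
    by (intro bounded_lists_of_length pd_bounded_on_cball[of _ R] Ck_on_pd ck) (use R in auto)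
  then obtain C where C: "C \<ge> 0" "\<And>ds x. length ds = Suc l \<Longrightarrow> x \<in> cball 0 (R/2) \<Longrightarrow> \<bar>pd ds (pd es f) x\<bar> \<le> C"
    by blast
  have "\<bar>pd es f x\<bar> \<le> (C * real CARD('n) ^ Suc l) * infdist x \<Sigma> ^ (k + 1 - length es)" if x: "x \<in> ball 0 (R/8)" for x
  proof -
    obtain p where p: "p \<in> \<Sigma>" "infdist x \<Sigma> = dist x p"
      using infdist_attains_inf[of \<Sigma> x] \<Sigma> by blast
    have "infdist x \<Sigma> \<le> norm x" using infdist_le[OF \<Sigma>(2), of x] by simp
    then have xp: "norm (x - p) \<le> norm x" using p by (simp add: dist_norm)
    then have np: "norm p \<le> 2 * norm x" using norm_triangle_sub[of p x] by (simp add: norm_minus_commute)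
    have "\<bar>pd es f x\<bar> \<le> C * real CARD('n) ^ Suc l * norm (x - p) ^ Suc l"
    proof (rule jet_bound[where R = "R/2"])
      show "Ck_on (Suc l) (ball 0 (R/2)) (pd es f)"
        by (rule Ck_on_subset[OF Ck_on_pd[OF ck]]) (use R in auto)
      show "\<bar>pd ds (pd es f) y\<bar> \<le> C" if "length ds = Suc l" "y \<in> ball 0 (R/2)" for ds y
        using C(2)[OF that(1), of y] that(2) by simp
      show "pd ds (pd es f) p = 0" if "length ds \<le> l" for ds
        using jet[OF p(1), of "ds @ es"] that len np x R by (simp add: pd_append l_def)
      have "norm x < R / 8" using x by simp
      then show "norm p + norm (x - p) < R / 2" using np xp R by linarith
    qed
    then show ?thesis using p(2) l by (simp add: dist_norm)
  qed
  moreover have "C * real CARD('n) ^ Suc l \<ge> 0" using C(1) by simp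
  ultimately show ?thesis by blast
qed

text \<open>Off \<open>\<Sigma>\<close> each derivative of \<open>f g / (\<Sum>g\<^sup>2)\<close> loses a fixed power of the distance to \<open>\<Sigma>\<close>,
  which the high order of vanishing of \<open>f\<close> compensates.\<close>

lemma division_Ck:
  fixes f :: "real^'n::finite \<Rightarrow> real"
  assumes \<Sigma>: "closed \<Sigma>" "0 \<in> \<Sigma>" and fin: "finite G" and R: "0 < R" "R \<le> 1"
    and G: "\<And>g k. g \<in> G \<Longrightarrow> Ck_on k (ball 0 R) g" and ck: "\<And>k. Ck_on k (ball 0 R) f"
    and C: "C > 0" "N \<ge> 1" "\<And>x. x \<in> ball 0 R \<Longrightarrow> C * infdist x \<Sigma> ^ N \<le> (\<Sum>g\<in>G. \<bar>g x\<bar>)"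
    and jet: "\<And>x ds. x \<in> \<Sigma> \<Longrightarrow> x \<in> ball 0 R \<Longrightarrow> length ds \<le> 2 * N * (r + 1) + 2 \<Longrightarrow> pd ds f x = 0"
    and g: "g \<in> G"
  shows "Ck_on r (ball 0 (R/8)) (\<lambda>x. if x \<in> \<Sigma> then 0 else f x * g x * inverse (\<Sum>g\<in>G. g x * g x))"
proof -
  \<comment> \<open>With \<open>L = 2 * N\<close> this reads \<open>k + 1 = L * r + L + 3\<close>:
    \<open>L\<close> for the inverse, \<open>L\<close> for each of \<open>r\<close> derivatives, and
    a surplus for the gluing.\<close>
  define k where "k = 2 * N * (r + 1) + 2"
  define A where "A = ball 0 (R/8) - \<Sigma>"
  define D where "D x = infdist x \<Sigma>" for x
  \<comment> \<open>The exponent in the lower bound of the sum of squares: squaring doubles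
    \<open>N\<close>.\<close>
  define L where "L = real (2 * N)"
  define Q where "Q x = (\<Sum>g\<in>G. g x * g x)" for x
  have L: "L \<ge> 1" "L \<ge> 0" using C(2) by (auto simp: L_def)
  have A: "open A" unfolding A_def using \<Sigma> by (intro open_Diff) auto
  have AR: "A \<subseteq> ball 0 R" "A \<subseteq> cball 0 (R/2)" unfolding A_def using R by auto
  have D: "0 < D x \<and> D x \<le> 1" if "x \<in> A" for x
  proof -
    have "infdist x \<Sigma> > 0" using that \<Sigma> by (intro infdist_pos_not_in_closed) (auto simp: A_def)
    moreover have "infdist x \<Sigma> \<le> norm x" using infdist_le[OF \<Sigma>(2), of x] by simp
    ultimately show ?thesis using that R by (auto simp: D_def A_def)
  qed
  have bounded: "weighted_bound A D 0 s 0 q" if q: "\<And>k. Ck_on k (ball 0 R) q" for s q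
    unfolding weighted_bound_def
  proof (intro allI impI)
    fix ds :: "'n list"
    obtain B where "\<forall>x\<in>cball 0 (R/2). \<bar>pd ds q x\<bar> \<le> B"
      using pd_bounded_on_cball[OF q, of "R/2" ds] R by auto
    then have "\<forall>x\<in>A. \<bar>pd ds q x\<bar> \<le> B * D x powr (0 - 0 * real (length ds))"
      using AR(2) D by (force simp: subset_iff)
    then show "\<exists>B. \<forall>x\<in>A. \<bar>pd ds q x\<bar> \<le> B * D x powr (0 - 0 * real (length ds))" by blast
  qed
  have CQ: "Ck_on k (ball 0 R) Q" for k
    unfolding Q_def by (intro Ck_on_sum Ck_on_mult G open_ball)
  have Qlow: "\<bar>Q x\<bar> \<ge> (C\<^sup>2 / (real (card G) + 1)) * D x powr L" if x: "x \<in> A" for x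
  proof -
    have pw: "D x powr L = (infdist x \<Sigma> ^ N)\<^sup>2"
      using D[OF x] unfolding L_def D_def by (simp only: powr_realpow power_mult[symmetric] mult.commute)
    have "(C * infdist x \<Sigma> ^ N)\<^sup>2 \<le> (\<Sum>g\<in>G. \<bar>g x\<bar>)\<^sup>2"
      using C(3)[of x] x AR C by (intro power_mono) (auto simp: infdist_nonneg)
    also have "\<dots> \<le> (\<Sum>g\<in>G. \<bar>g x\<bar>\<^sup>2) * real (card G)" by (rule sum_squared_le_sum_of_squares)
    also have "(\<Sum>g\<in>G. \<bar>g x\<bar>\<^sup>2) = Q x" by (simp add: Q_def power2_eq_square)
    also have "Q x * real (card G) \<le> Q x * (real (card G) + 1)"
      by (intro mult_left_mono) (auto simp: Q_def sum_nonneg)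
    finally have "C\<^sup>2 * (infdist x \<Sigma> ^ N)\<^sup>2 \<le> Q x * (real (card G) + 1)" by (simp add: power_mult_distrib)
    then have "(C\<^sup>2 / (real (card G) + 1)) * (infdist x \<Sigma> ^ N)\<^sup>2 \<le> Q x"
      by (simp add: pos_divide_le_eq)
    then show ?thesis unfolding pw by linarith
  qed
  have c: "C\<^sup>2 / (real (card G) + 1) > 0" using C by (intro divide_pos_pos) auto
  have nz: "Q x \<noteq> 0" if "x \<in> A" for x
  proof -
    have "0 < (C\<^sup>2 / (real (card G) + 1)) * D x powr L" using c D[OF that] by (intro mult_pos_pos) auto
    then show ?thesis using Qlow[OF that] by auto
  qed
  have CA: "Ck_on r A q" if "\<And>k. Ck_on k (ball 0 R) q" for q
    by (rule Ck_on_subset[OF that AR(1)])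
  have wi: "weighted_bound A D L r (- L) (\<lambda>x. inverse (Q x))"
    by (rule weighted_bound_inverse[OF A D L(2) CA[OF CQ] bounded[OF CQ] c Qlow])
  have ci: "Ck_on r A (\<lambda>x. inverse (Q x))" by (rule Ck_on_inverse[OF A CA[OF CQ] nz])
  have wg: "weighted_bound A D L r 0 g" by (rule weighted_bound_of_bounded[OF D L(2) bounded[OF G[OF g]]])
  have rk: "r \<le> k"
  proof -
    have "1 * (r + 1) \<le> 2 * N * (r + 1)" using C(2) by (intro mult_right_mono) auto
    then show ?thesis by (simp add: k_def)
  qed
  \<comment> \<open>A derivative of \<open>f\<close> loses just one order by Taylor's estimate. This
    fits into the uniform loss \<open>L\<close> because \<open>N \<ge> 1\<close> makes
    \<open>L\<close> at least 1.\<close>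
  have wf: "weighted_bound A D L r (real (k + 1)) f"
    unfolding weighted_bound_def
  proof (intro allI impI)
    fix ds :: "'n list" assume len: "length ds \<le> r"
    then have lk: "length ds \<le> k" using rk by simp
    obtain B where B: "B \<ge> 0" "\<forall>x\<in>ball 0 (R/8). \<bar>pd ds f x\<bar> \<le> B * infdist x \<Sigma> ^ (k + 1 - length ds)"
      using jet_zero_order[OF \<Sigma> R(1) ck jet[folded k_def] lk] by blast
    have "\<bar>pd ds f x\<bar> \<le> B * D x powr (real (k + 1) - L * real (length ds))" if x: "x \<in> A" for x
    proof -
      have "infdist x \<Sigma> ^ (k + 1 - length ds) = D x powr real (k + 1 - length ds)"
        using D[OF x] by (simp add: D_def powr_realpow)
      also have "\<dots> \<le> D x powr (real (k + 1) - L * real (length ds))"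
      proof (rule powr_mono')
        have "1 * real (length ds) \<le> L * real (length ds)" using L by (intro mult_right_mono) auto
        then show "real (k + 1) - L * real (length ds) \<le> real (k + 1 - length ds)" using lk by (simp add: of_nat_diff)
      qed (use D[OF x] in auto)
      finally have "B * infdist x \<Sigma> ^ (k + 1 - length ds) \<le> B * D x powr (real (k + 1) - L * real (length ds))"
        using B(1) by (intro mult_left_mono)
      moreover have "\<bar>pd ds f x\<bar> \<le> B * infdist x \<Sigma> ^ (k + 1 - length ds)" using B(2) x by (auto simp: A_def)
      ultimately show ?thesis by linarith
    qed
    then show "\<exists>B. \<forall>x\<in>A. \<bar>pd ds f x\<bar> \<le> B * D x powr (real (k + 1) - L * real (length ds))" by blast
  qed
  define h where "h x = (if x \<in> \<Sigma> then 0 else f x * g x * inverse (Q x))" for x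
  have hA: "h x = f x * g x * inverse (Q x)" if "x \<in> A" for x using that by (simp add: h_def A_def)
  have cfg: "Ck_on r A (\<lambda>x. f x * g x)" by (rule Ck_on_mult[OF A CA[OF ck] CA[OF G[OF g]]])
  have "weighted_bound A D L r (real (k + 1) + 0 + (- L)) (\<lambda>x. f x * g x * inverse (Q x))"
    by (rule weighted_bound_mult[OF A weighted_bound_mult[OF A wf CA[OF ck] wg CA[OF G[OF g]] D L(2)] cfg wi ci D L(2)])
  then have wh: "weighted_bound A D L r (real (k + 1) + 0 + (- L)) h"
    using weighted_bound_cong[OF A, of h "\<lambda>x. f x * g x * inverse (Q x)"] hA by simp
  have "Ck_on r A (\<lambda>x. f x * g x * inverse (Q x))" by (rule Ck_on_mult[OF A cfg ci])
  then have ch: "Ck_on r (ball 0 (R/8) - \<Sigma>) h"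
    using Ck_on_cong[OF A, of h "\<lambda>x. f x * g x * inverse (Q x)"] hA unfolding A_def by simp
  \<comment> \<open>After \<open>r\<close> derivatives the order left is at least
    \<open>k + 1 - L - L * r = 3\<close>, which covers the square of the distance asked for by
    \<open>glue_zero\<close>.\<close>
  have bh: "\<exists>B. \<forall>x\<in>ball 0 (R/8) - \<Sigma>. \<bar>pd ds h x\<bar> \<le> B * (infdist x \<Sigma>)\<^sup>2" if len: "length ds \<le> r" for ds
  proof -
    have "\<exists>B. \<forall>x\<in>A. \<bar>pd ds h x\<bar> \<le> B * D x powr (real (k + 1) + 0 + (- L) - L * real (length ds))"
      using wh len unfolding weighted_bound_def by blast
    from weighted_bound_nonneg_const[OF this] obtain B where B: "B \<ge> 0"
      "\<forall>x\<in>A. \<bar>pd ds h x\<bar> \<le> B * D x powr (real (k + 1) + 0 + (- L) - L * real (length ds))"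
      by (elim exE conjE) (rule that)
    have "\<bar>pd ds h x\<bar> \<le> B * (infdist x \<Sigma>)\<^sup>2" if x: "x \<in> A" for x
    proof -
      have "D x powr (real (k + 1) + 0 + (- L) - L * real (length ds)) \<le> D x powr (real 2)"
      proof (rule powr_mono')
        have "L * real (length ds) \<le> L * real r" using L len by (intro mult_left_mono) auto
        moreover have "real (k + 1) = L * real r + L + 3" by (simp add: k_def L_def algebra_simps)
        ultimately show "real 2 \<le> real (k + 1) + 0 + (- L) - L * real (length ds)" by simp
      qed (use D[OF x] in auto)
      also have "\<dots> = (infdist x \<Sigma>)\<^sup>2" using D[OF x] by (simp only: powr_realpow D_def)
      finally have "B * D x powr (real (k + 1) + 0 + (- L) - L * real (length ds)) \<le> B * (infdist x \<Sigma>)\<^sup>2"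
        using B(1) by (intro mult_left_mono)
      then show ?thesis using B(2) x by force
    qed
    then show ?thesis unfolding A_def by blast
  qed
  have "Ck_on r (ball 0 (R/8)) h"
    using glue_zero[OF open_ball \<Sigma>(1) _ ch bh] by (simp add: h_def)
  then show ?thesis unfolding h_def[abs_def] Q_def .
qed

lemma division_identity:
  assumes "closed \<Sigma>" "0 \<in> \<Sigma>" and C: "C > 0" "C * infdist x \<Sigma> ^ N \<le> (\<Sum>g\<in>G. \<bar>g x\<bar>)" and fin: "finite G"
    and f: "x \<in> \<Sigma> \<Longrightarrow> f x = 0"
  shows "f x = (\<Sum>g\<in>G. (if x \<in> \<Sigma> then 0 else f x * g x * inverse (\<Sum>g\<in>G. g x * g x)) * g x)"
proof (cases "x \<in> \<Sigma>")
  case False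
  have "infdist x \<Sigma> > 0" using False assms by (intro infdist_pos_not_in_closed) auto
  then have pos: "0 < (\<Sum>g\<in>G. \<bar>g x\<bar>)" using C by (smt (verit) mult_pos_pos zero_less_power)
  have "(\<Sum>g\<in>G. g x * g x) \<noteq> 0"
  proof
    assume "(\<Sum>g\<in>G. g x * g x) = 0"
    then have "\<forall>g\<in>G. g x * g x = 0" using fin by (subst (asm) sum_nonneg_eq_0_iff) auto
    then have "(\<Sum>g\<in>G. \<bar>g x\<bar>) = 0" by (intro sum.neutral) auto
    then show False using pos by simp
  qed
  moreover have "(\<Sum>g\<in>G. f x * g x * inverse (\<Sum>g\<in>G. g x * g x) * g x) = f x * inverse (\<Sum>g\<in>G. g x * g x) * (\<Sum>g\<in>G. g x * g x)"
    unfolding sum_distrib_left by (intro sum.cong) (auto simp: algebra_simps)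
  ultimately show ?thesis using False by simp
qed (use f in simp)

lemma lojasiewicz_division_setup:
  fixes f :: "real^'n::finite \<Rightarrow> real" and \<Sigma> U :: "(real^'n) set" and G :: "(real^'n \<Rightarrow> real) set"
  assumes \<Sigma>: "0 \<in> \<Sigma>" and fin: "finite G" and sm: "\<And>g. g \<in> G \<Longrightarrow> smooth_germ g" and f: "smooth_germ f"
    and ev: "\<forall>\<^sub>F x in nhds 0. C * infdist x \<Sigma> ^ N \<le> (\<Sum>g\<in>G. \<bar>g x\<bar>)"
    and U: "open U" "0 \<in> U"
  obtains R where "0 < R" "R \<le> 1" "\<And>g k. g \<in> G \<Longrightarrow> Ck_on k (ball 0 R) g" "\<And>k. Ck_on k (ball 0 R) f"
    "\<And>x. x \<in> ball 0 R \<Longrightarrow> C * infdist x \<Sigma> ^ N \<le> (\<Sum>g\<in>G. \<bar>g x\<bar>)" "ball 0 R \<subseteq> U"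
proof -
  obtain R1 where R1: "R1 > 0" "\<And>g k. g \<in> insert f G \<Longrightarrow> Ck_on k (ball 0 R1) g"
    by (rule smooth_germs_common[of "insert f G"]) (use fin sm f that in auto)
  obtain R2 where R2: "R2 > 0" "\<And>x. dist x 0 < R2 \<Longrightarrow> C * infdist x \<Sigma> ^ N \<le> (\<Sum>g\<in>G. \<bar>g x\<bar>)"
    using ev unfolding eventually_nhds_metric by blast
  obtain R3 where R3: "R3 > 0" "ball 0 R3 \<subseteq> U" using U open_contains_ball by blast
  define R where "R = min (min R1 R2) (min R3 1)"
  show thesis
  proof
    show "0 < R" "R \<le> 1" using R1 R2 R3 by (auto simp: R_def)
    show "Ck_on k (ball 0 R) g" if "g \<in> G" for g k
      by (rule Ck_on_subset[OF R1(2)]) (use that in \<open>auto simp: R_def\<close>)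
    show "Ck_on k (ball 0 R) f" for k
      by (rule Ck_on_subset[OF R1(2)]) (auto simp: R_def)
    show "C * infdist x \<Sigma> ^ N \<le> (\<Sum>g\<in>G. \<bar>g x\<bar>)" if "x \<in> ball 0 R" for x
      using R2(2)[of x] that by (auto simp: R_def)
    show "ball 0 R \<subseteq> U" using R3 by (auto simp: R_def)
  qed
qed

text \<open>Neither the quotient formula nor the ball of radius \<open>R/8\<close> depends on
  \<open>r\<close>. A flat numerator satisfies the jet condition for every \<open>r\<close>, so the
  same coefficients are of class C^r for all \<open>r\<close> at once.\<close>

lemma lojasiewicz_imp_flat_subset:
  assumes \<Sigma>: "closed \<Sigma>" "0 \<in> \<Sigma>" and fin: "finite G" and sm: "\<And>g. g \<in> G \<Longrightarrow> smooth_germ g" and "lojasiewicz \<Sigma> G"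
  shows "flat_subset \<Sigma> G"
  unfolding flat_subset_def
proof (intro allI impI)
  fix f assume "flat_on \<Sigma> f"
  then obtain U where f: "smooth_germ f" and U: "open U" "0 \<in> U" "\<And>x ds. x \<in> \<Sigma> \<inter> U \<Longrightarrow> pd ds f x = 0"
    unfolding flat_on_def by blast
  obtain C N where C: "C > 0" "N \<ge> 1" "\<forall>\<^sub>F x in nhds 0. C * infdist x \<Sigma> ^ N \<le> (\<Sum>g\<in>G. \<bar>g x\<bar>)"
    by (rule lojasiewiczE[OF \<Sigma>(2) assms(5)]) (rule that)
  obtain R where R: "0 < R" "R \<le> 1" "\<And>g k. g \<in> G \<Longrightarrow> Ck_on k (ball 0 R) g" "\<And>k. Ck_on k (ball 0 R) f"
    "\<And>x. x \<in> ball 0 R \<Longrightarrow> C * infdist x \<Sigma> ^ N \<le> (\<Sum>g\<in>G. \<bar>g x\<bar>)" "ball 0 R \<subseteq> U"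
    by (rule lojasiewicz_division_setup[OF \<Sigma>(2) fin sm f C(3) U(1,2)]) (assumption | rule that)+
  let ?h = "\<lambda>g x. if x \<in> \<Sigma> then 0 else f x * g x * inverse (\<Sum>g\<in>G. g x * g x)"
  have "Ck_on r (ball 0 (R/8)) (?h g)" if "g \<in> G" for g r
    by (rule division_Ck[OF \<Sigma> fin R(1-4) C(1,2) R(5) _ that]) (use U(3) R(6) in auto)
  then have "smooth_germ (?h g)" if "g \<in> G" for g using that R(1) by (intro smooth_germI[of "R/8"]) auto
  moreover have "\<forall>\<^sub>F x in nhds 0. f x = (\<Sum>g\<in>G. ?h g x * g x)"
  proof -
    have "\<forall>\<^sub>F x in nhds 0. x \<in> ball 0 R" using R(1) by (intro eventually_nhds_in_open) auto
    then show ?thesis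
    proof eventually_elim
      case (elim x)
      show ?case
        by (rule division_identity[OF \<Sigma> C(1) R(5)[OF elim] fin]) (use U(3)[of x "[]"] R(6) elim in auto)
    qed
  qed
  ultimately show "in_ideal smooth_germ f G" unfolding in_ideal_def by (intro exI[of _ ?h]) blast
qed

text \<open>The difference \<open>f - g0\<close> vanishes to high order on \<Sigma> and is
  divisible; \<open>g0\<close> is restored by adding 1 to its own coefficient.\<close>

lemma lojasiewicz_jet_in_ideal:
  assumes \<Sigma>: "closed \<Sigma>" "0 \<in> \<Sigma>" and fin: "finite G" and sm: "\<And>g. g \<in> G \<Longrightarrow> smooth_germ g"
    and C: "C > 0" "N \<ge> 1" "\<forall>\<^sub>F x in nhds 0. C * infdist x \<Sigma> ^ N \<le> (\<Sum>g\<in>G. \<bar>g x\<bar>)"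
    and f: "smooth_germ f" and g0: "g0 \<in> G" and U: "open U" "0 \<in> U"
    and jet: "\<And>x ds. x \<in> \<Sigma> \<inter> U \<Longrightarrow> length ds \<le> 2 * N * (r + 1) + 2 \<Longrightarrow> pd ds f x = pd ds g0 x"
  shows "in_ideal (Cr_germ r) f G"
proof -
  obtain R where R: "0 < R" "R \<le> 1" "\<And>g k. g \<in> G \<Longrightarrow> Ck_on k (ball 0 R) g" "\<And>k. Ck_on k (ball 0 R) f"
    "\<And>x. x \<in> ball 0 R \<Longrightarrow> C * infdist x \<Sigma> ^ N \<le> (\<Sum>g\<in>G. \<bar>g x\<bar>)" "ball 0 R \<subseteq> U"
    by (rule lojasiewicz_division_setup[OF \<Sigma>(2) fin sm f C(3) U]) (assumption | rule that)+
  define d where "d x = f x - g0 x" for x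
  have d: "Ck_on k (ball 0 R) d" for k unfolding d_def by (intro Ck_on_diff R g0 open_ball)
  have dj: "pd ds d x = 0" if "x \<in> \<Sigma>" "x \<in> ball 0 R" "length ds \<le> 2 * N * (r + 1) + 2" for x ds
    unfolding d_def using pd_diff[OF open_ball that(2) R(4) R(3)[OF g0]] jet[of x ds] that R(6) by auto
  let ?h = "\<lambda>g x. if x \<in> \<Sigma> then 0 else d x * g x * inverse (\<Sum>g\<in>G. g x * g x)"
  let ?k = "\<lambda>g x. ?h g x + (if g = g0 then 1 else 0)"
  have "Ck_on r (ball 0 (R/8)) (?k g)" if "g \<in> G" for g
    by (rule Ck_on_add[OF open_ball division_Ck[OF \<Sigma> fin R(1-3) d C(1,2) R(5) dj that] Ck_on_const[OF open_ball]])
  then have "Cr_germ r (?k g)" if "g \<in> G" for g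
    unfolding Cr_germ_def using that R(1) by (intro exI[of _ "ball 0 (R/8)"]) auto
  moreover have "\<forall>\<^sub>F x in nhds 0. f x = (\<Sum>g\<in>G. ?k g x * g x)"
  proof -
    have "\<forall>\<^sub>F x in nhds 0. x \<in> ball 0 R" using R(1) by (intro eventually_nhds_in_open) auto
    then show ?thesis
    proof eventually_elim
      case (elim x)
      have "d x = (\<Sum>g\<in>G. ?h g x * g x)"
        by (rule division_identity[OF \<Sigma> C(1) R(5)[OF elim] fin]) (use dj[of x "[]"] elim in auto)
      moreover have "(\<Sum>g\<in>G. (if g = g0 then 1 else 0) * g x) = g0 x"
        using fin g0 by (simp add: if_distrib[of "\<lambda>c. c * _"] cong: if_cong)
      ultimately have "d x + g0 x = (\<Sum>g\<in>G. ?h g x * g x + (if g = g0 then 1 else 0) * g x)"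
        unfolding sum.distrib by (simp only:)
      then show ?case by (simp only: distrib_right[symmetric]) (simp add: d_def)
    qed
  qed
  ultimately show ?thesis unfolding in_ideal_def by (intro exI[of _ ?k]) blast
qed

section \<open>Rings and ideals of C^r germs\<close>

lemma Cr_germ_binop:
  assumes f: "Cr_germ r f" and g: "Cr_germ r g"
    and op: "\<And>U. open U \<Longrightarrow> Ck_on r U f \<Longrightarrow> Ck_on r U g \<Longrightarrow> Ck_on r U h"
  shows "Cr_germ r h"
proof -
  obtain U where U: "open U" "0 \<in> U" "Ck_on r U f" using f unfolding Cr_germ_def by blast
  obtain V where V: "open V" "0 \<in> V" "Ck_on r V g" using g unfolding Cr_germ_def by blast
  have "Ck_on r (U \<inter> V) h"
    using U V by (intro op Ck_on_subset[OF U(3)] Ck_on_subset[OF V(3)]) auto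
  then show ?thesis unfolding Cr_germ_def using U V by (intro exI[of _ "U \<inter> V"]) auto
qed

lemma Cr_germ_mult: "Cr_germ r f \<Longrightarrow> Cr_germ r g \<Longrightarrow> Cr_germ r (\<lambda>x. f x * g x)"
  by (rule Cr_germ_binop[where f = f and g = g]) (assumption | rule Ck_on_mult)+

lemma Cr_germ_add: "Cr_germ r f \<Longrightarrow> Cr_germ r g \<Longrightarrow> Cr_germ r (\<lambda>x. f x + g x)"
  by (rule Cr_germ_binop[where f = f and g = g]) (assumption | rule Ck_on_add)+

lemma Cr_germ_sum: "(\<And>i. i \<in> I \<Longrightarrow> Cr_germ r (f i)) \<Longrightarrow> Cr_germ r (\<lambda>x. \<Sum>i\<in>I. f i x)"
proof (induction I rule: infinite_finite_induct)
  case (insert i I)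
  then show ?case by (auto intro: Cr_germ_add)
qed (auto simp: Cr_germ_def intro!: exI[of _ UNIV] Ck_on_const)

lemma in_ideal_trans:
  assumes H: "\<And>g. g \<in> H \<Longrightarrow> in_ideal (Cr_germ r) g G" and f: "in_ideal (Cr_germ r) f H" and fin: "finite H"
  shows "in_ideal (Cr_germ r) f G"
proof -
  obtain c where c: "\<And>g. g \<in> H \<Longrightarrow> Cr_germ r (c g)" "\<forall>\<^sub>F x in nhds 0. f x = (\<Sum>g\<in>H. c g x * g x)"
    using f unfolding in_ideal_def by blast
  have "\<forall>g\<in>H. \<exists>k. (\<forall>e\<in>G. Cr_germ r (k e)) \<and> (\<forall>\<^sub>F x in nhds 0. g x = (\<Sum>e\<in>G. k e x * e x))"
    using H unfolding in_ideal_def by blast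
  from bchoice[OF this] obtain k where k: "\<And>g e. g \<in> H \<Longrightarrow> e \<in> G \<Longrightarrow> Cr_germ r (k g e)"
    "\<And>g. g \<in> H \<Longrightarrow> \<forall>\<^sub>F x in nhds 0. g x = (\<Sum>e\<in>G. k g e x * e x)" by blast
  let ?m = "\<lambda>e x. \<Sum>g\<in>H. c g x * k g e x"
  have "Cr_germ r (?m e)" if "e \<in> G" for e using that by (intro Cr_germ_sum Cr_germ_mult c k)
  moreover have "\<forall>\<^sub>F x in nhds 0. \<forall>g\<in>H. g x = (\<Sum>e\<in>G. k g e x * e x)"
    by (intro eventually_ball_finite fin ballI k)
  with c(2) have "\<forall>\<^sub>F x in nhds 0. f x = (\<Sum>e\<in>G. ?m e x * e x)"
  proof eventually_elim
    case (elim x)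
    have "f x = (\<Sum>g\<in>H. c g x * (\<Sum>e\<in>G. k g e x * e x))" unfolding elim(1) using elim(2) by (intro sum.cong) auto
    also have "\<dots> = (\<Sum>g\<in>H. \<Sum>e\<in>G. c g x * k g e x * e x)" by (simp add: sum_distrib_left mult.assoc)
    also have "\<dots> = (\<Sum>e\<in>G. \<Sum>g\<in>H. c g x * k g e x * e x)" by (rule sum.swap)
    finally show ?case by (simp add: sum_distrib_right)
  qed
  ultimately show ?thesis unfolding in_ideal_def by (intro exI[of _ ?m]) blast
qed

text \<open>A flat \<open>u\<close> takes the value \<open>\<delta>^j\<close> at points where the
  generators sum to less than \<open>\<delta>^(2j+1)\<close>. Membership bounds \<open>u\<close> by
  a constant times that sum, which fails for large \<open>j\<close>.\<close>

lemma flat_subset_imp_lojasiewicz: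
  assumes \<Sigma>: "0 \<in> \<Sigma>" and fin: "finite G" and fs: "flat_subset \<Sigma> G"
  shows "lojasiewicz \<Sigma> G"
proof (rule ccontr)
  assume neg: "\<not> lojasiewicz \<Sigma> G"
  obtain X where X: "\<And>j. (\<Sum>g\<in>G. \<bar>g (X j)\<bar>) < infdist (X j) \<Sigma> ^ Suc (2 * j)" "\<And>j. 0 < infdist (X j) \<Sigma>"
    "\<And>j. norm (X j) \<le> (1/2) ^ j" "\<And>j. norm (X (Suc j)) < infdist (X j) \<Sigma> / 4"
    by (rule fast_sequence[where P = "\<lambda>j x. (\<Sum>g\<in>G. \<bar>g x\<bar>) < infdist x \<Sigma> ^ Suc (2 * j)", OF not_lojasiewiczD[OF neg]])
      (assumption | rule that)+
  define \<delta> where "\<delta> j = infdist (X j) \<Sigma>" for j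
  obtain u where u: "flat_on \<Sigma> u" "\<And>j x. dist x (X j) \<le> \<delta> j / 4 \<Longrightarrow> u x = \<delta> j ^ j + 0 * (x $ undefined - X j $ undefined)"
    by (rule flat_bumps[of \<Sigma> \<delta> X "\<lambda>j. \<delta> j ^ j" "\<lambda>j. 0" undefined]) (use \<Sigma> X in \<open>auto simp: \<delta>_def infdist_nonneg\<close>)
  obtain B where B: "B > 0" "\<forall>\<^sub>F x in nhds 0. \<bar>u x\<bar> \<le> B * (\<Sum>g\<in>G. \<bar>g x\<bar>)"
    using in_ideal_bound[OF _ fin, of smooth_germ u] fs u(1) smooth_germ_Cr_germ Cr_germ_isCont
    unfolding flat_subset_def by blast
  have X0: "X \<longlonglongrightarrow> 0"
    by (rule Lim_null_comparison[OF _ LIMSEQ_realpow_zero[of "1/2"]]) (use X(3) in auto)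
  have "\<forall>\<^sub>F j in sequentially. \<bar>u (X j)\<bar> \<le> B * (\<Sum>g\<in>G. \<bar>g (X j)\<bar>)"
    using eventually_compose_filterlim[OF B(2) X0] .
  moreover have "\<forall>\<^sub>F j in sequentially. (1/2) ^ j < 1 / B"
    using order_tendstoD(2)[OF LIMSEQ_realpow_zero[of "1/2"], of "1/B"] B(1) by simp
  ultimately have "\<forall>\<^sub>F j::nat in sequentially. False"
  proof eventually_elim
    case (elim j)
    have d: "\<delta> j > 0" "\<delta> j \<le> (1/2) ^ j" "\<delta> j \<le> 1"
    proof -
      show "\<delta> j > 0" using X(2) by (simp add: \<delta>_def)
      show le: "\<delta> j \<le> (1/2) ^ j" using infdist_le[OF \<Sigma>, of "X j"] X(3)[of j] by (simp add: \<delta>_def)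
      have "(1/2::real) ^ j \<le> 1" by (rule power_le_one) auto
      then show "\<delta> j \<le> 1" using le by linarith
    qed
    have "\<delta> j ^ j = u (X j)" using u(2)[of "X j" j] d by simp
    also have "\<dots> \<le> B * (\<Sum>g\<in>G. \<bar>g (X j)\<bar>)" using elim(1) by linarith
    also have "\<dots> \<le> B * \<delta> j ^ Suc (2 * j)" using X(1)[of j] B(1) by (intro mult_left_mono) (auto simp: \<delta>_def)
    also have "\<dots> = \<delta> j ^ j * (B * (\<delta> j ^ j * \<delta> j))" by (simp add: mult_2 power_add)
    finally have "\<delta> j ^ j * 1 \<le> \<delta> j ^ j * (B * (\<delta> j ^ j * \<delta> j))" by simp
    then have "1 \<le> B * (\<delta> j ^ j * \<delta> j)" using d(1) by (simp only: mult_le_cancel_left_pos zero_less_power)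
    also have "\<dots> \<le> B * (1 * \<delta> j)" using d B(1) by (intro mult_left_mono mult_right_mono power_le_one) auto
    also have "\<dots> \<le> B * (1/2) ^ j" using d B(1) by simp
    finally have "1 / B \<le> (1/2) ^ j" using B(1) by (simp add: field_simps)
    then show False using elim(2) by linarith
  qed
  then show False by simp
qed

lemma in_ideal_mono:
  assumes "in_ideal smooth_germ f G" "G \<subseteq> H" "finite H" shows "in_ideal smooth_germ f H"
proof -
  obtain h where h: "\<And>g. g \<in> G \<Longrightarrow> smooth_germ (h g)" "\<forall>\<^sub>F x in nhds 0. f x = (\<Sum>g\<in>G. h g x * g x)"
    using assms(1) unfolding in_ideal_def by blast
  let ?k = "\<lambda>g. if g \<in> G then h g else (\<lambda>x. 0)"
  have "smooth_germ (\<lambda>x::real^'a. 0)" by (rule smooth_germI[of 1]) (auto intro: Ck_on_const)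
  then have "\<forall>g\<in>H. smooth_germ (?k g)" using h(1) by auto
  moreover have "(\<Sum>g\<in>H. ?k g x * g x) = (\<Sum>g\<in>G. h g x * g x)" for x
    using assms(2,3) by (intro sum.mono_neutral_cong_right) auto
  ultimately show ?thesis unfolding in_ideal_def using h(2) by (intro exI[of _ ?k]) auto
qed

section \<open>Rigidity and determinacy\<close>

lemma finite_comps: "finite (comps \<phi>)"
  by (simp add: comps_def)

lemma comps_mem: "(\<lambda>x. \<phi> x $ i) \<in> comps \<phi>"
  by (auto simp: comps_def)

lemma comps_zero_iff: "(\<forall>g\<in>comps \<phi>. g x = 0) \<longleftrightarrow> \<phi> x = 0"
  by (auto simp: comps_def vec_eq_iff)

lemma norm_le_comps:
  fixes \<phi> :: "real^'n::finite \<Rightarrow> real^'m::finite"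
  shows "norm (\<phi> x) \<le> real CARD('m) * (\<Sum>g\<in>comps \<phi>. \<bar>g x\<bar>)"
proof -
  have "norm (\<phi> x) \<le> (\<Sum>i\<in>UNIV. \<bar>\<phi> x $ i\<bar>)" by (rule norm_le_l1_cart)
  also have "\<dots> \<le> (\<Sum>i\<in>(UNIV::'m set). (\<Sum>g\<in>comps \<phi>. \<bar>g x\<bar>))"
  proof (rule sum_mono)
    show "\<bar>\<phi> x $ i\<bar> \<le> (\<Sum>g\<in>comps \<phi>. \<bar>g x\<bar>)" for i
      using member_le_sum[of "\<lambda>x. \<phi> x $ i" "comps \<phi>" "\<lambda>g. \<bar>g x\<bar>"] comps_mem finite_comps by auto
  qed
  finally show ?thesis by simp
qed

lemma comps_le_norm:
  fixes \<phi> :: "real^'n::finite \<Rightarrow> real^'m::finite"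
  shows "(\<Sum>g\<in>comps \<phi>. \<bar>g x\<bar>) \<le> real CARD('m) * norm (\<phi> x)"
proof -
  have "(\<Sum>g\<in>comps \<phi>. \<bar>g x\<bar>) \<le> (\<Sum>i\<in>UNIV. ((\<lambda>g. \<bar>g x\<bar>) \<circ> (\<lambda>i x. \<phi> x $ i)) i)"
    unfolding comps_def by (rule sum_image_le) auto
  also have "\<dots> \<le> (\<Sum>i\<in>(UNIV::'m set). norm (\<phi> x))"
    by (intro sum_mono) (simp add: component_le_norm_cart)
  finally show ?thesis by simp
qed

text \<open>The difference is of order \<open>k + 1 > N\<close> in the distance and so cannot spoil
  the lower bound near the origin. The exponent is unchanged, which lets one jet order serve both
  inclusions of ideals.\<close>

lemma lojasiewicz_comps_perturb:
  fixes \<phi> \<psi> :: "real^'n::finite \<Rightarrow> real^'m::finite"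
  assumes \<Sigma>: "closed \<Sigma>" "0 \<in> \<Sigma>" and sm: "smooth_map_germ \<phi>" "smooth_map_germ \<psi>" and jet: "jet_eq k \<Sigma> \<psi> \<phi>"
    and C: "C > 0" "\<forall>\<^sub>F x in nhds 0. C * infdist x \<Sigma> ^ N \<le> (\<Sum>g\<in>comps \<phi>. \<bar>g x\<bar>)" and N: "N \<le> k"
  shows "\<exists>C'>0. \<forall>\<^sub>F x in nhds 0. C' * infdist x \<Sigma> ^ N \<le> (\<Sum>g\<in>comps \<psi>. \<bar>g x\<bar>)"
proof -
  let ?m = "real CARD('m)"
  obtain U where U: "open U" "0 \<in> U" "\<And>x i ds. x \<in> \<Sigma> \<inter> U \<Longrightarrow> length ds \<le> k \<Longrightarrow>
      pd ds (\<lambda>y. \<psi> y $ i) x = pd ds (\<lambda>y. \<phi> y $ i) x"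
    using jet unfolding jet_eq_def by blast
  have comp: "\<exists>B\<ge>0. \<forall>\<^sub>F x in nhds 0. \<bar>\<psi> x $ i - \<phi> x $ i\<bar> \<le> B * infdist x \<Sigma> ^ (k + 1)" for i
  proof -
    obtain R1 where R1: "R1 > 0" "\<And>g l. g \<in> {\<lambda>y. \<psi> y $ i, \<lambda>y. \<phi> y $ i} \<Longrightarrow> Ck_on l (ball 0 R1) g"
      by (rule smooth_germs_common[of "{\<lambda>y. \<psi> y $ i, \<lambda>y. \<phi> y $ i}"])
        (use sm that in \<open>auto simp: smooth_map_germ_def\<close>)
    obtain R2 where R2: "R2 > 0" "ball 0 R2 \<subseteq> U" using U open_contains_ball by blast
    define R where "R = min R1 R2"
    have R: "R > 0" "ball 0 R \<subseteq> U" using R1 R2 by (auto simp: R_def)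
    have c: "Ck_on l (ball 0 R) (\<lambda>y. \<psi> y $ i)" "Ck_on l (ball 0 R) (\<lambda>y. \<phi> y $ i)" for l
      by (rule Ck_on_subset[OF R1(2)]; auto simp: R_def)+
    have cd: "Ck_on l (ball 0 R) (\<lambda>y. \<psi> y $ i - \<phi> y $ i)" for l
      by (intro Ck_on_diff c open_ball)
    have dj: "pd ds (\<lambda>y. \<psi> y $ i - \<phi> y $ i) x = 0" if "x \<in> \<Sigma>" "x \<in> ball 0 R" "length ds \<le> k" for x ds
      using pd_diff[OF open_ball that(2) c] U(3)[of x ds i] that R(2) by auto
    have "\<exists>B\<ge>0. \<forall>x\<in>ball 0 (R/8). \<bar>pd [] (\<lambda>y. \<psi> y $ i - \<phi> y $ i) x\<bar> \<le> B * infdist x \<Sigma> ^ (k + 1 - length ([]::'n list))"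
      by (rule jet_zero_order[OF \<Sigma> R(1) cd dj]) auto
    then obtain B where B: "B \<ge> 0" "\<And>x. x \<in> ball 0 (R/8) \<Longrightarrow> \<bar>\<psi> x $ i - \<phi> x $ i\<bar> \<le> B * infdist x \<Sigma> ^ (k + 1)"
      by auto
    have "\<forall>\<^sub>F x in nhds 0. x \<in> ball 0 (R/8)" using R(1) by (intro eventually_nhds_in_open) auto
    then have "\<forall>\<^sub>F x in nhds 0. \<bar>\<psi> x $ i - \<phi> x $ i\<bar> \<le> B * infdist x \<Sigma> ^ (k + 1)"
      by eventually_elim (rule B(2))
    then show ?thesis using B(1) by blast
  qed
  then have "\<forall>i. \<exists>B. B \<ge> 0 \<and> (\<forall>\<^sub>F x in nhds 0. \<bar>\<psi> x $ i - \<phi> x $ i\<bar> \<le> B * infdist x \<Sigma> ^ (k + 1))"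
    by blast
  from choice[OF this] obtain B where
    B: "\<And>i. B i \<ge> 0" "\<And>i. \<forall>\<^sub>F x in nhds 0. \<bar>\<psi> x $ i - \<phi> x $ i\<bar> \<le> B i * infdist x \<Sigma> ^ (k + 1)"
    by blast
  define S where "S = (\<Sum>i\<in>UNIV. B i)"
  have S: "S \<ge> 0" unfolding S_def using B(1) by (intro sum_nonneg) auto
  have "\<forall>\<^sub>F x in nhds 0. \<forall>i. \<bar>\<psi> x $ i - \<phi> x $ i\<bar> \<le> B i * infdist x \<Sigma> ^ (k + 1)"
    by (intro eventually_all_finite B(2))
  \<comment> \<open>Below this distance the difference \<open>S * d^(N+1)\<close> is at most half of
    the lower bound \<open>(C / m) * d^N\<close> of the norm of \<open>\<phi>\<close>, where
    \<open>m\<close> is the dimension of the target.\<close>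
  moreover have "0 < min 1 (C / (2 * ?m * (S + 1)))" using C(1) S by (auto intro!: divide_pos_pos mult_pos_pos)
  note infdist_small[OF \<Sigma>(2) this]
  ultimately have "\<forall>\<^sub>F x in nhds 0. C / (2 * ?m * ?m) * infdist x \<Sigma> ^ N \<le> (\<Sum>g\<in>comps \<psi>. \<bar>g x\<bar>)"
    using C(2)
  proof eventually_elim
    case (elim x)
    let ?d = "infdist x \<Sigma>"
    have d: "0 \<le> ?d" "?d < 1" "?d < C / (2 * ?m * (S + 1))" using elim(2) by (auto simp: infdist_nonneg)
    have "norm (\<psi> x - \<phi> x) \<le> (\<Sum>i\<in>UNIV. \<bar>(\<psi> x - \<phi> x) $ i\<bar>)" by (rule norm_le_l1_cart)
    also have "\<dots> \<le> (\<Sum>i\<in>UNIV. B i * ?d ^ (k + 1))" using elim(1) by (intro sum_mono) simp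
    also have "\<dots> = S * ?d ^ (k + 1)" by (simp add: S_def sum_distrib_right)
    also have "\<dots> \<le> S * ?d ^ (N + 1)" using S N d by (intro mult_left_mono power_decreasing) auto
    also have "\<dots> = (S * ?d) * ?d ^ N" by simp
    also have "\<dots> \<le> (C / (2 * ?m)) * ?d ^ N"
    proof (rule mult_right_mono)
      have "S * ?d \<le> (S + 1) * (C / (2 * ?m * (S + 1)))" using d S by (intro mult_mono) auto
      also have "\<dots> = C / (2 * ?m)"
      proof -
        have "s * (C / (2 * m * s)) = C / (2 * m)" if "s \<noteq> 0" for s m :: real using that by simp
        moreover have "S + 1 \<noteq> 0" using S by linarith
        ultimately show ?thesis by blast
      qed
      finally show "S * ?d \<le> C / (2 * ?m)" .
    qed (use d in simp)
    finally have 1: "norm (\<psi> x - \<phi> x) \<le> (C / (2 * ?m)) * ?d ^ N" .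
    have "C * ?d ^ N \<le> ?m * norm (\<phi> x)" using elim(3) comps_le_norm[where \<phi> = \<phi> and x = x] by linarith
    then have 2: "C / ?m * ?d ^ N \<le> norm (\<phi> x)" by (simp add: field_simps)
    have "norm (\<phi> x) \<le> norm (\<psi> x) + norm (\<psi> x - \<phi> x)"
      by (metis norm_minus_commute norm_triangle_sub)
    moreover have "C / ?m * ?d ^ N = 2 * ((C / (2 * ?m)) * ?d ^ N)" by simp
    ultimately have "(C / (2 * ?m)) * ?d ^ N \<le> norm (\<psi> x)" using 1 2 by linarith
    also have "\<dots> \<le> ?m * (\<Sum>g\<in>comps \<psi>. \<bar>g x\<bar>)" by (rule norm_le_comps)
    finally show ?case by (simp add: field_simps)
  qed
  moreover have "C / (2 * ?m * ?m) > 0" using C(1) by simp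
  ultimately show ?thesis by blast
qed

lemma lojasiewicz_imp_Cr_rigid:
  fixes \<phi> :: "real^'n::finite \<Rightarrow> real^'m::finite"
  assumes \<Sigma>: "closed \<Sigma>" "0 \<in> \<Sigma>" and sm: "smooth_map_germ \<phi>" and lj: "lojasiewicz \<Sigma> (comps \<phi>)"
  shows "Cr_rigid r \<Sigma> \<phi>"
proof -
  obtain C N where C: "C > 0" "N \<ge> 1" "\<forall>\<^sub>F x in nhds 0. C * infdist x \<Sigma> ^ N \<le> (\<Sum>g\<in>comps \<phi>. \<bar>g x\<bar>)"
    by (rule lojasiewiczE[OF \<Sigma>(2) lj]) (rule that)
  define k where "k = 2 * N * (r + 1) + 2"
  have "N * 1 \<le> N * (2 * (r + 1))" by (intro mult_left_mono) auto
  then have Nk: "N \<le> k" by (simp add: k_def algebra_simps)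
  \<comment> \<open>Stated for an arbitrary pair of maps, since it is applied in both directions:
    generators of each ideal lie in the other.\<close>
  have sub: "in_ideal (Cr_germ r) g (comps \<alpha>)"
    if \<alpha>: "smooth_map_germ \<alpha>" and \<beta>: "smooth_map_germ \<beta>" and j: "jet_eq k \<Sigma> \<beta> \<alpha>"
      and l: "c > 0" "\<forall>\<^sub>F x in nhds 0. c * infdist x \<Sigma> ^ N \<le> (\<Sum>g\<in>comps \<alpha>. \<bar>g x\<bar>)" and g: "g \<in> comps \<beta>"
    for \<alpha> \<beta> :: "real^'n \<Rightarrow> real^'m" and c g
  proof -
    obtain i where gi: "g = (\<lambda>x. \<beta> x $ i)" using g by (auto simp: comps_def)
    obtain U where U: "open U" "0 \<in> U" "\<And>x i ds. x \<in> \<Sigma> \<inter> U \<Longrightarrow> length ds \<le> k \<Longrightarrow>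
        pd ds (\<lambda>y. \<beta> y $ i) x = pd ds (\<lambda>y. \<alpha> y $ i) x"
      using j unfolding jet_eq_def by blast
    show ?thesis unfolding gi
      by (rule lojasiewicz_jet_in_ideal[OF \<Sigma> finite_comps _ l(1) C(2) l(2) _ comps_mem[of \<alpha> i] U(1,2)])
        (use \<alpha> \<beta> U(3) in \<open>auto simp: smooth_map_germ_def comps_def k_def\<close>)
  qed
  have "\<exists>\<tau>. R_fix \<Sigma> \<tau> \<and> (\<forall>f. in_ideal (Cr_germ r) f (comps (\<phi> \<circ> \<tau>)) \<longleftrightarrow> in_ideal (Cr_germ r) f (comps \<psi>))"
    if \<psi>: "smooth_map_germ \<psi>" and jet: "jet_eq k \<Sigma> \<psi> \<phi>" for \<psi>
  proof -
    obtain c where c: "c > 0" "\<forall>\<^sub>F x in nhds 0. c * infdist x \<Sigma> ^ N \<le> (\<Sum>g\<in>comps \<psi>. \<bar>g x\<bar>)"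
      using lojasiewicz_comps_perturb[OF \<Sigma> sm \<psi> jet C(1,3) Nk] by blast
    have jet': "jet_eq k \<Sigma> \<phi> \<psi>" using jet unfolding jet_eq_def by metis
    have "in_ideal (Cr_germ r) f (comps \<phi>) \<longleftrightarrow> in_ideal (Cr_germ r) f (comps \<psi>)" for f
      using in_ideal_trans[OF sub[OF \<psi> sm jet' c] _ finite_comps, where f = f]
        in_ideal_trans[OF sub[OF sm \<psi> jet C(1,3)] _ finite_comps, where f = f] by blast
    moreover have "R_fix \<Sigma> id"
      unfolding R_fix_def R_fix_on_def
      by (intro exI[of _ UNIV] exI[of _ id]) (auto simp: homeomorphism_def)
    ultimately show ?thesis by (intro exI[of _ id]) auto
  qed
  then show ?thesis unfolding Cr_rigid_def by blast
qed

lemma ideal_eq_zero_sets: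
  assumes "\<And>g. g \<in> H \<Longrightarrow> in_ideal (Cr_germ r) g G" "finite H"
  shows "\<forall>\<^sub>F x in nhds 0. (\<forall>g\<in>G. g x = 0) \<longrightarrow> (\<forall>g\<in>H. g x = 0)"
proof -
  have "\<forall>\<^sub>F x in nhds 0. \<forall>g\<in>H. (\<forall>e\<in>G. e x = 0) \<longrightarrow> g x = 0"
  proof (intro eventually_ball_finite assms(2) ballI)
    fix g assume "g \<in> H"
    then obtain h where "\<forall>\<^sub>F x in nhds 0. g x = (\<Sum>e\<in>G. h e x * e x)"
      using assms(1) unfolding in_ideal_def by blast
    then show "\<forall>\<^sub>F x in nhds 0. (\<forall>e\<in>G. e x = 0) \<longrightarrow> g x = 0"
      by eventually_elim (auto intro!: sum.neutral)
  qed
  then show ?thesis by eventually_elim blast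
qed

lemma in_ideal_self:
  assumes "finite G" "g \<in> G" shows "in_ideal (Cr_germ r) g G"
  unfolding in_ideal_def
proof (intro exI[of _ "\<lambda>e x. if e = g then 1 else 0"] conjI ballI always_eventually allI)
  show "Cr_germ r (\<lambda>x. if e = g then 1 else 0)" for e
    unfolding Cr_germ_def by (intro exI[of _ UNIV]) (auto intro: Ck_on_const)
  show "g x = (\<Sum>e\<in>G. (if e = g then 1 else 0) * e x)" for x
    using assms by (simp add: if_distrib[of "\<lambda>c. c * _"] cong: if_cong)
qed

text \<open>Equal ideals have equal zero set germs. The zeros of \<open>g\<close> are those of
  \<open>\<phi> \<circ> \<tau>\<close>, so it is the inverse of \<open>\<tau>\<close> that carries
  zeros of \<open>\<phi>\<close> to zeros of \<open>g\<close>.\<close>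

lemma Cr_rigid_imp_fin_SV_det:
  fixes \<phi> :: "real^'n::finite \<Rightarrow> real^'m::finite"
  assumes "Cr_rigid r \<Sigma> \<phi>" shows "fin_SV_det \<Sigma> \<phi>"
proof -
  obtain k where k: "\<And>\<psi>. smooth_map_germ \<psi> \<Longrightarrow> jet_eq k \<Sigma> \<psi> \<phi> \<Longrightarrow>
     \<exists>\<tau>. R_fix \<Sigma> \<tau> \<and> (\<forall>f. in_ideal (Cr_germ r) f (comps (\<phi> \<circ> \<tau>)) \<longleftrightarrow> in_ideal (Cr_germ r) f (comps \<psi>))"
    using assms unfolding Cr_rigid_def by blast
  have "SV_equiv \<Sigma> \<phi> g" if g: "smooth_map_germ g" "jet_eq k \<Sigma> g \<phi>" for g
  proof -
    obtain \<tau> where \<tau>: "R_fix \<Sigma> \<tau>" and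
      id: "\<And>f. in_ideal (Cr_germ r) f (comps (\<phi> \<circ> \<tau>)) \<longleftrightarrow> in_ideal (Cr_germ r) f (comps g)"
      using k[OF g] by blast
    obtain U V \<tau>' where UV: "open U" "open V" "0 \<in> U" "homeomorphism U V \<tau> \<tau>'" "\<tau> 0 = 0"
      "\<And>x. x \<in> \<Sigma> \<inter> U \<Longrightarrow> \<tau> x = x"
      using \<tau> unfolding R_fix_def R_fix_on_def by blast
    have h: "\<And>x. x \<in> U \<Longrightarrow> \<tau>' (\<tau> x) = x" "\<And>y. y \<in> V \<Longrightarrow> \<tau> (\<tau>' y) = y" "\<tau> ` U = V" "\<tau>' ` V = U"
      "continuous_on U \<tau>" "continuous_on V \<tau>'"
      using UV(4) by (auto simp: homeomorphism_def)
    have "\<forall>\<^sub>F x in nhds 0. (\<forall>e\<in>comps (\<phi> \<circ> \<tau>). e x = 0) \<longrightarrow> (\<forall>e\<in>comps g. e x = 0)"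
      by (rule ideal_eq_zero_sets[where r = r]) (use id in_ideal_self finite_comps in blast)+
    moreover have "\<forall>\<^sub>F x in nhds 0. (\<forall>e\<in>comps g. e x = 0) \<longrightarrow> (\<forall>e\<in>comps (\<phi> \<circ> \<tau>). e x = 0)"
      by (rule ideal_eq_zero_sets[where r = r]) (use id in_ideal_self finite_comps in blast)+
    ultimately have "\<forall>\<^sub>F x in nhds 0. \<phi> (\<tau> x) = 0 \<longleftrightarrow> g x = 0"
      by eventually_elim (auto simp: comps_zero_iff)
    then obtain W where W: "open W" "0 \<in> W" "\<And>x. x \<in> W \<Longrightarrow> \<phi> (\<tau> x) = 0 \<longleftrightarrow> g x = 0"
      unfolding eventually_nhds by blast
    \<comment> \<open>\<open>\<tau>\<close> is known to fix \<Sigma> only inside \<open>U\<close>;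
      for the inverse to fix \<Sigma> its domain is cut down to points of \<open>U\<close>.\<close>
    define V1 where "V1 = V \<inter> U"
    define U1 where "U1 = \<tau>' ` V1"
    have U1: "U1 = {x \<in> U. \<tau> x \<in> V1}" unfolding U1_def V1_def using h by force
    then have "U1 = U \<inter> \<tau> -` V1" by auto
    then have oU1: "open U1"
      using continuous_open_preimage[OF h(5) UV(1), of V1] UV(1,2) by (simp add: V1_def open_Int)
    have z: "0 \<in> V1" "0 \<in> U1" "\<tau>' 0 = 0"
    proof -
      have "0 \<in> V" using h(3) UV(3,5) by force
      then show "0 \<in> V1" using UV(3) by (simp add: V1_def)
      then show "0 \<in> U1" unfolding U1 using UV(3,5) by simp
      show "\<tau>' 0 = 0" using h(1)[OF UV(3)] UV(5) by simp
    qed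
    have hom: "homeomorphism V1 U1 \<tau>' \<tau>"
    proof -
      have "homeomorphism V U \<tau>' \<tau>" using UV(4) by (rule homeomorphism_symD)
      then show ?thesis
        by (rule homeomorphism_of_subsets) (use h in \<open>auto simp: V1_def U1_def\<close>)
    qed
    have fixS: "\<tau>' x = x" if "x \<in> \<Sigma> \<inter> V1" for x
      using h(1)[of x] UV(6)[of x] that by (auto simp: V1_def)
    have "R_fix_on \<Sigma> V1 U1 \<tau>' \<tau>"
      unfolding R_fix_on_def using UV oU1 z hom fixS by (auto simp: V1_def)
    moreover have "\<tau>' ` ({x. \<phi> x = 0} \<inter> V1) \<inter> (W \<inter> U1) = {x. g x = 0} \<inter> (W \<inter> U1)"
    proof (intro equalityI subsetI)
      fix y assume y: "y \<in> \<tau>' ` ({x. \<phi> x = 0} \<inter> V1) \<inter> (W \<inter> U1)"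
      then obtain x where x: "y = \<tau>' x" "\<phi> x = 0" "x \<in> V1" by blast
      then have "\<phi> (\<tau> y) = 0" using h(2)[of x] by (simp add: V1_def)
      then show "y \<in> {x. g x = 0} \<inter> (W \<inter> U1)" using W(3)[of y] y by auto
    next
      fix y assume y: "y \<in> {x. g x = 0} \<inter> (W \<inter> U1)"
      then have "\<phi> (\<tau> y) = 0" using W(3)[of y] by auto
      moreover have "\<tau> y \<in> V1" "y = \<tau>' (\<tau> y)" using y h(1)[of y] unfolding U1 by auto
      ultimately show "y \<in> \<tau>' ` ({x. \<phi> x = 0} \<inter> V1) \<inter> (W \<inter> U1)" using y by blast
    qed
    moreover have "open (W \<inter> U1)" "0 \<in> W \<inter> U1" using W oU1 z by auto
    ultimately show ?thesis
      unfolding SV_equiv_def set_germ_eq_def by blast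
  qed
  then show ?thesis unfolding fin_SV_det_def by blast
qed

lemma SV_equiv_imp_V_equiv:
  assumes "SV_equiv \<Sigma> f g" shows "V_equiv \<Sigma> f g"
proof -
  obtain U V \<tau> \<tau>' where R: "R_fix_on \<Sigma> U V \<tau> \<tau>'" and "set_germ_eq (\<tau> ` ({x. f x = 0} \<inter> U)) {x. g x = 0}"
    using assms unfolding SV_equiv_def by blast
  then obtain W where W: "open W" "0 \<in> W" "\<tau> ` ({x. f x = 0} \<inter> U) \<inter> W = {x. g x = 0} \<inter> W"
    unfolding set_germ_eq_def by blast
  have UV: "open U" "open V" "0 \<in> U" "homeomorphism U V \<tau> \<tau>'" "\<tau> 0 = 0"
    and fixS: "\<And>x. x \<in> \<Sigma> \<inter> U \<Longrightarrow> \<tau> x = x"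
    using R by (simp_all add: R_fix_on_def)
  have h: "\<And>x. x \<in> U \<Longrightarrow> \<tau>' (\<tau> x) = x" "\<tau> ` U = V" "continuous_on U \<tau>"
    using UV(4) by (auto simp: homeomorphism_def)
  define W1 where "W1 = U \<inter> \<tau> -` (W \<inter> V)"
  have oW1: "open W1" unfolding W1_def by (rule continuous_open_preimage[OF h(3) UV(1)]) (use W UV in auto)
  have z: "0 \<in> W1" "0 \<in> W \<inter> V" using UV(3,5) W(2) h(2) by (force simp: W1_def)+
  have im: "\<tau> ` ({x. f x = 0} \<inter> W1) = {x. g x = 0} \<inter> (W \<inter> V)"
  proof (intro equalityI subsetI)
    fix y assume "y \<in> \<tau> ` ({x. f x = 0} \<inter> W1)"
    then have "y \<in> \<tau> ` ({x. f x = 0} \<inter> U) \<inter> W" "y \<in> V" by (auto simp: W1_def)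
    then show "y \<in> {x. g x = 0} \<inter> (W \<inter> V)" using W(3) by auto
  next
    fix y assume y: "y \<in> {x. g x = 0} \<inter> (W \<inter> V)"
    then obtain x where "x \<in> U" "f x = 0" "y = \<tau> x" using W(3) by blast
    then show "y \<in> \<tau> ` ({x. f x = 0} \<inter> W1)" using y by (auto simp: W1_def)
  qed
  have "homeomorphism ({x. f x = 0} \<inter> W1) ({x. g x = 0} \<inter> (W \<inter> V)) \<tau> \<tau>'"
    by (rule homeomorphism_of_subsets[OF UV(4)]) (use im in \<open>auto simp: W1_def\<close>)
  moreover have "open (W \<inter> V)" using W UV by auto
  moreover have "\<forall>x\<in>{x. f x = 0} \<inter> \<Sigma> \<inter> W1. \<tau> x = x" using fixS by (auto simp: W1_def)
  ultimately show ?thesis unfolding V_equiv_def using oW1 z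
    by (intro exI[of _ W1] exI[of _ "W \<inter> V"] exI[of _ \<tau>] exI[of _ \<tau>'] conjI)
qed

section \<open>Newton iteration near almost zeros\<close>

definition jacm :: "(real^'n::finite \<Rightarrow> real^'n) \<Rightarrow> real^'n \<Rightarrow> real^'n^'n" where
  "jacm \<phi> x = (\<chi> i j. partial j (\<lambda>y. \<phi> y $ i) x)"

lemma jac_eq_det_jacm: "jac \<phi> x = det (jacm \<phi> x)"
  by (simp add: jac_def jacm_def)

lemma C1_map_has_derivative:
  fixes \<phi> :: "real^'n::finite \<Rightarrow> real^'n"
  assumes "open U" "a \<in> U" "\<And>i. Ck_on 1 U (\<lambda>y. \<phi> y $ i)"
  shows "(\<phi> has_derivative (\<lambda>h. jacm \<phi> a *v h)) (at a)"
  unfolding has_derivative_componentwise_within[of \<phi>]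
proof
  fix b :: "real^'n" assume "b \<in> Basis"
  then obtain i where b: "b = axis i 1" by (auto simp: Basis_vec_def)
  have "((\<lambda>y. \<phi> y $ i) has_derivative (\<lambda>h. \<Sum>j\<in>UNIV. partial j (\<lambda>y. \<phi> y $ i) a * h $ j)) (at a)"
    by (rule C1_has_derivative[OF assms(3) assms(1,2)])
  then show "((\<lambda>x. \<phi> x \<bullet> b) has_derivative (\<lambda>x. (jacm \<phi> a *v x) \<bullet> b)) (at a)"
    by (simp add: b inner_axis matrix_vector_mult_def jacm_def)
qed

section \<open>Isolated nondegenerate zeros and quantitative inverses\<close>

lemma nondegenerate_zero_isolated:
  fixes g :: "real^'n::finite \<Rightarrow> real^'n"
  assumes der: "(g has_derivative (\<lambda>h. A *v h)) (at a)" and det: "det A \<noteq> 0" and "g a = 0"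
  obtains e where "e > 0" "\<And>y. y \<noteq> a \<Longrightarrow> dist y a < e \<Longrightarrow> g y \<noteq> 0"
proof -
  have "invertible A" using det by (simp add: invertible_det_nz)
  then have "inj ((*v) A)"
    unfolding invertible_left_inverse matrix_left_invertible_injective .
  then obtain B where B: "B > 0" "\<And>x. B * norm x \<le> norm (A *v x)"
    using linear_inj_bounded_below_pos[OF matrix_vector_mul_linear[of A]] by blast
  have "B / 2 > 0" using B by simp
  then obtain d where d: "d > 0" "\<And>y. norm (y - a) < d \<Longrightarrow> norm (g y - g a - A *v (y - a)) \<le> B / 2 * norm (y - a)"
    using der unfolding has_derivative_at_alt by blast
  show thesis
  proof
    show "d > 0" by (rule d)
    fix y assume y: "y \<noteq> a" "dist y a < d"
    show "g y \<noteq> 0"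
    proof
      assume "g y = 0"
      then have "norm (A *v (y - a)) \<le> B / 2 * norm (y - a)"
        using d(2)[of y] y assms(3) by (simp add: dist_norm)
      then have "B * norm (y - a) \<le> B / 2 * norm (y - a)" using B(2)[of "y - a"] by linarith
      moreover have "B * norm (y - a) > 0" using B(1) y by simp
      ultimately show False by (simp add: field_simps)
    qed
  qed
qed

lemma det_column_bound:
  fixes A :: "real^'n::finite^'n"
  assumes A: "\<And>i j. \<bar>A $ i $ j\<bar> \<le> M" and M: "M \<ge> 1"
  shows "\<bar>det (\<chi> i j. if j = k then b $ i else A $ i $ j)\<bar> \<le> fact CARD('n) * M ^ CARD('n) * norm b"
proof -
  have term_le: "\<bar>of_int (sign p) * (\<Prod>i\<in>UNIV. if p i = k then b $ i else A $ i $ p i)\<bar> \<le> M ^ CARD('n) * norm b"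
    if p: "p permutes (UNIV::'n set)" for p
  proof -
    obtain i0 where i0: "p i0 = k" using permutes_surj[OF p] by (metis surjD)
    have inj: "p i = k \<longleftrightarrow> i = i0" for i using permutes_inj[OF p] i0 by (metis injD)
    have "\<bar>of_int (sign p) * (\<Prod>i\<in>UNIV. if p i = k then b $ i else A $ i $ p i)\<bar> =
        (\<Prod>i\<in>UNIV. \<bar>if p i = k then b $ i else A $ i $ p i\<bar>)"
      by (simp add: abs_mult abs_prod sign_def)
    also have "\<dots> = \<bar>b $ i0\<bar> * (\<Prod>i\<in>UNIV - {i0}. \<bar>if p i = k then b $ i else A $ i $ p i\<bar>)"
      by (subst prod.remove[of UNIV i0]) (auto simp: i0)
    also have "\<dots> \<le> norm b * (\<Prod>i\<in>UNIV - {i0}. M)"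
      using A by (intro mult_mono prod_mono component_le_norm_cart prod_nonneg) (auto simp: inj)
    also have "(\<Prod>i\<in>UNIV - {i0}. M) = M ^ (CARD('n) - 1)" by simp
    also have "norm b * M ^ (CARD('n) - 1) \<le> norm b * M ^ CARD('n)"
      using M by (intro mult_left_mono power_increasing) auto
    finally show ?thesis by (simp add: mult.commute)
  qed
  have "\<bar>det (\<chi> i j. if j = k then b $ i else A $ i $ j)\<bar> \<le>
      (\<Sum>p\<in>{p. p permutes (UNIV::'n set)}. M ^ CARD('n) * norm b)"
    unfolding det_def by (rule order_trans[OF sum_abs sum_mono]) (use term_le in auto)
  also have "\<dots> = fact CARD('n) * (M ^ CARD('n) * norm b)"
    by (simp add: card_permutations)
  finally show ?thesis by (simp add: mult.assoc)
qed

text \<open>Cramer's rule bounds the inverse by \<open>1 / |det A|\<close> times a constant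
  depending only on the size of the entries. A power lower bound on the Jacobian determinant thus
  becomes one for the derivative.\<close>

lemma matrix_solution_bound:
  fixes A :: "real^'n::finite^'n"
  assumes A: "\<And>i j. \<bar>A $ i $ j\<bar> \<le> M" and M: "M \<ge> 1"
  shows "\<bar>det A\<bar> * norm x \<le> real CARD('n) * fact CARD('n) * M ^ CARD('n) * norm (A *v x)"
proof -
  have "\<bar>det A\<bar> * norm x \<le> \<bar>det A\<bar> * (\<Sum>k\<in>UNIV. \<bar>x $ k\<bar>)"
    by (intro mult_left_mono norm_le_l1_cart) auto
  also have "\<dots> = (\<Sum>k\<in>UNIV. \<bar>x $ k * det A\<bar>)" by (simp add: sum_distrib_left abs_mult mult.commute)
  also have "\<dots> \<le> (\<Sum>k\<in>(UNIV::'n set). fact CARD('n) * M ^ CARD('n) * norm (A *v x))"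
    unfolding cramer_lemma[symmetric] by (intro sum_mono det_column_bound A M)
  finally show ?thesis by (simp add: mult.assoc)
qed

text \<open>Simplified Newton iteration with the derivative frozen at \<open>x\<close>. The third
  condition on \<open>D\<close> makes the map a contraction with factor 1/2, the fourth makes the
  first step at most \<open>\<rho> / 2\<close>, so \<open>cball x \<rho>\<close> is mapped to
  itself. The radius \<open>3 * \<rho>\<close> accommodates coordinate paths between two points of
  that ball.\<close>

lemma newton_zero:
  fixes \<phi> :: "real^'n::finite \<Rightarrow> real^'n"
  assumes ck: "\<And>i. Ck_on 2 U (\<lambda>y. \<phi> y $ i)" and \<rho>: "\<rho> > 0" and U: "cball x (3 * \<rho>) \<subseteq> U"
    and M: "M \<ge> 1" "\<And>i j y. y \<in> cball x (3 * \<rho>) \<Longrightarrow> \<bar>partial j (\<lambda>y. \<phi> y $ i) y\<bar> \<le> M"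
      "\<And>i j k y. y \<in> cball x (3 * \<rho>) \<Longrightarrow> \<bar>partial k (partial j (\<lambda>y. \<phi> y $ i)) y\<bar> \<le> M"
    and K: "K = real CARD('n) * fact CARD('n) * M ^ CARD('n)"
    and D: "D > 0" "\<bar>jac \<phi> x\<bar> \<ge> D" "3 * real CARD('n) ^ 3 * M * K * \<rho> \<le> D / 2" "K * norm (\<phi> x) \<le> D * \<rho> / 2"
  shows "\<exists>z\<in>cball x \<rho>. \<phi> z = 0"
proof -
  let ?n = "real CARD('n)"
  define A where "A = jacm \<phi> x"
  have Aij: "A $ i $ j = partial j (\<lambda>y. \<phi> y $ i) x" for i j by (simp add: A_def jacm_def)
  have Ab: "\<bar>A $ i $ j\<bar> \<le> M" for i j unfolding Aij by (rule M(2)) (use \<rho> in simp)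
  have detA: "\<bar>det A\<bar> \<ge> D" using D(2) by (simp add: A_def jac_eq_det_jacm)
  then have "invertible A" using D(1) by (auto simp: invertible_det_nz)
  then obtain B where AB: "A ** B = mat 1" "B ** A = mat 1" unfolding invertible_def by blast
  have ABv: "A *v (B *v v) = v" "B *v (A *v v) = v" for v
    using AB by (simp_all add: matrix_vector_mul_assoc)
  have K0: "K \<ge> 0" unfolding K using M(1) by simp
  have Bb: "D * norm (B *v v) \<le> K * norm v" for v
  proof -
    have "D * norm (B *v v) \<le> \<bar>det A\<bar> * norm (B *v v)" using detA by (intro mult_right_mono) auto
    also have "\<dots> \<le> K * norm (A *v (B *v v))" unfolding K by (rule matrix_solution_bound[OF Ab M(1)])
    finally show ?thesis by (simp add: ABv)
  qed
  \<comment> \<open>The deviation of \<open>\<phi>\<close> from its linear part at \<open>x\<close>;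
    bounded second derivatives make it Lipschitz with a constant proportional to
    \<open>\<rho>\<close>.\<close>
  define E where "E y = \<phi> y - A *v y" for y
  have E: "norm (E y - E y') \<le> 3 * ?n ^ 3 * M * \<rho> * norm (y - y')" if y: "y \<in> cball x \<rho>" "y' \<in> cball x \<rho>" for y y'
  proof -
    have comp: "\<bar>E y $ l - E y' $ l\<bar> \<le> ?n * (3 * ?n * M * \<rho>) * norm (y - y')" for l
    proof (rule axis_path_bound[where f = "\<lambda>y. E y $ l" and f' = "\<lambda>i w. partial i (\<lambda>y. \<phi> y $ l) w - A $ l $ i"])
      fix w i assume w: "norm (w - y') \<le> norm (y - y')"
      have "norm (y - y') \<le> 2 * \<rho>" using y norm_triangle_ineq[of "y - x" "x - y'"]
        by (simp add: dist_norm norm_minus_commute)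
      then have wx: "norm (w - x) \<le> 3 * \<rho>"
        using w y(2) norm_triangle_ineq[of "w - y'" "y' - x"] by (simp add: dist_norm norm_minus_commute)
      have inb: "v \<in> cball x (3 * \<rho>)" if "norm (v - x) \<le> norm (w - x)" for v
        using that wx by (simp add: dist_norm norm_minus_commute)
      have ck2: "Ck_on (Suc (Suc 0)) U (\<lambda>y. \<phi> y $ l)" using ck[of l] by (simp add: numeral_2_eq_2)
      have "\<bar>partial i (\<lambda>y. \<phi> y $ l) w - partial i (\<lambda>y. \<phi> y $ l) x\<bar> \<le> ?n * M * norm (w - x)"
      proof (rule axis_path_bound[where f' = "\<lambda>k. partial k (partial i (\<lambda>y. \<phi> y $ l))"])
        fix v k assume v: "norm (v - x) \<le> norm (w - x)"
        show "\<bar>partial k (partial i (\<lambda>y. \<phi> y $ l)) v\<bar> \<le> M" by (rule M(3)[OF inb[OF v]])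
        show "((\<lambda>t. partial i (\<lambda>y. \<phi> y $ l) (v + t *\<^sub>R axis k 1)) has_real_derivative
            partial k (partial i (\<lambda>y. \<phi> y $ l)) v) (at 0)"
          by (rule Ck_on_SucD(4)[OF Ck_on_SucD(2)[OF ck2]]) (use inb[OF v] U in auto)
      qed
      also have "\<dots> \<le> ?n * M * (3 * \<rho>)" using wx M(1) by (intro mult_left_mono) auto
      finally show "\<bar>partial i (\<lambda>y. \<phi> y $ l) w - A $ l $ i\<bar> \<le> 3 * ?n * M * \<rho>" by (simp add: Aij mult_ac)
      have "w \<in> U" using inb[of w] U by auto
      then have d1: "((\<lambda>t. \<phi> (w + t *\<^sub>R axis i 1) $ l) has_real_derivative partial i (\<lambda>y. \<phi> y $ l) w) (at 0)"
        by (rule Ck_on_SucD(4)[OF ck2])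
      have "(A *v (w + t *\<^sub>R axis i 1)) $ l = (A *v w) $ l + A $ l $ i * t" for t
      proof -
        have "(A *v axis i 1) $ l = A $ l $ i" by (simp add: matrix_vector_mult_basis column_def)
        then show ?thesis by (simp add: matrix_vector_right_distrib matrix_vector_mult_scaleR mult.commute)
      qed
      moreover have "((\<lambda>t. \<phi> (w + t *\<^sub>R axis i 1) $ l - ((A *v w) $ l + A $ l $ i * t)) has_real_derivative
          partial i (\<lambda>y. \<phi> y $ l) w - A $ l $ i) (at 0)"
        by (rule derivative_eq_intros d1 refl | simp)+
      ultimately show "((\<lambda>t. E (w + t *\<^sub>R axis i 1) $ l) has_real_derivative partial i (\<lambda>y. \<phi> y $ l) w - A $ l $ i) (at 0)"
        by (simp add: E_def)
    qed
    have "norm (E y - E y') \<le> (\<Sum>l\<in>UNIV. \<bar>(E y - E y') $ l\<bar>)" by (rule norm_le_l1_cart)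
    also have "\<dots> \<le> (\<Sum>l\<in>(UNIV::'n set). ?n * (3 * ?n * M * \<rho>) * norm (y - y'))"
      using comp by (intro sum_mono) simp
    also have "\<dots> = 3 * ?n ^ 3 * M * \<rho> * norm (y - y')" by (simp add: power3_eq_cube)
    finally show ?thesis .
  qed
  define T where "T y = y - B *v \<phi> y" for y
  have Tlip: "dist (T y) (T y') \<le> 1/2 * dist y y'" if y: "y \<in> cball x \<rho>" "y' \<in> cball x \<rho>" for y y'
  proof -
    have "T y - T y' = B *v (A *v y) - B *v (A *v y') - (B *v \<phi> y - B *v \<phi> y')" by (simp add: T_def ABv)
    also have "\<dots> = - (B *v (E y - E y'))"
      by (simp add: E_def matrix_vector_mult_diff_distrib)
    finally have "norm (T y - T y') = norm (B *v (E y - E y'))" by simp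
    then have "D * norm (T y - T y') \<le> K * norm (E y - E y')" using Bb by simp
    also have "\<dots> \<le> K * (3 * ?n ^ 3 * M * \<rho> * norm (y - y'))" using E[OF y] K0 by (intro mult_left_mono)
    also have "\<dots> = (3 * ?n ^ 3 * M * K * \<rho>) * norm (y - y')" by simp
    also have "\<dots> \<le> D / 2 * norm (y - y')" using D(3) by (intro mult_right_mono) auto
    finally have "D * norm (T y - T y') \<le> D * (1/2 * norm (y - y'))" by simp
    then show ?thesis using D(1) unfolding dist_norm by (simp only: mult_le_cancel_left_pos)
  qed
  have Tx: "dist (T x) x \<le> \<rho> / 2"
  proof -
    have "D * norm (B *v \<phi> x) \<le> D * (\<rho> / 2)" using Bb[of "\<phi> x"] D(4) by simp
    then have "norm (B *v \<phi> x) \<le> \<rho> / 2" using D(1) by (simp only: mult_le_cancel_left_pos)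
    then show ?thesis by (simp add: T_def dist_norm)
  qed
  have "T ` cball x \<rho> \<subseteq> cball x \<rho>"
  proof (rule image_subsetI)
    fix y assume y: "y \<in> cball x \<rho>"
    have "dist x (T y) \<le> dist x (T x) + dist (T x) (T y)" by (rule dist_triangle)
    also have "\<dots> \<le> \<rho> / 2 + 1/2 * dist x y" using Tx Tlip[of x y] y \<rho> by (simp add: dist_commute)
    also have "\<dots> \<le> \<rho>" using y by simp
    finally show "T y \<in> cball x \<rho>" by simp
  qed
  then have "\<exists>!z\<in>cball x \<rho>. T z = z"
    by (intro Banach_fix[where c = "1/2"]) (use \<rho> Tlip in \<open>auto simp: complete_eq_closed\<close>)
  then obtain z where z: "z \<in> cball x \<rho>" "T z = z" by blast
  then have "B *v \<phi> z = 0" by (simp add: T_def)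
  then have "\<phi> z = 0" using ABv(1)[of "\<phi> z"] by simp
  then show ?thesis using z(1) by blast
qed

lemma smooth_germ_jac:
  assumes "smooth_map_germ \<phi>" shows "smooth_germ (jac \<phi>)"
proof -
  obtain R where R: "R > 0" "\<And>g k. g \<in> comps \<phi> \<Longrightarrow> Ck_on k (ball 0 R) g"
    by (rule smooth_germs_common[OF finite_comps[of \<phi>]])
      (use assms that in \<open>auto simp: smooth_map_germ_def comps_def\<close>)
  have "Ck_on k (ball 0 R) (jac \<phi>)" for k
    unfolding jac_def det_def vec_lambda_beta
    by (intro Ck_on_sum Ck_on_cmult Ck_on_prod open_ball Ck_on_SucD(2)[OF R(2)[OF comps_mem]])
  then show ?thesis by (rule smooth_germI[OF R(1)])
qed

lemma cx_analytic_comps_not_isolated: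
  fixes \<phi> :: "real^'n::finite \<Rightarrow> real^'m::finite"
  assumes cx_analytic: "\<And>i. cx_analytic (\<lambda>x. \<phi> x $ i)" and z: "z \<longlonglongrightarrow> 0" "\<And>j. z j \<noteq> 0" "\<And>j. \<phi> (z j) = 0"
  shows "\<exists>j. \<forall>e>0. \<exists>y. y \<noteq> z j \<and> dist y (z j) < e \<and> \<phi> y = 0"
proof -
  have "\<exists>j. \<forall>e>0. \<exists>y\<in>UNIV. y \<noteq> z j \<and> dist y (z j) < e \<and> (\<forall>f\<in>comps \<phi>. f y = 0)"
    by (rule cx_analytic_zeros_not_isolated) (use assms finite_comps in \<open>auto simp: comps_def\<close>)
  then show ?thesis by (simp add: comps_zero_iff)
qed

text \<open>Where the components are tiny, the Jacobian has to carry the lower bound, so Newton's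
  method finds a zero within half the distance to \<Sigma>. That zero is off \<Sigma>, its Jacobian
  is nonzero by the same inequality, hence it is isolated; such zeros would accumulate at the
  origin.\<close>

lemma lojasiewicz_I_K_imp_lojasiewicz_comps:
  fixes \<phi> :: "real^'n::finite \<Rightarrow> real^'n"
  assumes \<Sigma>: "closed \<Sigma>" "0 \<in> \<Sigma>" and cx_analytic: "\<And>i. cx_analytic (\<lambda>x. \<phi> x $ i)" and lj: "lojasiewicz \<Sigma> (I_K \<phi>)"
  shows "lojasiewicz \<Sigma> (comps \<phi>)"
proof (rule ccontr)
  assume neg: "\<not> lojasiewicz \<Sigma> (comps \<phi>)"
  let ?n = "real CARD('n)"
  obtain C N where C: "C > 0" "N \<ge> 1" and ev: "\<forall>\<^sub>F x in nhds 0. C * infdist x \<Sigma> ^ N \<le> (\<Sum>g\<in>I_K \<phi>. \<bar>g x\<bar>)"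
    by (rule lojasiewiczE[OF \<Sigma>(2) lj]) (rule that)
  have sumK: "(\<Sum>g\<in>I_K \<phi>. \<bar>g x\<bar>) \<le> (\<Sum>g\<in>comps \<phi>. \<bar>g x\<bar>) + \<bar>jac \<phi> x\<bar>" for x
    unfolding I_K_def using finite_comps[of \<phi>] by (cases "jac \<phi> \<in> comps \<phi>") (auto simp: insert_absorb)
  obtain R2 where R2: "R2 > 0" "\<And>x. dist x 0 < R2 \<Longrightarrow> C * infdist x \<Sigma> ^ N \<le> (\<Sum>g\<in>I_K \<phi>. \<bar>g x\<bar>)"
    using ev unfolding eventually_nhds_metric by blast
  have smooth: "smooth_germ g" if "g \<in> comps \<phi>" for g
    using that cx_analytic cx_analytic_imp_smooth_germ by (auto simp: comps_def)
  obtain R1 where R1: "R1 > 0" "\<And>g k. g \<in> comps \<phi> \<Longrightarrow> Ck_on k (ball 0 R1) g"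
    by (rule smooth_germs_common[OF finite_comps[of \<phi>] smooth]) (assumption | rule that)+
  define R where "R = min R1 R2"
  have R: "R > 0" "R \<le> R1" "R \<le> R2" using R1 R2 by (auto simp: R_def)
  have ck: "Ck_on k (ball 0 R) (\<lambda>y. \<phi> y $ i)" for i k
    by (rule Ck_on_subset[OF R1(2)[OF comps_mem]]) (use R in auto)
  have "\<exists>M\<ge>0. \<forall>ds. length ds = l \<longrightarrow> (\<forall>x\<in>cball 0 (R/2). \<bar>pd ds (\<lambda>y. \<phi> y $ i) x\<bar> \<le> M)" for l i
    by (intro bounded_lists_of_length pd_bounded_on_cball[of _ R] ck) (use R in auto)
  then have "\<forall>l i. \<exists>M. M \<ge> 0 \<and> (\<forall>ds. length ds = l \<longrightarrow> (\<forall>x\<in>cball 0 (R/2). \<bar>pd ds (\<lambda>y. \<phi> y $ i) x\<bar> \<le> M))" by blast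
  then obtain m where m: "\<And>l i. m l i \<ge> 0" "\<And>l i ds x. length ds = l \<Longrightarrow> x \<in> cball 0 (R/2) \<Longrightarrow> \<bar>pd ds (\<lambda>y. \<phi> y $ i) x\<bar> \<le> m l i"
    using choice[of "\<lambda>l f. \<forall>i. f i \<ge> 0 \<and> (\<forall>ds. length ds = l \<longrightarrow> (\<forall>x\<in>cball 0 (R/2). \<bar>pd ds (\<lambda>y. \<phi> y $ i) x\<bar> \<le> f i))"]
      choice[of "\<lambda>i M. M \<ge> 0 \<and> (\<forall>ds. length ds = _ \<longrightarrow> (\<forall>x\<in>cball 0 (R/2). \<bar>pd ds (\<lambda>y. \<phi> y $ i) x\<bar> \<le> M))"] by metis
  define M where "M = 1 + (\<Sum>i\<in>UNIV. m 1 i) + (\<Sum>i\<in>UNIV. m 2 i)"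
  have sums: "0 \<le> (\<Sum>i\<in>UNIV. m l i)" "m l i \<le> (\<Sum>i\<in>UNIV. m l i)" for l i
    using m(1) by (auto intro!: sum_nonneg member_le_sum)
  have M1: "M \<ge> 1" "m 1 i \<le> M" "m 2 i \<le> M" for i
    using sums(1)[of 1] sums(1)[of 2] sums(2)[of 1 i] sums(2)[of 2 i] unfolding M_def by linarith+
  have Mp: "\<bar>partial j (\<lambda>y. \<phi> y $ i) y\<bar> \<le> M" "\<bar>partial k (partial j (\<lambda>y. \<phi> y $ i)) y\<bar> \<le> M"
    if "y \<in> cball 0 (R/2)" for i j k y
    using m(2)[of "[j]" 1 y i] m(2)[of "[k, j]" 2 y i] that M1(2,3)[of i] by auto
  define K where "K = ?n * fact CARD('n) * M ^ CARD('n)"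
  have K: "K > 0" unfolding K_def using M1(1) by (intro mult_pos_pos) auto
  \<comment> \<open>One half of \<open>C\<close> remains for the Jacobian; the other half absorbs
    the components.\<close>
  define c where "c = C / 2"
  \<comment> \<open>The value 1/2 keeps the Newton ball within half the distance to \<Sigma>; the
    other term gives the contraction condition.\<close>
  define \<theta> where "\<theta> = min (1/2) (c / (6 * K * ?n ^ 3 * M))"
  have c: "c > 0" using C by (simp add: c_def)
  have \<theta>: "\<theta> > 0" "\<theta> \<le> 1/2" "\<theta> * (6 * K * ?n ^ 3 * M) \<le> c"
  proof -
    have pos: "6 * K * ?n ^ 3 * M > 0" using K M1(1) by simp
    then show "\<theta> > 0" using c by (simp add: \<theta>_def)
    show "\<theta> \<le> 1/2" by (simp add: \<theta>_def)
    have "\<theta> \<le> c / (6 * K * ?n ^ 3 * M)" by (simp add: \<theta>_def)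
    then show "\<theta> * (6 * K * ?n ^ 3 * M) \<le> c" using pos by (simp only: pos_le_divide_eq)
  qed
  obtain X where X: "\<And>j. (\<Sum>g\<in>comps \<phi>. \<bar>g (X j)\<bar>) < infdist (X j) \<Sigma> ^ Suc j" "\<And>j. 0 < infdist (X j) \<Sigma>"
    "\<And>j. norm (X j) \<le> (1/2) ^ j" "\<And>j. norm (X (Suc j)) < infdist (X j) \<Sigma> / 4"
    by (rule fast_sequence[where P = "\<lambda>j x. (\<Sum>g\<in>comps \<phi>. \<bar>g x\<bar>) < infdist x \<Sigma> ^ Suc j", OF not_lojasiewiczD[OF neg]])
      (assumption | rule that)+
  \<comment> \<open>The bounds 1 and \<open>c\<close> make the components smaller than
    \<open>c * d^N\<close>, the third makes the first Newton step short enough, and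
    \<open>R / 8\<close> keeps the balls in the domain.\<close>
  define \<mu> where "\<mu> = min (min 1 c) (min (c * \<theta> / (2 * K * ?n)) (R / 8))"
  have \<mu>: "\<mu> > 0" using c \<theta> K R by (simp add: \<mu>_def)
  have "\<forall>\<^sub>F j in sequentially. (1/2) ^ j < \<mu>"
    using order_tendstoD(2)[OF LIMSEQ_realpow_zero[of "1/2"], of \<mu>] \<mu> by simp
  then obtain J where J: "\<And>j. j \<ge> J \<Longrightarrow> (1/2) ^ j < \<mu>" unfolding eventually_sequentially by blast
  have zero: "\<exists>z. \<phi> z = 0 \<and> dist z (X j) \<le> infdist (X j) \<Sigma> / 2" if j: "j \<ge> J + 2 * N + 1" for j
  proof -
    define x where "x = X j"
    define d where "d = infdist x \<Sigma>"
    have d0: "d > 0" using X(2) by (simp add: d_def x_def)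
    have nx: "norm x < \<mu>" using X(3)[of j] J[of j] j by (simp add: x_def)
    have dx: "d \<le> norm x" using infdist_le[OF \<Sigma>(2), of x] by (simp add: d_def)
    have d\<mu>: "d \<le> 1" "d \<le> c" "d \<le> c * \<theta> / (2 * K * ?n)" "norm x < R / 8" "d < R / 8"
      using nx dx by (auto simp: \<mu>_def)
    \<comment> \<open>The product of the determinant bound \<open>c * d^N\<close> and the radius has
      order \<open>2 * N + 1\<close>; one further factor \<open>d\<close> beats the constants. This
      explains the condition on \<open>j\<close>.\<close>
    have S: "(\<Sum>g\<in>comps \<phi>. \<bar>g x\<bar>) \<le> d * d ^ (2 * N + 1)"
    proof -
      have "(\<Sum>g\<in>comps \<phi>. \<bar>g x\<bar>) \<le> d ^ Suc j" using X(1)[of j] by (simp add: x_def d_def)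
      also have "\<dots> \<le> d ^ Suc (2 * N + 1)" using d0 d\<mu> j by (intro power_decreasing) auto
      finally show ?thesis by simp
    qed
    \<comment> \<open>One power beyond the determinant bound: a multiple of \<open>\<rho>\<close> is
      then dominated by \<open>c * d^N\<close>.\<close>
    define \<rho> where "\<rho> = \<theta> * d ^ (N + 1)"
    have \<rho>: "\<rho> > 0" "\<rho> \<le> d / 2"
    proof -
      show "\<rho> > 0" using \<theta> d0 by (simp add: \<rho>_def)
      have "d ^ (N + 1) \<le> d ^ 1" using d0 d\<mu> by (intro power_decreasing) auto
      then have "\<theta> * d ^ (N + 1) \<le> 1/2 * d" using \<theta> d0 by (intro mult_mono) auto
      then show "\<rho> \<le> d / 2" by (simp add: \<rho>_def)
    qed
    have sub: "cball x (3 * \<rho>) \<subseteq> cball 0 (R/2)"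
    proof
      fix y assume "y \<in> cball x (3 * \<rho>)"
      then have "norm (y - x) \<le> 3 * \<rho>" by (simp add: dist_norm norm_minus_commute)
      then have "norm y \<le> R / 2" using norm_triangle_sub[of y x] \<rho>(2) d\<mu>(4,5) R(1) by linarith
      then show "y \<in> cball 0 (R/2)" by simp
    qed
    have "\<exists>z\<in>cball x \<rho>. \<phi> z = 0"
    proof (rule newton_zero[where U = "ball 0 R" and M = M and K = K and D = "c * d ^ N"])
      show "Ck_on 2 (ball 0 R) (\<lambda>y. \<phi> y $ i)" for i by (rule ck)
      show "cball x (3 * \<rho>) \<subseteq> ball 0 R" using sub R(1) by force
      show "\<bar>partial j (\<lambda>y. \<phi> y $ i) y\<bar> \<le> M" "\<bar>partial k (partial j (\<lambda>y. \<phi> y $ i)) y\<bar> \<le> M"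
        if "y \<in> cball x (3 * \<rho>)" for i j k y using Mp that sub by blast+
      show "c * d ^ N > 0" using c d0 by simp
      show "c * d ^ N \<le> \<bar>jac \<phi> x\<bar>"
      proof -
        have "C * d ^ N \<le> (\<Sum>g\<in>comps \<phi>. \<bar>g x\<bar>) + \<bar>jac \<phi> x\<bar>"
          using R2(2)[of x] sumK[of x] d\<mu>(4) R by (simp add: d_def)
        moreover have "(\<Sum>g\<in>comps \<phi>. \<bar>g x\<bar>) \<le> c * d ^ N"
        proof -
          have "d ^ (2 * N + 1) \<le> d ^ N" using d0 d\<mu> by (intro power_decreasing) auto
          then have "d * d ^ (2 * N + 1) \<le> c * d ^ N" using d\<mu> d0 c by (intro mult_mono) auto
          then show ?thesis using S by linarith
        qed
        moreover have "C * d ^ N = c * d ^ N + c * d ^ N" by (simp add: c_def)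
        ultimately show ?thesis by linarith
      qed
      show "3 * ?n ^ 3 * M * K * \<rho> \<le> c * d ^ N / 2"
      proof -
        have "3 * ?n ^ 3 * M * K * \<rho> = (\<theta> * (6 * K * ?n ^ 3 * M)) * (d * d ^ N) / 2" by (simp add: \<rho>_def)
        also have "\<dots> \<le> c * (1 * d ^ N) / 2"
          using \<theta>(3) d\<mu>(1) d0 c by (intro divide_right_mono mult_mono) auto
        finally show ?thesis by simp
      qed
      show "K * norm (\<phi> x) \<le> c * d ^ N * \<rho> / 2"
      proof -
        have "K * norm (\<phi> x) \<le> K * (?n * (d * d ^ (2 * N + 1)))"
          using order_trans[OF norm_le_comps[of \<phi> x] mult_left_mono[OF S]] K by (intro mult_left_mono) auto
        also have "\<dots> = (K * ?n * d) * d ^ (2 * N + 1)" by simp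
        also have "\<dots> \<le> (c * \<theta> / 2) * d ^ (2 * N + 1)"
        proof (rule mult_right_mono)
          have "2 * K * ?n > 0" using K by simp
          then have "d * (2 * K * ?n) \<le> c * \<theta>" using d\<mu>(3) by (simp only: pos_le_divide_eq)
          then show "K * ?n * d \<le> c * \<theta> / 2" by (simp add: mult_ac)
        qed (use d0 in simp)
        also have "\<dots> = c * d ^ N * \<rho> / 2" by (simp add: \<rho>_def mult_2 power_add)
        finally show ?thesis .
      qed
    qed (use M1(1) \<rho>(1) in \<open>auto simp: K_def\<close>)
    then obtain z where "\<phi> z = 0" "dist x z \<le> \<rho>" by auto
    then show ?thesis using \<rho>(2) by (intro exI[of _ z]) (auto simp: x_def d_def dist_commute)
  qed
  define J' where "J' = J + 2 * N + 1"
  have "\<forall>j. \<exists>z. \<phi> z = 0 \<and> dist z (X (j + J')) \<le> infdist (X (j + J')) \<Sigma> / 2"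
    using zero by (simp add: J'_def)
  from choice[OF this] obtain z where z: "\<And>j. \<phi> (z j) = 0" "\<And>j. dist (z j) (X (j + J')) \<le> infdist (X (j + J')) \<Sigma> / 2"
    by blast
  have zd: "infdist (z j) \<Sigma> > 0" for j
    using infdist_triangle[of "X (j + J')" \<Sigma> "z j"] z(2)[of j] X(2)[of "j + J'"] by (simp add: dist_commute)
  have zn: "norm (z j) \<le> 2 * norm (X (j + J'))" for j
  proof -
    have "infdist (X (j + J')) \<Sigma> \<le> norm (X (j + J'))" using infdist_le[OF \<Sigma>(2), of "X (j + J')"] by simp
    then show ?thesis using z(2)[of j] norm_triangle_sub[of "z j" "X (j + J')"] norm_ge_zero[of "X (j + J')"]
      unfolding dist_norm by linarith
  qed
  have zR: "dist (z j) 0 < R2" for j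
  proof -
    have "norm (X (j + J')) < R / 8" using X(3)[of "j + J'"] J[of "j + J'"] by (simp add: J'_def \<mu>_def)
    then show ?thesis using zn[of j] R by simp
  qed
  have z0: "z \<longlonglongrightarrow> 0"
  proof (rule Lim_null_comparison)
    show "\<forall>\<^sub>F j in sequentially. norm (z j) \<le> 2 * (1/2) ^ (j + J')"
      using zn X(3) by (intro always_eventually allI) (meson mult_left_mono order_trans zero_le_numeral)
    show "(\<lambda>j. 2 * (1/2::real) ^ (j + J')) \<longlonglongrightarrow> 0"
      using tendsto_mult_right_zero[OF LIMSEQ_ignore_initial_segment[OF LIMSEQ_realpow_zero[of "1/2::real"], of J'], of 2] by simp
  qed
  have znz: "z j \<noteq> 0" for j using zd[of j] \<Sigma>(2) by auto
  obtain j where j: "\<forall>e>0. \<exists>y. y \<noteq> z j \<and> dist y (z j) < e \<and> \<phi> y = 0"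
    using cx_analytic_comps_not_isolated[OF cx_analytic z0 znz z(1)] by blast
  \<comment> \<open>At a zero of \<open>\<phi>\<close> the whole lower bound for \<open>I_K\<close>
    falls on the Jacobian, which is therefore nonzero off \<Sigma>.\<close>
  have "(\<Sum>g\<in>comps \<phi>. \<bar>g (z j)\<bar>) = 0"
    by (rule sum.neutral) (use z(1)[of j] comps_zero_iff[of \<phi> "z j"] in auto)
  then have "C * infdist (z j) \<Sigma> ^ N \<le> \<bar>jac \<phi> (z j)\<bar>" using R2(2)[OF zR[of j]] sumK[of "z j"] by linarith
  moreover have "C * infdist (z j) \<Sigma> ^ N > 0" using C zd[of j] by simp
  ultimately have nd: "det (jacm \<phi> (z j)) \<noteq> 0" by (auto simp: jac_eq_det_jacm)
  have der: "(\<phi> has_derivative (\<lambda>h. jacm \<phi> (z j) *v h)) (at (z j))"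
  proof (rule C1_map_has_derivative[of "ball 0 R"])
    have "norm (X (j + J')) < R / 8" using X(3)[of "j + J'"] J[of "j + J'"] by (simp add: J'_def \<mu>_def)
    then show "z j \<in> ball 0 R" using zn[of j] R(1) by simp
  qed (auto intro: ck)
  obtain e where "e > 0" "\<And>y. y \<noteq> z j \<Longrightarrow> dist y (z j) < e \<Longrightarrow> \<phi> y \<noteq> 0"
    by (rule nondegenerate_zero_isolated[OF der nd z(1)]) (rule that)
  then show False using j by blast
qed

section \<open>Proof of the theorem\<close>

text \<open>The determinant of \<open>A + t I\<close> is a polynomial in \<open>t\<close>. It is not
  the zero polynomial, since a shift by more than an operator bound of \<open>A\<close> is
  invertible, so its finitely many roots leave arbitrarily small admissible shifts.\<close>

lemma det_shift_nonzero:
  fixes A :: "real^'n::finite^'n"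
  assumes "e > 0"
  obtains \<epsilon> where "0 < \<epsilon>" "\<epsilon> < e" "det (A + \<epsilon> *\<^sub>R mat 1) \<noteq> 0"
proof -
  define q where "q = (\<Sum>p\<in>{p. p permutes (UNIV::'n set)}. [:of_int (sign p):] *
      (\<Prod>i\<in>UNIV. [:A $ i $ p i, if i = p i then 1 else 0:]))"
  have q: "poly q t = det (A + t *\<^sub>R mat 1)" for t
  proof -
    have "poly q t = (\<Sum>p\<in>{p. p permutes (UNIV::'n set)}. of_int (sign p) *
        (\<Prod>i\<in>UNIV. A $ i $ p i + t * (if i = p i then 1 else 0)))"
      by (simp add: q_def poly_sum poly_prod)
    then show ?thesis by (simp add: det_def mat_def)
  qed
  obtain B where B: "B > 0" "\<And>x. norm (A *v x) \<le> B * norm x"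
    using linear_bounded_pos[OF matrix_vector_mul_linear[of A]] by blast
  have "invertible (A + (B + 1) *\<^sub>R mat 1)"
    unfolding invertible_left_inverse matrix_left_invertible_ker
  proof (intro allI impI)
    fix x assume "(A + (B + 1) *\<^sub>R mat 1) *v x = 0"
    then have "A *v x = - ((B + 1) *\<^sub>R x)"
      by (simp add: matrix_vector_mult_add_rdistrib scaleR_matrix_vector_assoc[symmetric] eq_neg_iff_add_eq_0)
    then have "(B + 1) * norm x = norm (A *v x)" using B(1) by simp
    also have "\<dots> \<le> B * norm x" by (rule B)
    finally have "norm x \<le> 0" by (simp add: algebra_simps)
    then show "x = 0" by simp
  qed
  then have "poly q (B + 1) \<noteq> 0" by (simp add: q invertible_det_nz)
  then have "q \<noteq> 0" by auto
  then have "finite {t. poly q t = 0}" by (rule poly_roots_finite)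
  moreover have "infinite {0<..<e}" using assms by simp
  ultimately have "\<not> {0<..<e} \<subseteq> {t. poly q t = 0}" using finite_subset by blast
  then have "\<exists>t\<in>{0<..<e}. poly q t \<noteq> 0" by blast
  then obtain t where "0 < t" "t < e" "poly q t \<noteq> 0" by auto
  then show thesis using that[of t] by (simp add: q)
qed

text \<open>If \<open>\<phi>\<close> is tiny compared with every power of the distance along a sequence, flat bumps
  produce \<open>g\<close> with isolated zeros at the points of the sequence; a \<open>V\<close>-equivalence would transport
  them to isolated zeros of \<open>\<phi>\<close> accumulating at the origin.\<close>

lemma fin_V_det_imp_lojasiewicz:
  fixes \<phi> :: "real^'n::finite \<Rightarrow> real^'n"
  assumes \<Sigma>: "closed \<Sigma>" "0 \<in> \<Sigma>" and cx_analytic: "\<And>i. cx_analytic (\<lambda>x. \<phi> x $ i)" and \<phi>0: "\<phi> 0 = 0" and V: "fin_V_det \<Sigma> \<phi>"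
  shows "lojasiewicz \<Sigma> (comps \<phi>)"
proof (rule ccontr)
  assume neg: "\<not> lojasiewicz \<Sigma> (comps \<phi>)"
  obtain k where k: "\<And>g. smooth_map_germ g \<Longrightarrow> jet_eq k \<Sigma> g \<phi> \<Longrightarrow> V_equiv \<Sigma> \<phi> g"
    using V unfolding fin_V_det_def by blast
  have smooth: "smooth_germ g" if "g \<in> comps \<phi>" for g
    using that cx_analytic cx_analytic_imp_smooth_germ by (auto simp: comps_def)
  obtain R where R: "R > 0" "\<And>g k. g \<in> comps \<phi> \<Longrightarrow> Ck_on k (ball 0 R) g"
    by (rule smooth_germs_common[OF finite_comps[of \<phi>] smooth]) (assumption | rule that)+
  have ck: "Ck_on k (ball 0 R) (\<lambda>y. \<phi> y $ i)" for i k by (rule R(2)[OF comps_mem])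
  have "\<exists>x. norm x < e \<and> 0 < infdist x \<Sigma> \<and> ((\<Sum>g\<in>comps \<phi>. \<bar>g x\<bar>) < infdist x \<Sigma> ^ Suc j \<and> norm x < R)"
    if "e > 0" for j e
    using not_lojasiewiczD[OF neg, of "min e R" j] that R(1) by auto
  then obtain X where XP: "\<And>j. (\<Sum>g\<in>comps \<phi>. \<bar>g (X j)\<bar>) < infdist (X j) \<Sigma> ^ Suc j \<and> norm (X j) < R"
    and X: "\<And>j. 0 < infdist (X j) \<Sigma>" "\<And>j. norm (X j) \<le> (1/2) ^ j" "\<And>j. norm (X (Suc j)) < infdist (X j) \<Sigma> / 4"
    using fast_sequence[where P = "\<lambda>j x. (\<Sum>g\<in>comps \<phi>. \<bar>g x\<bar>) < infdist x \<Sigma> ^ Suc j \<and> norm x < R" and \<Sigma> = \<Sigma>] by blast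
  define \<delta> where "\<delta> j = infdist (X j) \<Sigma>" for j
  have \<delta>0: "\<delta> j > 0" for j using X(1) by (simp add: \<delta>_def)
  have \<delta>1: "\<delta> j \<le> 1" for j
  proof -
    have "\<delta> j \<le> norm (X j)" using infdist_le[OF \<Sigma>(2), of "X j"] by (simp add: \<delta>_def)
    moreover have "(1/2::real) ^ j \<le> 1" by (rule power_le_one) auto
    ultimately show ?thesis using X(2)[of j] by linarith
  qed
  \<comment> \<open>The shift makes the derivative at \<open>X j\<close> invertible, while staying
    below the size that \<open>flat_bumps\<close> accepts.\<close>
  have "\<forall>j. \<exists>\<epsilon>. 0 < \<epsilon> \<and> \<epsilon> < \<delta> j ^ j \<and> det (jacm \<phi> (X j) + \<epsilon> *\<^sub>R mat 1) \<noteq> 0"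
    using det_shift_nonzero \<delta>0 by (metis zero_less_power)
  from choice[OF this] obtain \<epsilon> where \<epsilon>: "\<And>j. 0 < \<epsilon> j" "\<And>j. \<epsilon> j < \<delta> j ^ j"
    "\<And>j. det (jacm \<phi> (X j) + \<epsilon> j *\<^sub>R mat 1) \<noteq> 0" by blast
  have small: "\<bar>- \<phi> (X j) $ i\<bar> \<le> \<delta> j ^ j" for i j
  proof -
    have "\<bar>\<phi> (X j) $ i\<bar> \<le> (\<Sum>g\<in>comps \<phi>. \<bar>g (X j)\<bar>)"
      using member_le_sum[of "\<lambda>x. \<phi> x $ i" "comps \<phi>" "\<lambda>g. \<bar>g (X j)\<bar>"] comps_mem finite_comps by auto
    also have "\<dots> \<le> \<delta> j ^ Suc j" using XP[of j] by (simp add: \<delta>_def)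
    also have "\<dots> \<le> \<delta> j ^ j" using \<delta>0[of j] \<delta>1[of j] by (intro power_decreasing) auto
    finally show ?thesis by simp
  qed
  have "\<forall>i. \<exists>u. flat_on \<Sigma> u \<and> (\<forall>k. Ck_on k UNIV u) \<and>
      (\<forall>j x. dist x (X j) \<le> \<delta> j / 4 \<longrightarrow> u x = - \<phi> (X j) $ i + \<epsilon> j * (x $ i - X j $ i))"
  proof
    fix i
    obtain u where "flat_on \<Sigma> u" "\<And>k. Ck_on k UNIV u"
      "\<And>j x. dist x (X j) \<le> \<delta> j / 4 \<Longrightarrow> u x = - \<phi> (X j) $ i + \<epsilon> j * (x $ i - X j $ i)"
    proof (rule flat_bumps[of \<Sigma> \<delta> X "\<lambda>j. - \<phi> (X j) $ i" \<epsilon> i])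
      show "\<bar>\<epsilon> j\<bar> \<le> \<delta> j ^ j" for j using \<epsilon>(1,2)[of j] by simp
    qed (use \<Sigma>(2) \<delta>0 X small in \<open>auto simp: \<delta>_def\<close>)
    then show "\<exists>u. flat_on \<Sigma> u \<and> (\<forall>k. Ck_on k UNIV u) \<and>
      (\<forall>j x. dist x (X j) \<le> \<delta> j / 4 \<longrightarrow> u x = - \<phi> (X j) $ i + \<epsilon> j * (x $ i - X j $ i))" by blast
  qed
  from choice[OF this] obtain u where u: "\<And>i. flat_on \<Sigma> (u i)" "\<And>i k. Ck_on k UNIV (u i)"
      "\<And>i j x. dist x (X j) \<le> \<delta> j / 4 \<Longrightarrow> u i x = - \<phi> (X j) $ i + \<epsilon> j * (x $ i - X j $ i)"
    by blast
  \<comment> \<open>A flat perturbation of \<open>\<phi>\<close>. Near \<open>X j\<close> it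
    subtracts the value of \<open>\<phi>\<close> there and adds \<open>\<epsilon> j\<close> times
    the displacement, which creates a nondegenerate zero at \<open>X j\<close>.\<close>
  define g where "g x = (\<chi> i. \<phi> x $ i + u i x)" for x
  have gi: "(\<lambda>x. g x $ i) = (\<lambda>x. \<phi> x $ i + u i x)" for i by (simp add: g_def)
  have uR: "Ck_on k (ball 0 R) (u i)" for k i by (rule Ck_on_subset[OF u(2)]) simp
  have cg: "Ck_on k (ball 0 R) (\<lambda>x. g x $ i)" for k i unfolding gi by (intro Ck_on_add ck uR open_ball)
  have sg: "smooth_map_germ g"
    unfolding smooth_map_germ_def using smooth_germI[OF R(1) cg] by blast
  have "\<forall>i. \<exists>U. open U \<and> 0 \<in> U \<and> (\<forall>x\<in>\<Sigma> \<inter> U. \<forall>ds. pd ds (u i) x = 0)"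
    using u(1) unfolding flat_on_def by blast
  then obtain U where U: "\<And>i. open (U i)" "\<And>i. 0 \<in> U i" "\<And>i x ds. x \<in> \<Sigma> \<inter> U i \<Longrightarrow> pd ds (u i) x = 0"
    using choice[of "\<lambda>i U. open U \<and> 0 \<in> U \<and> (\<forall>x\<in>\<Sigma> \<inter> U. \<forall>ds. pd ds (u i) x = 0)"] by blast
  have jet: "jet_eq k \<Sigma> g \<phi>"
    unfolding jet_eq_def
  proof (intro exI[of _ "ball 0 R \<inter> (\<Inter>i. U i)"] conjI ballI allI impI)
    show "open (ball 0 R \<inter> (\<Inter>i. U i))" using U(1) by (intro open_Int open_INT) auto
    show "0 \<in> ball 0 R \<inter> (\<Inter>i. U i)" using R(1) U(2) by auto
    fix x i and ds :: "'n list" assume x: "x \<in> \<Sigma> \<inter> (ball 0 R \<inter> (\<Inter>i. U i))"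
    have xb: "x \<in> ball 0 R" and xU: "x \<in> \<Sigma> \<inter> U i" using x by auto
    show "pd ds (\<lambda>y. g y $ i) x = pd ds (\<lambda>y. \<phi> y $ i) x"
      unfolding gi pd_add[OF open_ball xb ck uR] U(3)[OF xU] by simp
  qed
  obtain W1 W2 h h' where W: "open W1" "open W2" "0 \<in> W1" "0 \<in> W2"
    and hom: "homeomorphism ({x. \<phi> x = 0} \<inter> W1) ({x. g x = 0} \<inter> W2) h h'"
    and fixS: "\<forall>x\<in>{x. \<phi> x = 0} \<inter> \<Sigma> \<inter> W1. h x = x"
    using k[OF sg jet] unfolding V_equiv_def by (elim exE conjE) (rule that)
  have loc: "g x = \<phi> x - \<phi> (X j) + \<epsilon> j *\<^sub>R (x - X j)" if "dist x (X j) \<le> \<delta> j / 4" for x j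
    using u(3)[OF that] by (simp add: g_def vec_eq_iff)
  have gX: "g (X j) = 0" for j using loc[of "X j" j] \<delta>0[of j] by simp
  have iso: "\<exists>e>0. \<forall>y. y \<noteq> X j \<longrightarrow> dist y (X j) < e \<longrightarrow> g y \<noteq> 0" for j
  proof -
    have "(\<phi> has_derivative (\<lambda>h. jacm \<phi> (X j) *v h)) (at (X j))"
      by (rule C1_map_has_derivative[of "ball 0 R"]) (use XP in \<open>auto intro: ck\<close>)
    then have "((\<lambda>x. \<phi> x - \<phi> (X j) + \<epsilon> j *\<^sub>R (x - X j)) has_derivative (\<lambda>h. jacm \<phi> (X j) *v h - 0 + \<epsilon> j *\<^sub>R (h - 0))) (at (X j))"
      by (intro has_derivative_add has_derivative_diff has_derivative_const has_derivative_scaleR_right has_derivative_ident)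
    then have "((\<lambda>x. \<phi> x - \<phi> (X j) + \<epsilon> j *\<^sub>R (x - X j)) has_derivative (\<lambda>h. (jacm \<phi> (X j) + \<epsilon> j *\<^sub>R mat 1) *v h)) (at (X j))"
      by (simp add: matrix_vector_mult_add_rdistrib scaleR_matrix_vector_assoc[symmetric])
    then have "(g has_derivative (\<lambda>h. (jacm \<phi> (X j) + \<epsilon> j *\<^sub>R mat 1) *v h)) (at (X j))"
      by (rule has_derivative_transform_within_open[where s = "ball (X j) (\<delta> j / 4)"])
        (use \<delta>0[of j] loc[of _ j] in \<open>auto simp: dist_commute\<close>)
    from nondegenerate_zero_isolated[OF this \<epsilon>(3) gX] show ?thesis by metis
  qed
  have hh: "\<And>x. x \<in> {x. \<phi> x = 0} \<inter> W1 \<Longrightarrow> h' (h x) = x" "\<And>y. y \<in> {x. g x = 0} \<inter> W2 \<Longrightarrow> h (h' y) = y"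
    "h ` ({x. \<phi> x = 0} \<inter> W1) = {x. g x = 0} \<inter> W2" "h' ` ({x. g x = 0} \<inter> W2) = {x. \<phi> x = 0} \<inter> W1"
    "continuous_on ({x. \<phi> x = 0} \<inter> W1) h" "continuous_on ({x. g x = 0} \<inter> W2) h'"
    using hom by (auto simp: homeomorphism_def)
  \<comment> \<open>Fixing zeros of \<open>\<phi>\<close> on \<Sigma> pins the origin. Hence the
    preimages of the points \<open>X j\<close> tend to 0 as well.\<close>
  have h0: "h 0 = 0" using fixS \<phi>0 \<Sigma>(2) W(3) by simp
  have h'0: "h' 0 = 0" using hh(1)[of 0] h0 \<phi>0 W(3) by simp
  have g0: "0 \<in> {x. g x = 0} \<inter> W2" using hh(3) h0 \<phi>0 W(3) by force
  have X0: "X \<longlonglongrightarrow> 0"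
    by (rule Lim_null_comparison[OF _ LIMSEQ_realpow_zero[of "1/2"]]) (use X(2) in auto)
  have "\<forall>\<^sub>F j in sequentially. X j \<in> W2" using X0 W(2,4) by (rule topological_tendstoD)
  then obtain J where J: "\<And>j. j \<ge> J \<Longrightarrow> X j \<in> W2" unfolding eventually_sequentially by blast
  define y where "y j = h' (X (j + J))" for j
  have XW: "X (j + J) \<in> {x. g x = 0} \<inter> W2" for j using gX J by simp
  have yW: "y j \<in> {x. \<phi> x = 0} \<inter> W1" for j unfolding y_def using hh(4) XW[of j] by blast
  have hy: "h (y j) = X (j + J)" for j unfolding y_def by (rule hh(2)[OF XW])
  have "y \<longlonglongrightarrow> h' 0"
    unfolding y_def
    by (rule continuous_on_tendsto_compose[OF hh(6) LIMSEQ_ignore_initial_segment[OF X0] g0])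
      (use XW in auto)
  then have y0: "y \<longlonglongrightarrow> 0" by (simp add: h'0)
  have Xnz: "X j \<noteq> 0" for j using X(1)[of j] \<Sigma>(2) by auto
  have ynz: "y j \<noteq> 0" for j using hy[of j] h0 Xnz[of "j + J"] by auto
  obtain j where j: "\<And>e. e > 0 \<Longrightarrow> \<exists>w. w \<noteq> y j \<and> dist w (y j) < e \<and> \<phi> w = 0"
    using cx_analytic_comps_not_isolated[OF cx_analytic y0 ynz] yW by auto
  obtain e where e: "e > 0" "\<And>w. w \<noteq> X (j + J) \<Longrightarrow> dist w (X (j + J)) < e \<Longrightarrow> g w \<noteq> 0"
    using iso[of "j + J"] by blast
  \<comment> \<open>Continuity of \<open>h\<close> sends zeros of \<open>\<phi>\<close> close to
    \<open>y j\<close> into the ball where \<open>X (j + J)\<close> is the only zero of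
    \<open>g\<close>; injectivity then gives the contradiction.\<close>
  obtain d where d: "d > 0" "\<And>w. w \<in> {x. \<phi> x = 0} \<inter> W1 \<Longrightarrow> dist w (y j) < d \<Longrightarrow> dist (h w) (h (y j)) < e"
    using hh(5) yW[of j] e(1) unfolding continuous_on_iff by blast
  obtain d' where d': "d' > 0" "ball (y j) d' \<subseteq> W1" using W(1) yW[of j] open_contains_ball by blast
  obtain w where w: "w \<noteq> y j" "dist w (y j) < min d d'" "\<phi> w = 0" using j[of "min d d'"] d(1) d'(1) by auto
  have wW: "w \<in> {x. \<phi> x = 0} \<inter> W1" using w d'(2) by (auto simp: dist_commute)
  have "g (h w) = 0" using hh(3) wW by blast
  moreover have "h w \<noteq> X (j + J)" using hh(1)[OF wW] hh(1)[OF yW[of j]] hy[of j] w(1) by metis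
  moreover have "dist (h w) (X (j + J)) < e" using d(2)[OF wW] w(2) hy[of j] by simp
  ultimately show False using e(2) by blast
qed

theorem theorem6p8:
  fixes \<Sigma> :: "(real^'n::finite) set" and \<phi> :: "real^'n \<Rightarrow> real^'n"
  assumes "closed \<Sigma>" and "0 \<in> \<Sigma>" and "subanalytic_germ \<Sigma>" and "coherent \<Sigma>"
    and "analytic_map_germ \<phi>" and "\<phi> 0 = 0"
  shows "((\<forall>r. Cr_rigid r \<Sigma> \<phi>) \<longleftrightarrow> fin_SV_det \<Sigma> \<phi>) \<and>
         (fin_SV_det \<Sigma> \<phi> \<longleftrightarrow> fin_V_det \<Sigma> \<phi>) \<and>
         (fin_V_det \<Sigma> \<phi> \<longleftrightarrow> elliptic \<Sigma> (I_K \<phi>)) \<and>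
         (elliptic \<Sigma> (I_K \<phi>) \<longleftrightarrow> flat_subset \<Sigma> (I_K \<phi>)) \<and>
         (flat_subset \<Sigma> (I_K \<phi>) \<longleftrightarrow> flat_subset \<Sigma> (I_T \<phi>))"
proof -
  note \<Sigma> = assms(1,2)
  have cx_analytic: "cx_analytic (\<lambda>x. \<phi> x $ i)" for i
    using assms(5) real_analytic_germ_imp_cx_analytic unfolding analytic_map_germ_def by blast
  have sm: "smooth_map_germ \<phi>"
    unfolding smooth_map_germ_def using cx_analytic cx_analytic_imp_smooth_germ by blast
  have fT: "finite (comps \<phi>)" and fK: "finite (I_K \<phi>)"
    by (auto simp: I_K_def finite_comps)
  have sT: "smooth_germ g" if "g \<in> comps \<phi>" for g
    using that sm by (auto simp: comps_def smooth_map_germ_def)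
  have sK: "smooth_germ g" if "g \<in> I_K \<phi>" for g
    using that sT smooth_germ_jac[OF sm] by (auto simp: I_K_def)
  have ellK: "elliptic \<Sigma> (I_K \<phi>) \<longleftrightarrow> lojasiewicz \<Sigma> (I_K \<phi>)"
    by (rule elliptic_iff_lojasiewicz[OF fK sK \<Sigma>(2)])
  have flatK: "flat_subset \<Sigma> (I_K \<phi>) \<longleftrightarrow> lojasiewicz \<Sigma> (I_K \<phi>)"
    using flat_subset_imp_lojasiewicz[OF \<Sigma>(2) fK] lojasiewicz_imp_flat_subset[OF \<Sigma> fK sK] by blast
  have flatT: "flat_subset \<Sigma> (I_T \<phi>) \<longleftrightarrow> lojasiewicz \<Sigma> (comps \<phi>)"
    unfolding I_T_def using flat_subset_imp_lojasiewicz[OF \<Sigma>(2) fT] lojasiewicz_imp_flat_subset[OF \<Sigma> fT sT] by blast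
  \<comment> \<open>The easy half of \<open>KT\<close> is read off from the inclusion of the ideals,
    since flatness conditions are already known to be equivalent to the inequalities.\<close>
  have "flat_subset \<Sigma> (I_T \<phi>) \<Longrightarrow> flat_subset \<Sigma> (I_K \<phi>)"
    unfolding flat_subset_def using in_ideal_mono[of _ "I_T \<phi>" "I_K \<phi>"] fK
    by (auto simp: I_T_def I_K_def)
  then have KT: "lojasiewicz \<Sigma> (I_K \<phi>) \<longleftrightarrow> lojasiewicz \<Sigma> (comps \<phi>)"
    using lojasiewicz_I_K_imp_lojasiewicz_comps[OF \<Sigma> cx_analytic] flatK flatT by blast
  have rigid: "lojasiewicz \<Sigma> (comps \<phi>) \<Longrightarrow> Cr_rigid r \<Sigma> \<phi>" for r
    by (rule lojasiewicz_imp_Cr_rigid[OF \<Sigma> sm])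
  \<comment> \<open>The return path from rigidity starts at \<open>r = 0\<close>: coefficients are
    merely continuous there, and equality of zero sets is all that is extracted.\<close>
  have SV: "Cr_rigid 0 \<Sigma> \<phi> \<Longrightarrow> fin_SV_det \<Sigma> \<phi>"
    by (rule Cr_rigid_imp_fin_SV_det)
  have VSV: "fin_SV_det \<Sigma> \<phi> \<Longrightarrow> fin_V_det \<Sigma> \<phi>"
    unfolding fin_SV_det_def fin_V_det_def using SV_equiv_imp_V_equiv by blast
  have Vloj: "fin_V_det \<Sigma> \<phi> \<Longrightarrow> lojasiewicz \<Sigma> (comps \<phi>)"
    by (rule fin_V_det_imp_lojasiewicz[OF \<Sigma> cx_analytic assms(6)])
  \<comment> \<open>Rigidity, \<open>SV\<close>-determinacy, \<open>V\<close>-determinacy and the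
    inequality for the components form a cycle; the three ideal conditions are attached through
    \<open>ellK\<close>, \<open>flatK\<close>, \<open>flatT\<close> and \<open>KT\<close>.\<close>
  show ?thesis
    using ellK flatK flatT KT rigid SV VSV Vloj by blast
qed

end
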